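(* Let $\Sigma$ be a discrete-time linear system given by bounded Hilbert space operators $(A,B,C,D)$. Assume that $\Sigma$ is minimal and that its transfer function $F_\Sigma$ has an analytic continuation to a function in the Schur class $\mathcal S(\mathcal U,\mathcal Y)$. Let $H_a$, $H_r$ be the positive-definite operators defined in the context, with inverses $H_a^{-1}$, $H_r^{-1}$. Then: (1) $S_{H_a}$ and $S_{H_r}$ are nondegenerate storage functions for $\Sigma$, or equivalently, $H_a$ and $H_r$ are positive-definite solutions of the generalized KYP-inequality for $\Sigma$. (2) $S_{H_r^{-1}}$ and $S_{H_a^{-1}}$ are storage functions for the adjoint system $\Sigma^*$, or equivalently, $H_r^{-1}$ and $H_a^{-1}$ are positive-definite solutions of the generalized KYP-inequality for $\Sigma^*$.
   Context: System: $\mathcal U,\mathcal X,\mathcal Y$ Hilbert spaces, $A:\mathcal X\to\mathcal X$, $B:\mathcal U\to\mathcal X$, $C:\mathcal X\to\mathcal Y$, $D:\mathcal U\to\mathcal Y$ bounded; $\Sigma$: $\mathbf x(n+1)=A\mathbf x(n)+B\mathbf u(n)$, $\mathbf y(n)=C\mathbf x(n)+D\mathbf u(n)$; $F_\Sigma(\lambda)=D+\lambda C(I-\lambda A)^{-1}B$ near $0$. $\mathcal S(\mathcal U,\mathcal Y)$: holomorphic $F:\mathbb D\to\mathcal L(\mathcal U,\mathcal Y)$ with $\|F(\lambda)\|\le1$ on $\mathbb D$. Minimal: the linear spans of $\{\mathrm{Im}\,A^kB\}_{k\ge0}$ and of $\{\mathrm{Im}\,A^{*k}C^*\}_{k\ge0}$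 are both dense in $\mathcal X$. The adjoint system $\Sigma^*$ evolves in backward time: $\mathbf x_*(n-1)=A^*\mathbf x_*(n)+C^*\mathbf u_*(n)$, $\mathbf y_*(n)=B^*\mathbf x_*(n)+D^*\mathbf u_*(n)$. Storage functions: $S:\mathcal X\to[0,\infty]$ is a storage function for $\Sigma$ if $S(0)=0$ and $S(\mathbf x(n+1))\le S(\mathbf x(n))+\|\mathbf u(n)\|^2-\|\mathbf y(n)\|^2$ ($n\ge N_0$) along all trajectories $(\mathbf u(n),\mathbf x(n),\mathbf y(n))_{n\ge N_0}$ of $\Sigma$ started from an arbitrary state at an arbitrary $N_0\in\mathbb Z$. $S_*:\mathcal X\to[0,\infty]$ is a storage function for $\Sigma^*$ if $S_*(0)=0$ and $S_*(\mathbf x_*(n-1))\le S_*(\mathbf x_*(n))+\|\mathbf u_*(n)\|^2-\|\mathbf y_*(n)\|^2$ ($n\le N_0$) along all trajectories $(\mathbf u_*(n),\mathbf x_*(n),\mathbf y_*(n))_{n\le N_0}$ of $\Sigma^*$ with arbitrary $\mathbf x_*(N_0)\in\mathcal X$, $N_0\in\mathbb Z$. For a (possibly unbounded, densely defined selfadjoint) positive-semidefinite $H$, $S_H(x)=\|H^{1/2}x\|^2$ for $x\in\mathcal D(H^{1/2})$ and $S_H(x)=+\infty$ otherwise. $S$ is nondegenerate if $S(x)>0$ for all nonzero $x\in\mathcal X$. $H$ is positive-definite if $\langle Hx,x\rangle>0$ for all nonzero $x\in\mathcal D(H)$. Generalized KYP-inequality for $\Sigma$: $A\mathcal D(H^{1/2})\subset\mathcal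 D(H^{1/2})$, $B\mathcal U\subset\mathcal D(H^{1/2})$, and $\|H^{1/2}(Ax+Bu)\|^2+\|Cx+Du\|^2\le\|H^{1/2}x\|^2+\|u\|^2$ for all $x\in\mathcal D(H^{1/2})$, $u\in\mathcal U$. Generalized KYP-inequality for $\Sigma^*$: $A^*\mathcal D(H_*^{1/2})\subset\mathcal D(H_*^{1/2})$, $C^*\mathcal Y\subset\mathcal D(H_*^{1/2})$, and $\|H_*^{1/2}(A^*x_*+C^*u_* )\|^2+\|B^*x_*+D^*u_*\|^2\le\|H_*^{1/2}x_*\|^2+\|u_*\|^2$ for all $x_*\in\mathcal D(H_*^{1/2})$, $u_*\in\mathcal Y$. $\mathbb Z_+=\{0,1,\dots\}$, $\mathbb Z_-=\{-1,-2,\dots\}$. $\mathbf W_o$: domain $\{x\in\mathcal X:\{CA^nx\}_{n\ge0}\in\ell^2_{\mathcal Y}(\mathbb Z_+)\}$, $\mathbf W_ox=\{CA^nx\}_{n\ge0}$. $\mathbf W_c^*$: domain $\{x\in\mathcal X:\{B^*A^{*(-n-1)}x\}_{n\le-1}\in\ell^2_{\mathcal U}(\mathbb Z_-)\}$, $\mathbf W_c^*x=\{B^*A^{*(-n-1)}x\}_{n\le-1}$. Under the assumptions both are closed and densely defined; $\mathbf W_c:=(\mathbf W_c^* )^*$, $\mathbf W_o^*$ is the adjoint of $\mathbf W_o$; $\mathrm{Im}\,\mathbf W_c\subset\mathcal D(\mathbf W_o)$ and $\mathrm{Im}\,\mathbf W_o^*\subset\mathcal D(\mathbf W_c^* )$.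 With $F_0=D$, $F_n=CA^{n-1}B$ ($n\ge1$), the Toeplitz operators $\mathfrak T_{F_\Sigma}=[F_{i-j}]_{0\le j\le i}:\ell^2_{\mathcal U}(\mathbb Z_+)\to\ell^2_{\mathcal Y}(\mathbb Z_+)$ and $\widetilde{\mathfrak T}_{F_\Sigma}=[F_{i-j}]_{j\le i<0}:\ell^2_{\mathcal U}(\mathbb Z_-)\to\ell^2_{\mathcal Y}(\mathbb Z_-)$ are contractions; $D_X=(I-X^*X)^{1/2}$ for a contraction $X$. There is a unique closable operator $X_a$ with domain $\mathrm{Im}\,\mathbf W_c$ mapping into $(\mathrm{Ker}\,D_{\mathfrak T_{F_\Sigma}^*})^\perp$ with $\mathbf W_o|_{\mathrm{Im}\,\mathbf W_c}=D_{\mathfrak T_{F_\Sigma}^*}X_a$, and a unique closable operator $X_r$ with domain $\mathrm{Im}\,\mathbf W_o^*$ mapping into $(\mathrm{Ker}\,D_{\widetilde{\mathfrak T}_{F_\Sigma}})^\perp$ with $\mathbf W_c^*|_{\mathrm{Im}\,\mathbf W_o^*}=D_{\widetilde{\mathfrak T}_{F_\Sigma}}X_r$; their closures $\overline X_a,\overline X_r$ are injective. Define $H_a=\overline X_a^*\overline X_a$ and $H_r=(\overline X_r^*\overline X_r)^{-1}$. *)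

theory Defs
  imports "HOL-Analysis.Analysis"
begin

section \<open>Complex Hilbert spaces\<close>

class scaleC =
  fixes scaleC :: "complex \<Rightarrow> 'a \<Rightarrow> 'a"  (infixr "*\<^sub>C" 75)

text \<open>
  The library has real inner product spaces only. A complex inner product space is taken to be
  a real one with a compatible complex structure: the real inner product is the real part
  of the complex one, so that norm and topology are those of the library. The complex inner
  product is linear in its first argument.
\<close>

class complex_inner = real_inner + scaleC +
  fixes cinner :: "'a \<Rightarrow> 'a \<Rightarrow> complex"
  assumes scaleC_add_right: "a *\<^sub>C (x + y) = a *\<^sub>C x + a *\<^sub>C y"
    and scaleC_add_left: "(a + b) *\<^sub>C x = a *\<^sub>C x + b *\<^sub>C x"
    and scaleC_scaleC: "a *\<^sub>C (b *\<^sub>C x) = (a * b) *\<^sub>C x"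
    and scaleC_of_real: "complex_of_real r *\<^sub>C x = r *\<^sub>R x"
    and cinner_commute: "cinner x y = cnj (cinner y x)"
    and cinner_add_left: "cinner (x + y) z = cinner x z + cinner y z"
    and cinner_scaleC_left: "cinner (a *\<^sub>C x) y = a * cinner x y"
    and inner_eq_Re_cinner: "inner x y = Re (cinner x y)"

class chilbert_space = complex_inner + complete_space

lemma cinner_self: "cinner x x = complex_of_real ((norm (x :: 'a::complex_inner))\<^sup>2)"
proof -
  have "Im (cinner x x) = 0"
    using arg_cong[OF cinner_commute[of x x], of Im] by simp
  moreover have "Re (cinner x x) = (norm x)\<^sup>2"
    by (simp add: inner_eq_Re_cinner[symmetric] power2_norm_eq_inner)
  ultimately show ?thesis by (simp add: complex_eq_iff)
qed

lemma norm_scaleC: "norm (a *\<^sub>C x) = cmod a * norm (x :: 'a::complex_inner)"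
proof -
  have "cinner (a *\<^sub>C x) (a *\<^sub>C x) = a * cnj (a * cinner x x)"
    by (metis cinner_commute cinner_scaleC_left)
  also have "\<dots> = (a * cnj a) * cinner x x"
    by (simp add: cinner_self)
  finally have "complex_of_real ((norm (a *\<^sub>C x))\<^sup>2) = complex_of_real ((cmod a * norm x)\<^sup>2)"
    by (simp add: cinner_self complex_norm_square[symmetric] power_mult_distrib)
  then have "(norm (a *\<^sub>C x))\<^sup>2 = (cmod a * norm x)\<^sup>2"
    using of_real_eq_iff by blast
  then show ?thesis by (simp add: power2_eq_iff_nonneg)
qed

lemma Im_cinner: "Im (cinner x y) = inner ((- \<i>) *\<^sub>C x) (y :: 'a::complex_inner)"
  unfolding inner_eq_Re_cinner by (simp add: cinner_scaleC_left)

lemma cmod_cinner_le: "cmod (cinner x y) \<le> (norm x)\<^sup>2 + (norm (y :: 'a::complex_inner))\<^sup>2"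
proof -
  have "\<bar>Re (cinner x y)\<bar> \<le> norm x * norm y"
    using Cauchy_Schwarz_ineq2[of x y] by (simp add: inner_eq_Re_cinner)
  moreover have "\<bar>Im (cinner x y)\<bar> \<le> norm x * norm y"
    using Cauchy_Schwarz_ineq2[of "(- \<i>) *\<^sub>C x" y] by (simp add: Im_cinner norm_scaleC)
  moreover have "2 * (norm x * norm y) \<le> (norm x)\<^sup>2 + (norm y)\<^sup>2"
    using sum_squares_bound[of "norm x" "norm y"] by simp
  ultimately show ?thesis using cmod_le[of "cinner x y"] by linarith
qed

definition bounded_clinear :: "('a::complex_inner \<Rightarrow> 'b::complex_inner) \<Rightarrow> bool" where
  "bounded_clinear f \<longleftrightarrow> bounded_linear f \<and> (\<forall>c x. f (c *\<^sub>C x) = c *\<^sub>C f x)"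

definition cadjoint :: "('a::complex_inner \<Rightarrow> 'b::complex_inner) \<Rightarrow> 'b \<Rightarrow> 'a" where
  "cadjoint f = (THE g. \<forall>x y. cinner (f x) y = cinner x (g y))"

definition cspan :: "'a::complex_inner set \<Rightarrow> 'a set" where
  "cspan = module.span scaleC"

definition orth_compl :: "'a::complex_inner set \<Rightarrow> 'a set" where
  "orth_compl M = {y. \<forall>x\<in>M. cinner x y = 0}"


section \<open>Square-summable families\<close>

typedef (overloaded) ('i, 'a) ell2 =
  "{f :: 'i \<Rightarrow> 'a::complex_inner. (\<lambda>i. (norm (f i))\<^sup>2) summable_on UNIV}"
  morphisms ell2_nth Abs_ell2
  by (rule exI[of _ "\<lambda>_. 0"]) simp

lemma ell2_summable: "(\<lambda>i. (norm (ell2_nth v i))\<^sup>2) summable_on UNIV"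
  using ell2_nth[of v] by simp

lemma ell2_eqI: "(\<And>i. ell2_nth v i = ell2_nth w i) \<Longrightarrow> v = w"
  by (metis ell2_nth_inject ext)

lemma summable_on_le_real:
  fixes f g :: "'i \<Rightarrow> real"
  assumes "g summable_on UNIV" "\<And>i. 0 \<le> f i" "\<And>i. f i \<le> g i"
  shows "f summable_on UNIV"
  by (rule summable_on_comparison_test[OF assms(1)]) (use assms in auto)

lemma ell2_closed_add:
  fixes f g :: "'i \<Rightarrow> 'a::complex_inner"
  assumes "(\<lambda>i. (norm (f i))\<^sup>2) summable_on UNIV" "(\<lambda>i. (norm (g i))\<^sup>2) summable_on UNIV"
  shows "(\<lambda>i. (norm (f i + g i))\<^sup>2) summable_on UNIV"
proof (rule summable_on_le_real)
  show "(\<lambda>i. 2 * (norm (f i))\<^sup>2 + 2 * (norm (g i))\<^sup>2) summable_on UNIV"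
    by (intro summable_on_add summable_on_cmult_right assms)
  show "(norm (f i + g i))\<^sup>2 \<le> 2 * (norm (f i))\<^sup>2 + 2 * (norm (g i))\<^sup>2" for i
  proof -
    have "(norm (f i + g i))\<^sup>2 \<le> (norm (f i) + norm (g i))\<^sup>2"
      by (intro power_mono norm_triangle_ineq) simp
    also have "\<dots> \<le> 2 * (norm (f i))\<^sup>2 + 2 * (norm (g i))\<^sup>2"
      using sum_squares_bound[of "norm (f i)" "norm (g i)"] by (simp add: power2_sum)
    finally show ?thesis .
  qed
qed simp

lemma ell2_closed_scaleC:
  fixes f :: "'i \<Rightarrow> 'a::complex_inner"
  assumes "(\<lambda>i. (norm (f i))\<^sup>2) summable_on UNIV"
  shows "(\<lambda>i. (norm (c *\<^sub>C f i))\<^sup>2) summable_on UNIV"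
  by (simp add: norm_scaleC power_mult_distrib summable_on_cmult_right[OF assms])

lemma ell2_closed_scaleR:
  fixes f :: "'i \<Rightarrow> 'a::complex_inner"
  assumes "(\<lambda>i. (norm (f i))\<^sup>2) summable_on UNIV"
  shows "(\<lambda>i. (norm (r *\<^sub>R f i))\<^sup>2) summable_on UNIV"
  by (simp add: power_mult_distrib summable_on_cmult_right[OF assms])

lemma ell2_closed_minus:
  fixes f :: "'i \<Rightarrow> 'a::complex_inner"
  assumes "(\<lambda>i. (norm (f i))\<^sup>2) summable_on UNIV" "(\<lambda>i. (norm (g i))\<^sup>2) summable_on UNIV"
  shows "(\<lambda>i. (norm (f i - g i))\<^sup>2) summable_on UNIV"
  using ell2_closed_add[OF assms(1) ell2_closed_scaleR[OF assms(2), of "-1"]] by simp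

lemma ell2_cinner_summable:
  "(\<lambda>i. cinner (ell2_nth v i) (ell2_nth w i)) summable_on UNIV"
proof (rule abs_summable_summable, rule summable_on_le_real)
  show "(\<lambda>i. (norm (ell2_nth v i))\<^sup>2 + (norm (ell2_nth w i))\<^sup>2) summable_on UNIV"
    by (intro summable_on_add ell2_summable)
qed (auto intro: cmod_cinner_le)

instantiation ell2 :: (type, complex_inner) complex_inner
begin

definition "0 = Abs_ell2 (\<lambda>_. 0)"
definition "v + w = Abs_ell2 (\<lambda>i. ell2_nth v i + ell2_nth w i)"
definition "v - w = Abs_ell2 (\<lambda>i. ell2_nth v i - ell2_nth w i)"
definition "- v = Abs_ell2 (\<lambda>i. - ell2_nth v i)" for v :: "('a, 'b) ell2"
definition "r *\<^sub>R v = Abs_ell2 (\<lambda>i. r *\<^sub>R ell2_nth v i)"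
definition "c *\<^sub>C v = Abs_ell2 (\<lambda>i. c *\<^sub>C ell2_nth v i)"
definition "cinner v w = (\<Sum>\<^sub>\<infinity>i. cinner (ell2_nth v i) (ell2_nth w i))" for v w :: "('a, 'b) ell2"
definition "inner v w = Re (cinner v w)" for v w :: "('a, 'b) ell2"
definition "norm v = sqrt (inner v v)" for v :: "('a, 'b) ell2"
definition "dist v w = norm (v - w)" for v w :: "('a, 'b) ell2"
definition "sgn v = inverse (norm v) *\<^sub>R v" for v :: "('a, 'b) ell2"
definition [code del]:
  "(uniformity :: (('a, 'b) ell2 \<times> ('a, 'b) ell2) filter)
     = (INF e\<in>{0<..}. principal {(x, y). dist x y < e})"
definition [code del]:
  "open U \<longleftrightarrow> (\<forall>x\<in>U. eventually (\<lambda>(x', y). x' = x \<longrightarrow> y \<in> U) uniformity)"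
  for U :: "('a, 'b) ell2 set"

lemma ell2_nth_zero [simp]: "ell2_nth 0 i = (0 :: 'b)"
  unfolding zero_ell2_def by (subst Abs_ell2_inverse) auto

lemma ell2_nth_add [simp]: "ell2_nth (v + w) i = ell2_nth v i + (ell2_nth w i :: 'b)"
  unfolding plus_ell2_def
  by (subst Abs_ell2_inverse) (auto intro: ell2_closed_add ell2_summable)

lemma ell2_nth_diff [simp]: "ell2_nth (v - w) i = ell2_nth v i - (ell2_nth w i :: 'b)"
  unfolding minus_ell2_def
  by (subst Abs_ell2_inverse) (auto intro: ell2_closed_minus ell2_summable)

lemma ell2_nth_minus [simp]: "ell2_nth (- v) i = - (ell2_nth v i :: 'b)"
  unfolding uminus_ell2_def
  by (subst Abs_ell2_inverse) (auto intro: ell2_summable)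

lemma ell2_nth_scaleR [simp]: "ell2_nth (r *\<^sub>R v) i = r *\<^sub>R (ell2_nth v i :: 'b)"
  unfolding scaleR_ell2_def
  by (subst Abs_ell2_inverse) (use ell2_closed_scaleR ell2_summable in auto)

lemma ell2_nth_scaleC [simp]: "ell2_nth (c *\<^sub>C v) i = c *\<^sub>C (ell2_nth v i :: 'b)"
  unfolding scaleC_ell2_def
  by (subst Abs_ell2_inverse) (use ell2_closed_scaleC ell2_summable in auto)

lemma ell2_cinner_self:
  "cinner v v = complex_of_real (\<Sum>\<^sub>\<infinity>i. (norm (ell2_nth v i :: 'b))\<^sup>2)"
  unfolding cinner_ell2_def cinner_self
  by (rule infsumI, rule has_sum_of_real, rule has_sum_infsum, rule ell2_summable)

instance
proof
  fix a b c :: complex and r s :: real and x y z :: "('a, 'b) ell2"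
  show "x + y + z = x + (y + z)" "x + y = y + x" "0 + x = x" "- x + x = 0" "x - y = x + - y"
    by (rule ell2_eqI, simp add: algebra_simps)+
  show "r *\<^sub>R (x + y) = r *\<^sub>R x + r *\<^sub>R y" "(r + s) *\<^sub>R x = r *\<^sub>R x + s *\<^sub>R x"
    "r *\<^sub>R s *\<^sub>R x = (r * s) *\<^sub>R x" "1 *\<^sub>R x = x"
    by (rule ell2_eqI, simp add: algebra_simps)+
  show "a *\<^sub>C (x + y) = a *\<^sub>C x + a *\<^sub>C y" "(a + b) *\<^sub>C x = a *\<^sub>C x + b *\<^sub>C x"
    "a *\<^sub>C b *\<^sub>C x = (a * b) *\<^sub>C x" "complex_of_real r *\<^sub>C x = r *\<^sub>R x"
    by (rule ell2_eqI, simp add: scaleC_add_right scaleC_add_left scaleC_scaleC scaleC_of_real)+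
  show comm: "cinner x y = cnj (cinner y x)" for x y :: "('a, 'b) ell2"
    unfolding cinner_ell2_def infsum_cnj[symmetric] by (simp flip: cinner_commute)
  show cadd: "cinner (x + y) z = cinner x z + cinner y z" for x y z :: "('a, 'b) ell2"
    unfolding cinner_ell2_def ell2_nth_add cinner_add_left
    by (rule infsum_add[OF ell2_cinner_summable ell2_cinner_summable])
  show cscale: "cinner (a *\<^sub>C x) y = a * cinner x y" for a and x y :: "('a, 'b) ell2"
    unfolding cinner_ell2_def ell2_nth_scaleC cinner_scaleC_left
    by (rule infsum_cmult_right')
  show "inner x y = Re (cinner x y)" by (rule inner_ell2_def)
  show "inner x y = inner y x"
    unfolding inner_ell2_def by (subst comm) simp
  show "inner (x + y) z = inner x z + inner y z"
    unfolding inner_ell2_def by (simp add: cadd)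
  have "r *\<^sub>R x = complex_of_real r *\<^sub>C x"
    by (rule ell2_eqI, simp add: scaleC_of_real)
  then show "inner (r *\<^sub>R x) y = r * inner x y"
    unfolding inner_ell2_def by (simp add: cscale)
  show "0 \<le> inner x x"
    unfolding inner_ell2_def ell2_cinner_self by (simp add: infsum_nonneg)
  show "(inner x x = 0) = (x = 0)"
  proof
    assume "inner x x = 0"
    then have *: "(\<Sum>\<^sub>\<infinity>i. (norm (ell2_nth x i))\<^sup>2) = 0"
      unfolding inner_ell2_def ell2_cinner_self by simp
    have "(norm (ell2_nth x i))\<^sup>2 = 0" for i
      by (rule nonneg_infsum_le_0D[OF _ ell2_summable[of x]]) (use * in auto)
    then show "x = 0" by (intro ell2_eqI) simp
  qed (simp add: inner_ell2_def ell2_cinner_self)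
  show "norm x = sqrt (inner x x)" by (rule norm_ell2_def)
  show "dist x y = norm (x - y)" by (rule dist_ell2_def)
  show "sgn x = inverse (norm x) *\<^sub>R x" by (rule sgn_ell2_def)
  show "uniformity = (INF e\<in>{0<..}. principal {(x, y). dist x (y :: ('a, 'b) ell2) < e})"
    by (rule uniformity_ell2_def)
  show "open U \<longleftrightarrow> (\<forall>x\<in>U. eventually (\<lambda>(x', y). x' = x \<longrightarrow> y \<in> U) uniformity)"
    for U :: "('a, 'b) ell2 set"
    by (rule open_ell2_def)
qed

end

lemma ell2_norm_sq: "(norm v)\<^sup>2 = (\<Sum>\<^sub>\<infinity>i. (norm (ell2_nth v i))\<^sup>2)"
  using ell2_cinner_self[of v] unfolding cinner_self by (simp only: of_real_eq_iff)

lemma ell2_sum_le_norm_sq: "finite M \<Longrightarrow> (\<Sum>i\<in>M. (norm (ell2_nth v i))\<^sup>2) \<le> (norm v)\<^sup>2"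
  unfolding ell2_norm_sq by (rule finite_sum_le_infsum[OF ell2_summable]) auto

lemma ell2_nth_le_norm: "norm (ell2_nth v i) \<le> norm v"
  using ell2_sum_le_norm_sq[of "{i}" v] by (simp add: power2_le_iff_abs_le)

instance ell2 :: (type, chilbert_space) chilbert_space
proof
  fix X :: "nat \<Rightarrow> ('a, 'b) ell2"
  assume X: "Cauchy X"
  have "Cauchy (\<lambda>n. ell2_nth (X n) i)" for i
    unfolding Cauchy_def
  proof (intro allI impI)
    fix e :: real assume "e > 0"
    then obtain N where N: "\<forall>m\<ge>N. \<forall>n\<ge>N. dist (X m) (X n) < e"
      using X unfolding Cauchy_def by blast
    have "dist (ell2_nth (X m) i) (ell2_nth (X n) i) \<le> dist (X m) (X n)" for m n
      using ell2_nth_le_norm[of "X m - X n" i] by (simp add: dist_norm)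
    with N show "\<exists>N. \<forall>m\<ge>N. \<forall>n\<ge>N. dist (ell2_nth (X m) i) (ell2_nth (X n) i) < e"
      by (meson le_less_trans)
  qed
  then have "\<exists>l. (\<lambda>n. ell2_nth (X n) i) \<longlonglongrightarrow> l" for i
    using Cauchy_convergent convergent_def by blast
  then obtain L where L: "\<And>i. (\<lambda>n. ell2_nth (X n) i) \<longlonglongrightarrow> L i"
    by metis
  have key: "\<exists>N. \<forall>n\<ge>N. \<forall>M. finite M \<longrightarrow> (\<Sum>i\<in>M. (norm (ell2_nth (X n) i - L i))\<^sup>2) \<le> e\<^sup>2"
    if "e > 0" for e :: real
  proof -
    obtain N where N: "\<And>m n. m \<ge> N \<Longrightarrow> n \<ge> N \<Longrightarrow> dist (X m) (X n) < e"
      using X \<open>e > 0\<close> unfolding Cauchy_def by blast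
    have "(\<Sum>i\<in>M. (norm (ell2_nth (X n) i - L i))\<^sup>2) \<le> e\<^sup>2" if "n \<ge> N" "finite M" for n M
    proof (rule LIMSEQ_le_const2)
      show "(\<lambda>m. \<Sum>i\<in>M. (norm (ell2_nth (X n) i - ell2_nth (X m) i))\<^sup>2)
        \<longlonglongrightarrow> (\<Sum>i\<in>M. (norm (ell2_nth (X n) i - L i))\<^sup>2)"
        by (intro tendsto_intros L)
      have "(\<Sum>i\<in>M. (norm (ell2_nth (X n) i - ell2_nth (X m) i))\<^sup>2) \<le> e\<^sup>2" if "m \<ge> N" for m
      proof -
        have "(\<Sum>i\<in>M. (norm (ell2_nth (X n) i - ell2_nth (X m) i))\<^sup>2) \<le> (norm (X n - X m))\<^sup>2"
          using ell2_sum_le_norm_sq[OF \<open>finite M\<close>, of "X n - X m"] by simp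
        also have "\<dots> \<le> e\<^sup>2"
          using N[OF \<open>n \<ge> N\<close> that] by (intro power_mono) (auto simp: dist_norm)
        finally show ?thesis .
      qed
      then show "\<exists>K. \<forall>m\<ge>K. (\<Sum>i\<in>M. (norm (ell2_nth (X n) i - ell2_nth (X m) i))\<^sup>2) \<le> e\<^sup>2"
        by blast
    qed
    then show ?thesis by blast
  qed
  have summ: "(\<lambda>i. (norm (ell2_nth (X n) i - L i))\<^sup>2) summable_on UNIV"
    if "\<forall>M. finite M \<longrightarrow> (\<Sum>i\<in>M. (norm (ell2_nth (X n) i - L i))\<^sup>2) \<le> e\<^sup>2" for n and e :: real
    by (rule nonneg_bdd_above_summable_on) (use that in \<open>auto intro!: bdd_aboveI2\<close>)
  obtain N where "\<forall>M. finite M \<longrightarrow> (\<Sum>i\<in>M. (norm (ell2_nth (X N) i - L i))\<^sup>2) \<le> 1\<^sup>2"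
    using key[of 1] by auto
  from ell2_closed_minus[OF ell2_summable[of "X N"] summ[OF this]]
  have "(\<lambda>i. (norm (L i))\<^sup>2) summable_on UNIV" by simp
  then have nthL: "ell2_nth (Abs_ell2 L) = L"
    by (simp add: Abs_ell2_inverse)
  have "X \<longlonglongrightarrow> Abs_ell2 L"
  proof (rule metric_LIMSEQ_I)
    fix e :: real assume "e > 0"
    then obtain N where N: "\<And>n M. n \<ge> N \<Longrightarrow> finite M \<Longrightarrow>
        (\<Sum>i\<in>M. (norm (ell2_nth (X n) i - L i))\<^sup>2) \<le> (e/2)\<^sup>2"
      using key[of "e/2"] by auto
    have "dist (X n) (Abs_ell2 L) < e" if "n \<ge> N" for n
    proof -
      have "(norm (X n - Abs_ell2 L))\<^sup>2 \<le> (e/2)\<^sup>2"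
        unfolding ell2_norm_sq
        by (rule infsum_le_finite_sums[OF ell2_summable]) (use N[OF that] nthL in auto)
      then have "norm (X n - Abs_ell2 L) \<le> e/2"
        using \<open>e > 0\<close> power2_le_imp_le by fastforce
      then show ?thesis using \<open>e > 0\<close> by (simp add: dist_norm)
    qed
    then show "\<exists>N. \<forall>n\<ge>N. dist (X n) (Abs_ell2 L) < e" by blast
  qed
  then show "convergent X" unfolding convergent_def by blast
qed

text \<open>The index set of the past, \<open>{-1, -2, \<dots>}\<close>.\<close>

typedef zneg = "{n :: int. n < 0}"
  morphisms int_of_zneg Abs_zneg
  by (rule exI[of _ "-1"]) simp


section \<open>Unbounded operators\<close>

text \<open>
  A partially defined operator is represented by its graph. Domain, range, inverse and closure
  are then \<^const>\<open>Domain\<close>, \<^const>\<open>Range\<close>, \<^const>\<open>converse\<close> and \<^const>\<open>closure\<close>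
  (in the product space), and the product \<open>R S\<close> of operators, with its natural domain,
  is \<open>S O R\<close>.
\<close>

definition is_operator :: "('a::complex_inner \<times> 'b::complex_inner) set \<Rightarrow> bool" where
  "is_operator T \<longleftrightarrow> single_valued T \<and> (0, 0) \<in> T
     \<and> (\<forall>x y x' y'. (x, y) \<in> T \<longrightarrow> (x', y') \<in> T \<longrightarrow> (x + x', y + y') \<in> T)
     \<and> (\<forall>c x y. (x, y) \<in> T \<longrightarrow> (c *\<^sub>C x, c *\<^sub>C y) \<in> T)"

definition op_apply :: "('a \<times> 'b) set \<Rightarrow> 'a \<Rightarrow> 'b" where
  "op_apply T x = (THE y. (x, y) \<in> T)"

definition closable :: "('a::complex_inner \<times> 'b::complex_inner) set \<Rightarrow> bool" where
  "closable T \<longleftrightarrow> is_operator T \<and> single_valued (closure T)"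

definition op_restrict :: "('a \<times> 'b) set \<Rightarrow> 'a set \<Rightarrow> ('a \<times> 'b) set" where
  "op_restrict T M = {(x, y) \<in> T. x \<in> M}"

definition op_kernel :: "('a \<times> 'b::zero) set \<Rightarrow> 'a set" where
  "op_kernel T = {x. (x, 0) \<in> T}"

definition op_adjoint :: "('a::complex_inner \<times> 'b::complex_inner) set \<Rightarrow> ('b \<times> 'a) set" where
  "op_adjoint T = {(y, z). \<forall>(x, w) \<in> T. cinner w y = cinner x z}"

definition selfadjoint :: "('a::complex_inner \<times> 'a) set \<Rightarrow> bool" where
  "selfadjoint T \<longleftrightarrow> is_operator T \<and> closure (Domain T) = UNIV \<and> op_adjoint T = T"

definition positive_semidefinite :: "('a::complex_inner \<times> 'a) set \<Rightarrow> bool" where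
  "positive_semidefinite H \<longleftrightarrow> selfadjoint H
     \<and> (\<forall>(x, y) \<in> H. cinner y x \<in> \<real> \<and> 0 \<le> Re (cinner y x))"

definition positive_definite :: "('a::complex_inner \<times> 'a) set \<Rightarrow> bool" where
  "positive_definite H \<longleftrightarrow> positive_semidefinite H
     \<and> (\<forall>(x, y) \<in> H. x \<noteq> 0 \<longrightarrow> 0 < Re (cinner y x))"

definition op_sqrt :: "('a::complex_inner \<times> 'a) set \<Rightarrow> ('a \<times> 'a) set" where
  "op_sqrt H = (THE R. positive_semidefinite R \<and> R O R = H)"

text \<open>\<open>D\<^sub>X = (I - X\<^sup>* X)\<^sup>1\<^sup>/\<^sup>2\<close>\<close>

definition defect :: "('a::complex_inner \<times> 'b::complex_inner) set \<Rightarrow> ('a \<times> 'a) set" where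
  "defect X = op_sqrt {(x, x - z) | x z. (x, z) \<in> X O op_adjoint X}"


section \<open>Linear systems\<close>

definition minimal_system ::
  "('x::chilbert_space \<Rightarrow> 'x) \<Rightarrow> ('u::chilbert_space \<Rightarrow> 'x) \<Rightarrow> ('x \<Rightarrow> 'y::chilbert_space) \<Rightarrow> bool" where
  "minimal_system A B C \<longleftrightarrow>
     closure (cspan (\<Union>k. range (\<lambda>u. (A ^^ k) (B u)))) = UNIV \<and>
     closure (cspan (\<Union>k. range (\<lambda>y. (cadjoint A ^^ k) (cadjoint C y)))) = UNIV"

definition transfer_function ::
  "('x::chilbert_space \<Rightarrow> 'x) \<Rightarrow> ('u::chilbert_space \<Rightarrow> 'x) \<Rightarrow> ('x \<Rightarrow> 'y::chilbert_space) \<Rightarrow> ('u \<Rightarrow> 'y)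
    \<Rightarrow> complex \<Rightarrow> 'u \<Rightarrow> 'y" where
  "transfer_function A B C D z u = D u + z *\<^sub>C C (inv (\<lambda>x. x - z *\<^sub>C A x) (B u))"

text \<open>Holomorphy of operator-valued functions is complex differentiability in operator norm.\<close>

definition schur_class :: "(complex \<Rightarrow> 'u::chilbert_space \<Rightarrow> 'y::chilbert_space) set" where
  "schur_class = {F.
     (\<forall>z\<in>ball 0 1. bounded_clinear (F z) \<and> onorm (F z) \<le> 1) \<and>
     (\<forall>z\<in>ball 0 1. \<exists>F'. bounded_clinear F' \<and>
        ((\<lambda>w. onorm (\<lambda>u. (1 / (w - z)) *\<^sub>C (F w u - F z u) - F' u)) \<longlongrightarrow> 0) (at z))}"

text \<open>Here \<open>F\<close> is a total function, of which only the values on the open unit disc matter.\<close>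

definition has_schur_continuation ::
  "('x::chilbert_space \<Rightarrow> 'x) \<Rightarrow> ('u::chilbert_space \<Rightarrow> 'x) \<Rightarrow> ('x \<Rightarrow> 'y::chilbert_space) \<Rightarrow> ('u \<Rightarrow> 'y)
    \<Rightarrow> bool" where
  "has_schur_continuation A B C D \<longleftrightarrow>
     (\<exists>F\<in>schur_class. \<forall>\<^sub>F z in nhds 0. F z = transfer_function A B C D z)"

definition trajectory ::
  "('x::chilbert_space \<Rightarrow> 'x) \<Rightarrow> ('u::chilbert_space \<Rightarrow> 'x) \<Rightarrow> ('x \<Rightarrow> 'y::chilbert_space) \<Rightarrow> ('u \<Rightarrow> 'y)
    \<Rightarrow> int \<Rightarrow> (int \<Rightarrow> 'u) \<Rightarrow> (int \<Rightarrow> 'x) \<Rightarrow> (int \<Rightarrow> 'y) \<Rightarrow> bool" where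
  "trajectory A B C D N0 u x y \<longleftrightarrow>
     (\<forall>n\<ge>N0. x (n + 1) = A (x n) + B (u n) \<and> y n = C (x n) + D (u n))"

definition adjoint_trajectory ::
  "('x::chilbert_space \<Rightarrow> 'x) \<Rightarrow> ('u::chilbert_space \<Rightarrow> 'x) \<Rightarrow> ('x \<Rightarrow> 'y::chilbert_space) \<Rightarrow> ('u \<Rightarrow> 'y)
    \<Rightarrow> int \<Rightarrow> (int \<Rightarrow> 'y) \<Rightarrow> (int \<Rightarrow> 'x) \<Rightarrow> (int \<Rightarrow> 'u) \<Rightarrow> bool" where
  "adjoint_trajectory A B C D N0 u x y \<longleftrightarrow>
     (\<forall>n\<le>N0. x (n - 1) = cadjoint A (x n) + cadjoint C (u n)
            \<and> y n = cadjoint B (x n) + cadjoint D (u n))"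

text \<open>
  The inequalities are between extended reals; the last two terms on the right are finite, so no
  difference of infinities occurs.
\<close>

definition storage_function ::
  "('x::chilbert_space \<Rightarrow> 'x) \<Rightarrow> ('u::chilbert_space \<Rightarrow> 'x) \<Rightarrow> ('x \<Rightarrow> 'y::chilbert_space) \<Rightarrow> ('u \<Rightarrow> 'y)
    \<Rightarrow> ('x \<Rightarrow> ennreal) \<Rightarrow> bool" where
  "storage_function A B C D S \<longleftrightarrow> S 0 = 0 \<and>
     (\<forall>N0 u x y. trajectory A B C D N0 u x y \<longrightarrow>
       (\<forall>n\<ge>N0. enn2ereal (S (x (n + 1)))
          \<le> enn2ereal (S (x n)) + ereal ((norm (u n))\<^sup>2) - ereal ((norm (y n))\<^sup>2)))"

definition adjoint_storage_function ::
  "('x::chilbert_space \<Rightarrow> 'x) \<Rightarrow> ('u::chilbert_space \<Rightarrow> 'x) \<Rightarrow> ('x \<Rightarrow> 'y::chilbert_space) \<Rightarrow> ('u \<Rightarrow> 'y)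
    \<Rightarrow> ('x \<Rightarrow> ennreal) \<Rightarrow> bool" where
  "adjoint_storage_function A B C D S \<longleftrightarrow> S 0 = 0 \<and>
     (\<forall>N0 u x y. adjoint_trajectory A B C D N0 u x y \<longrightarrow>
       (\<forall>n\<le>N0. enn2ereal (S (x (n - 1)))
          \<le> enn2ereal (S (x n)) + ereal ((norm (u n))\<^sup>2) - ereal ((norm (y n))\<^sup>2)))"

definition nondegenerate :: "('x::chilbert_space \<Rightarrow> ennreal) \<Rightarrow> bool" where
  "nondegenerate S \<longleftrightarrow> (\<forall>x. x \<noteq> 0 \<longrightarrow> S x > 0)"

definition quadratic_storage :: "('x::chilbert_space \<times> 'x) set \<Rightarrow> 'x \<Rightarrow> ennreal" where
  "quadratic_storage H x =
     (if x \<in> Domain (op_sqrt H) then ennreal ((norm (op_apply (op_sqrt H) x))\<^sup>2) else \<infinity>)"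

definition kyp_inequality ::
  "('x::chilbert_space \<Rightarrow> 'x) \<Rightarrow> ('u::chilbert_space \<Rightarrow> 'x) \<Rightarrow> ('x \<Rightarrow> 'y::chilbert_space) \<Rightarrow> ('u \<Rightarrow> 'y)
    \<Rightarrow> ('x \<times> 'x) set \<Rightarrow> bool" where
  "kyp_inequality A B C D H \<longleftrightarrow>
     A ` Domain (op_sqrt H) \<subseteq> Domain (op_sqrt H) \<and>
     range B \<subseteq> Domain (op_sqrt H) \<and>
     (\<forall>x \<in> Domain (op_sqrt H). \<forall>u.
        (norm (op_apply (op_sqrt H) (A x + B u)))\<^sup>2 + (norm (C x + D u))\<^sup>2
          \<le> (norm (op_apply (op_sqrt H) x))\<^sup>2 + (norm u)\<^sup>2)"

definition adjoint_kyp_inequality ::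
  "('x::chilbert_space \<Rightarrow> 'x) \<Rightarrow> ('u::chilbert_space \<Rightarrow> 'x) \<Rightarrow> ('x \<Rightarrow> 'y::chilbert_space) \<Rightarrow> ('u \<Rightarrow> 'y)
    \<Rightarrow> ('x \<times> 'x) set \<Rightarrow> bool" where
  "adjoint_kyp_inequality A B C D H \<longleftrightarrow>
     kyp_inequality (cadjoint A) (cadjoint C) (cadjoint B) (cadjoint D) H"


section \<open>The operators \<open>H\<^sub>a\<close> and \<open>H\<^sub>r\<close>\<close>

definition obs_op ::
  "('x::chilbert_space \<Rightarrow> 'x) \<Rightarrow> ('x \<Rightarrow> 'y::chilbert_space) \<Rightarrow> ('x \<times> (nat, 'y) ell2) set" where
  "obs_op A C = {(x, v). \<forall>n. ell2_nth v n = C ((A ^^ n) x)}"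

text \<open>\<open>ctr_op_adj A B\<close> is \<open>W\<^sub>c\<^sup>*\<close>, from which \<open>W\<^sub>c\<close> is defined by taking the adjoint.\<close>

definition ctr_op_adj ::
  "('x::chilbert_space \<Rightarrow> 'x) \<Rightarrow> ('u::chilbert_space \<Rightarrow> 'x) \<Rightarrow> ('x \<times> (zneg, 'u) ell2) set" where
  "ctr_op_adj A B =
     {(x, v). \<forall>n. ell2_nth v n = cadjoint B ((cadjoint A ^^ nat (- int_of_zneg n - 1)) x)}"

definition ctr_op ::
  "('x::chilbert_space \<Rightarrow> 'x) \<Rightarrow> ('u::chilbert_space \<Rightarrow> 'x) \<Rightarrow> ((zneg, 'u) ell2 \<times> 'x) set" where
  "ctr_op A B = op_adjoint (ctr_op_adj A B)"

definition obs_op_adj ::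
  "('x::chilbert_space \<Rightarrow> 'x) \<Rightarrow> ('x \<Rightarrow> 'y::chilbert_space) \<Rightarrow> ((nat, 'y) ell2 \<times> 'x) set" where
  "obs_op_adj A C = op_adjoint (obs_op A C)"

definition taylor_coeff ::
  "('x::chilbert_space \<Rightarrow> 'x) \<Rightarrow> ('u::chilbert_space \<Rightarrow> 'x) \<Rightarrow> ('x \<Rightarrow> 'y::chilbert_space) \<Rightarrow> ('u \<Rightarrow> 'y)
    \<Rightarrow> nat \<Rightarrow> 'u \<Rightarrow> 'y" where
  "taylor_coeff A B C D n u = (case n of 0 \<Rightarrow> D u | Suc k \<Rightarrow> C ((A ^^ k) (B u)))"

definition toeplitz_future ::
  "('x::chilbert_space \<Rightarrow> 'x) \<Rightarrow> ('u::chilbert_space \<Rightarrow> 'x) \<Rightarrow> ('x \<Rightarrow> 'y::chilbert_space) \<Rightarrow> ('u \<Rightarrow> 'y)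
    \<Rightarrow> ((nat, 'u) ell2 \<times> (nat, 'y) ell2) set" where
  "toeplitz_future A B C D =
     {(u, v). \<forall>i. ell2_nth v i = (\<Sum>j\<le>i. taylor_coeff A B C D (i - j) (ell2_nth u j))}"

text \<open>
  The rows of the backward Toeplitz matrix are infinite; being a graph of all pairs for which
  the row sums converge, \<open>toeplitz_past\<close> is everywhere defined when the matrix is contractive.
\<close>

definition toeplitz_past ::
  "('x::chilbert_space \<Rightarrow> 'x) \<Rightarrow> ('u::chilbert_space \<Rightarrow> 'x) \<Rightarrow> ('x \<Rightarrow> 'y::chilbert_space) \<Rightarrow> ('u \<Rightarrow> 'y)
    \<Rightarrow> ((zneg, 'u) ell2 \<times> (zneg, 'y) ell2) set" where
  "toeplitz_past A B C D =
     {(u, v). \<forall>i. ((\<lambda>j. taylor_coeff A B C D (nat (int_of_zneg i - int_of_zneg j)) (ell2_nth u j))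
                     has_sum ell2_nth v i) {j. int_of_zneg j \<le> int_of_zneg i}}"

text \<open>
  \<open>X_avail\<close> and \<open>X_req\<close> are \<open>X\<^sub>a\<close> and \<open>X\<^sub>r\<close>; existence and uniqueness hold for minimal systems
  whose transfer function has a Schur class continuation.
\<close>

definition X_avail ::
  "('x::chilbert_space \<Rightarrow> 'x) \<Rightarrow> ('u::chilbert_space \<Rightarrow> 'x) \<Rightarrow> ('x \<Rightarrow> 'y::chilbert_space) \<Rightarrow> ('u \<Rightarrow> 'y)
    \<Rightarrow> ('x \<times> (nat, 'y) ell2) set" where
  "X_avail A B C D = (THE X.
     let Def = defect (op_adjoint (toeplitz_future A B C D)) in
     closable X \<and> Domain X = Range (ctr_op A B) \<and>
     Range X \<subseteq> orth_compl (op_kernel Def) \<and>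
     op_restrict (obs_op A C) (Range (ctr_op A B)) = X O Def)"

definition X_req ::
  "('x::chilbert_space \<Rightarrow> 'x) \<Rightarrow> ('u::chilbert_space \<Rightarrow> 'x) \<Rightarrow> ('x \<Rightarrow> 'y::chilbert_space) \<Rightarrow> ('u \<Rightarrow> 'y)
    \<Rightarrow> ('x \<times> (zneg, 'u) ell2) set" where
  "X_req A B C D = (THE X.
     let Def = defect (toeplitz_past A B C D) in
     closable X \<and> Domain X = Range (obs_op_adj A C) \<and>
     Range X \<subseteq> orth_compl (op_kernel Def) \<and>
     op_restrict (ctr_op_adj A B) (Range (obs_op_adj A C)) = X O Def)"

definition H_avail ::
  "('x::chilbert_space \<Rightarrow> 'x) \<Rightarrow> ('u::chilbert_space \<Rightarrow> 'x) \<Rightarrow> ('x \<Rightarrow> 'y::chilbert_space) \<Rightarrow> ('u \<Rightarrow> 'y)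
    \<Rightarrow> ('x \<times> 'x) set" where
  "H_avail A B C D = closure (X_avail A B C D) O op_adjoint (closure (X_avail A B C D))"

definition H_req ::
  "('x::chilbert_space \<Rightarrow> 'x) \<Rightarrow> ('u::chilbert_space \<Rightarrow> 'x) \<Rightarrow> ('x \<Rightarrow> 'y::chilbert_space) \<Rightarrow> ('u \<Rightarrow> 'y)
    \<Rightarrow> ('x \<times> 'x) set" where
  "H_req A B C D = (closure (X_req A B C D) O op_adjoint (closure (X_req A B C D)))\<inverse>"

end

theory Submission
  imports Defs "HOL-Complex_Analysis.Complex_Analysis"
begin

text \<open>
  The key is a description of \<open>X\<^sub>a\<close> by energy bounds. Let \<open>T\<close> be the Toeplitz operator, a contraction, and
  \<open>P = (I - T T\<^sup>*)\<^sup>1\<^sup>/\<^sup>2\<close>. Since \<open>(z, u) \<mapsto> P z + T u\<close> is a coisometry, \<open>P z = w\<close> implies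
  \<open>\<parallel>w + T u\<parallel>\<^sup>2 \<le> \<parallel>z\<parallel>\<^sup>2 + \<parallel>u\<parallel>\<^sup>2\<close> for all \<open>u\<close> (\<open>defect_column_contraction\<close>), and conversely a bound
  \<open>\<parallel>w + T u\<parallel>\<^sup>2 \<le> c + \<parallel>u\<parallel>\<^sup>2\<close> for all \<open>u\<close> produces such a \<open>z\<close> with \<open>\<parallel>z\<parallel>\<^sup>2 \<le> c\<close>
  (\<open>defect_range_criterion\<close>). So \<open>\<parallel>X\<^sub>a x\<parallel>\<^sup>2\<close> is the least \<open>c\<close> such that the output energy from the
  initial state \<open>x\<close> never exceeds \<open>c\<close> plus the input energy. Prepending an input \<open>u\<close> to the future
  input turns a bound for \<open>x\<close> into one for \<open>A x + B u\<close> that is smaller by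
  \<open>\<parallel>C x + D u\<parallel>\<^sup>2 - \<parallel>u\<parallel>\<^sup>2\<close>: this is the KYP inequality on \<open>Im W\<^sub>c\<close>. Taken with \<open>u = 0\<close> it also says that
  \<open>A\<close> does not increase \<open>\<parallel>X\<^sub>a x\<parallel>\<close>, and hence it passes to the closure of \<open>X\<^sub>a\<close>
  (\<open>available_storage_solution\<close>).

  The theorem speaks of \<open>H\<^sup>1\<^sup>/\<^sup>2\<close>, not of \<open>X\<close>. For a closed densely defined \<open>X\<close> the operator \<open>X\<^sup>* X\<close>
  has exactly one positive square root \<open>R\<close>, and \<open>R\<close> and \<open>X\<close> have the same domain and the same norms
  (\<open>TstarT_sqrt\<close>, \<open>op_sqrt_eq\<close>). Both facts are obtained from the bounded resolvent
  \<open>J = (I + X\<^sup>* X)\<^sup>-\<^sup>1\<close>, which is read off from the orthogonal projection onto the graph of \<open>X\<close>: with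
  \<open>j = J\<^sup>1\<^sup>/\<^sup>2\<close> and \<open>k = (I - J)\<^sup>1\<^sup>/\<^sup>2\<close> the graph of \<open>R\<close> is \<open>{(j z, k z)}\<close>.

  That a finite bound \<open>c\<close> exists at all comes from the Schur class: its members give trajectories
  which, started at rest, never emit more energy than they receive (\<open>schur_dissipative\<close>). Pairing
  trajectories of the system with trajectories of the adjoint system makes \<open>\<langle>x, \<xi>\<rangle>\<close> telescope;
  this transfers dissipativity to the adjoint system and shows that \<open>c = \<parallel>v\<parallel>\<^sup>2\<close> works for
  \<open>x = W\<^sub>c v\<close> (\<open>dissipative_adjoint\<close>, \<open>dissipative_output_bound\<close>).

  There remain \<open>H\<^sub>r\<close> and the inverses. Up to reversal of time, \<open>H\<^sub>r\<^sup>-\<^sup>1\<close> is the \<open>H\<^sub>a\<close> of the adjoint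
  system, so everything above is proved for sequence spaces over an index set that is merely in
  bijection with the natural numbers. Finally, the KYP inequality for \<open>H\<close> says that
  \<open>(R x, u) \<mapsto> (R (A x + B u), C x + D u)\<close> is a contraction; its adjoint is the corresponding map
  for \<open>R\<^sup>-\<^sup>1\<close> and the adjoint system, so \<open>H\<^sup>-\<^sup>1\<close> solves the KYP inequality of the adjoint system
  (\<open>kyp_root_inverse\<close>).
\<close>

section \<open>Orthogonality in real Hilbert spaces\<close>

lemma linear_term_zero:
  fixes a b :: real
  assumes "0 \<le> b" and "\<And>t. 0 \<le> 2 * t * a + t\<^sup>2 * b"
  shows "a = 0"
proof -
  \<comment> \<open>the minimiser is \<open>- a / b\<close>; dividing by \<open>b + 1\<close> avoids the case \<open>b = 0\<close>\<close>
  have "0 \<le> 2 * (- a / (b + 1)) * a + (- a / (b + 1))\<^sup>2 * b" by (rule assms(2))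
  also have "\<dots> = - (a\<^sup>2 * (b + 2)) / (b + 1)\<^sup>2"
  proof -
    have "b + 1 \<noteq> 0" using assms(1) by linarith
    then show ?thesis by (simp add: divide_simps) (simp add: algebra_simps power2_eq_square)
  qed
  finally have "a\<^sup>2 * (b + 2) \<le> 0"
    using assms(1) by (simp add: divide_le_0_iff zero_le_divide_iff mult_le_0_iff)
  then show ?thesis using assms(1) by (auto simp: mult_le_0_iff)
qed

text \<open>
  The functional is represented by the minimiser of \<open>\<parallel>x\<parallel>\<^sup>2 - 2 l x\<close>, the limit of a minimising
  sequence that is Cauchy by the parallelogram law. The subspace need not be closed, and the
  functional is only linear on it; this makes the lemma the common source of projections, of
  adjoints, and of solutions of operator equations.
\<close>

lemma riesz_subspace:
  fixes l :: "'a::{real_inner,complete_space} \<Rightarrow> real"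
  assumes sub: "subspace M" and "0 \<le> c"
    and add: "\<And>x y. x \<in> M \<Longrightarrow> y \<in> M \<Longrightarrow> l (x + y) = l x + l y"
    and scale: "\<And>r x. x \<in> M \<Longrightarrow> l (r *\<^sub>R x) = r * l x"
    and bnd: "\<And>x. x \<in> M \<Longrightarrow> l x \<le> c * norm x"
  obtains z where "z \<in> closure M" "\<And>x. x \<in> M \<Longrightarrow> l x = inner x z" "norm z \<le> c"
proof -
  define f where "f = (\<lambda>x. (norm x)\<^sup>2 - 2 * l x)"
  define d where "d = Inf (f ` M)"
  have below: "- c\<^sup>2 \<le> f x" if "x \<in> M" for x
  proof -
    have "0 \<le> (norm x - c)\<^sup>2" by simp
    then show ?thesis using bnd[OF that] by (simp add: f_def power2_diff algebra_simps)
  qed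
  have bdd: "bdd_below (f ` M)" by (rule bdd_belowI2[of _ "- c\<^sup>2"]) (rule below)
  have dle: "d \<le> f x" if "x \<in> M" for x
    unfolding d_def by (rule cInf_lower[OF imageI[OF that] bdd])
  have "\<exists>x. x \<in> M \<and> f x < d + 1 / real (Suc n)" for n
  proof -
    have "Inf (f ` M) < d + 1 / real (Suc n)" unfolding d_def by simp
    then show ?thesis
      using cInf_lessD[of "f ` M"] sub subspace_0 by blast
  qed
  then obtain X where XM: "\<And>n. X n \<in> M" and Xd: "\<And>n. f (X n) < d + 1 / real (Suc n)" by metis
  have par: "(norm (x - y))\<^sup>2 \<le> 2 * (f x - d) + 2 * (f y - d)" if "x \<in> M" "y \<in> M" for x y
  proof -
    have "d \<le> f ((1/2) *\<^sub>R (x + y))"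
      by (intro dle subspace_scale[OF sub] subspace_add[OF sub] that)
    also have "f ((1/2) *\<^sub>R (x + y)) = (norm (x + y))\<^sup>2 / 4 - l x - l y"
    proof -
      have "l ((1/2) *\<^sub>R (x + y)) = (l x + l y) / 2"
        using scale[of "x + y" "1/2"] add that by (simp add: subspace_add[OF sub])
      then show ?thesis unfolding f_def norm_scaleR by (simp add: power_mult_distrib power_divide)
    qed
    finally show ?thesis
      by (simp add: f_def power2_norm_eq_inner inner_simps inner_commute field_simps)
  qed
  have "Cauchy X"
  proof (rule metric_CauchyI)
    fix e :: real assume "0 < e"
    then obtain N where N: "1 / real (Suc N) < e\<^sup>2 / 4"
      using reals_Archimedean[of "e\<^sup>2/4"] by (auto simp: inverse_eq_divide)
    have "dist (X m) (X n) < e" if "N \<le> m" "N \<le> n" for m n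
    proof -
      have *: "1 / real (Suc k) \<le> 1 / real (Suc N)" if "N \<le> k" for k
        using that by (simp add: frac_le)
      have "(norm (X m - X n))\<^sup>2 < e\<^sup>2"
      proof -
        have "f (X m) - d < 1 / real (Suc N)" "f (X n) - d < 1 / real (Suc N)"
          using Xd[of m] *[OF that(1)] Xd[of n] *[OF that(2)] by simp_all
        then have "2 * (f (X m) - d) + 2 * (f (X n) - d) < e\<^sup>2"
          using N by argo
        then show ?thesis using par[OF XM[of m] XM[of n]] by (rule le_less_trans[rotated])
      qed
      then show ?thesis using \<open>0 < e\<close> by (simp add: dist_norm power2_less_imp_less)
    qed
    then show "\<exists>N. \<forall>m\<ge>N. \<forall>n\<ge>N. dist (X m) (X n) < e" by blast
  qed
  then obtain z where z: "X \<longlonglongrightarrow> z" using Cauchy_convergent convergent_def by blast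
  have zM: "z \<in> closure M" using XM z closure_sequential by blast
  have lz: "l h = inner h z" if "h \<in> M" for h
  proof -
    have "inner z h - l h = 0"
    proof (rule linear_term_zero)
      show "0 \<le> (norm h)\<^sup>2" by simp
      fix t :: real
      have "(\<lambda>n. 1 / real (Suc n) + (2 * t * (inner (X n) h - l h) + t\<^sup>2 * (norm h)\<^sup>2))
          \<longlonglongrightarrow> 0 + (2 * t * (inner z h - l h) + t\<^sup>2 * (norm h)\<^sup>2)"
        by (intro tendsto_intros z LIMSEQ_Suc lim_1_over_n)
      moreover have "0 \<le> 1 / real (Suc n) + (2 * t * (inner (X n) h - l h) + t\<^sup>2 * (norm h)\<^sup>2)" for n
      proof -
        have "d \<le> f (X n + t *\<^sub>R h)"
          by (intro dle subspace_add[OF sub] subspace_scale[OF sub] XM that)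
        also have "\<dots> = f (X n) + (2 * t * (inner (X n) h - l h) + t\<^sup>2 * (norm h)\<^sup>2)"
          using XM that
          by (simp add: f_def add scale subspace_scale[OF sub] power2_norm_eq_inner inner_add_left
              inner_add_right power2_eq_square[of t])
            (simp add: inner_commute algebra_simps)
        finally show ?thesis using Xd[of n] by linarith
      qed
      ultimately show "0 \<le> 2 * t * (inner z h - l h) + t\<^sup>2 * (norm h)\<^sup>2"
        by (intro LIMSEQ_le_const[where X="\<lambda>n. 1 / real (Suc n) + (2 * t * (inner (X n) h - l h) + t\<^sup>2 * (norm h)\<^sup>2)"]) auto
    qed
    then show ?thesis by (simp add: inner_commute)
  qed
  have "inner z z \<le> c * norm z"
  proof (rule LIMSEQ_le)
    show "(\<lambda>n. inner (X n) z) \<longlonglongrightarrow> inner z z" by (intro tendsto_intros z)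
    show "(\<lambda>n. c * norm (X n)) \<longlonglongrightarrow> c * norm z" by (intro tendsto_intros z)
    show "\<exists>N. \<forall>n\<ge>N. inner (X n) z \<le> c * norm (X n)" using bnd[OF XM] lz[OF XM] by auto
  qed
  then have "norm z * norm z \<le> c * norm z" by (simp add: power2_norm_eq_inner[symmetric] power2_eq_square)
  then have "norm z \<le> c" using \<open>0 \<le> c\<close> by (cases "norm z = 0") (auto simp: mult_le_cancel_right)
  with that zM lz show thesis by blast
qed

lemma orthogonal_decomposition:
  fixes x :: "'a::{real_inner,complete_space}"
  assumes "subspace M"
  obtains m where "m \<in> closure M" "\<And>h. h \<in> M \<Longrightarrow> inner h (x - m) = 0"
proof -
  obtain z where "z \<in> closure M" "\<And>h. h \<in> M \<Longrightarrow> inner h x = inner h z"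
    by (rule riesz_subspace[OF assms norm_ge_zero[of x], of "\<lambda>h. inner h x"])
      (auto simp: inner_simps norm_cauchy_schwarz mult.commute)
  then show thesis using that by (simp add: inner_diff_right)
qed

lemma dense_iff_trivial_complement:
  fixes M :: "'a::{real_inner,complete_space} set"
  assumes "subspace M"
  shows "closure M = UNIV \<longleftrightarrow> (\<forall>x. (\<forall>m\<in>M. inner m x = 0) \<longrightarrow> x = 0)"
proof
  assume d: "closure M = UNIV"
  show "\<forall>x. (\<forall>m\<in>M. inner m x = 0) \<longrightarrow> x = 0"
  proof (intro allI impI)
    fix x assume *: "\<forall>m\<in>M. inner m x = 0"
    have "x \<in> closure M" using d by simp
    then obtain X where "\<And>n. X n \<in> M" "X \<longlonglongrightarrow> x" using closure_sequential by blast
    then have "(\<lambda>n. inner (X n) x) \<longlonglongrightarrow> inner x x" by (intro tendsto_intros)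
    then have "inner x x = 0" using * \<open>\<And>n. X n \<in> M\<close> LIMSEQ_unique tendsto_const by fastforce
    then show "x = 0" by simp
  qed
next
  assume *: "\<forall>x. (\<forall>m\<in>M. inner m x = 0) \<longrightarrow> x = 0"
  have "x \<in> closure M" for x
  proof -
    obtain m where "m \<in> closure M" "\<And>h. h \<in> M \<Longrightarrow> inner h (x - m) = 0"
      using orthogonal_decomposition[OF assms] by blast
    then show ?thesis using *[rule_format, of "x - m"] by simp
  qed
  then show "closure M = UNIV" by blast
qed

lemma hilbert_adjoint_exists:
  fixes f :: "'a::{real_inner,complete_space} \<Rightarrow> 'b::real_inner"
  assumes "bounded_linear f"
  obtains g where "\<And>x y. inner (f x) y = inner x (g y)"
proof -
  interpret f: bounded_linear f by fact
  obtain K where K: "0 \<le> K" "\<And>x. norm (f x) \<le> norm x * K" using f.nonneg_bounded by blast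
  have "\<exists>z. \<forall>x. inner (f x) y = inner x z" for y
  proof -
    obtain z where "\<And>x. x \<in> UNIV \<Longrightarrow> inner (f x) y = inner x z"
    proof (rule riesz_subspace[of UNIV "K * norm y" "\<lambda>x. inner (f x) y"])
      show "inner (f x) y \<le> K * norm y * norm x" for x
      proof -
        have "inner (f x) y \<le> norm (f x) * norm y" by (rule norm_cauchy_schwarz)
        also have "\<dots> \<le> (norm x * K) * norm y" by (intro mult_right_mono K) simp
        finally show ?thesis by (simp add: mult.commute mult.left_commute)
      qed
    qed (use K in \<open>auto simp: f.add f.scaleR inner_simps\<close>)
    then show ?thesis by auto
  qed
  then show thesis using that by metis
qed

section \<open>Square roots of bounded positive operators\<close>

definition symmetric_map :: "('a::real_inner \<Rightarrow> 'a) \<Rightarrow> bool" where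
  "symmetric_map f \<longleftrightarrow> linear f \<and> (\<forall>x y. inner (f x) y = inner x (f y))"

text \<open>
  Cauchy--Schwarz for the form \<open>\<langle>P x, y\<rangle>\<close>.
\<close>

lemma positive_form_zero:
  assumes "symmetric_map P" "\<And>x. 0 \<le> inner (P x) x" "inner (P w) w = 0"
  shows "P w = 0"
proof -
  interpret P: linear P using assms(1) by (simp add: symmetric_map_def)
  have sym: "inner (P x) y = inner x (P y)" for x y using assms(1) by (simp add: symmetric_map_def)
  define h where "h = P w"
  have "inner (P w) h = 0"
  proof (rule linear_term_zero)
    show "0 \<le> inner (P h) h" by (rule assms)
    fix t :: real
    have "0 \<le> inner (P (w + t *\<^sub>R h)) (w + t *\<^sub>R h)" by (rule assms)
    also have "\<dots> = 2 * t * inner (P w) h + t\<^sup>2 * inner (P h) h"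
      using assms(3) sym[of h w]
      by (simp add: P.add P.scaleR inner_simps power2_eq_square algebra_simps inner_commute)
    finally show "0 \<le> 2 * t * inner (P w) h + t\<^sup>2 * inner (P h) h" .
  qed
  then show ?thesis by (simp add: h_def)
qed

text \<open>
  With \<open>w = (P - Q) x\<close>, the sum of \<open>\<langle>P w, w\<rangle>\<close> and \<open>\<langle>Q w, w\<rangle>\<close> is
  \<open>\<langle>(P\<^sup>2 - Q\<^sup>2) x, w\<rangle> = 0\<close>. Both terms are nonnegative, so \<open>P\<close> and \<open>Q\<close> annihilate \<open>w\<close>.
\<close>

lemma commuting_positive_sqrt_unique:
  assumes P: "symmetric_map P" "\<And>x. 0 \<le> inner (P x) x"
    and Q: "symmetric_map Q" "\<And>x. 0 \<le> inner (Q x) x"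
    and comm: "\<And>x. P (Q x) = Q (P x)" and sq: "\<And>x. P (P x) = Q (Q x)"
  shows "P x = Q x"
proof -
  interpret P: linear P using P(1) by (simp add: symmetric_map_def)
  interpret Q: linear Q using Q(1) by (simp add: symmetric_map_def)
  define w where "w = P x - Q x"
  have "inner (P w) w + inner (Q w) w = inner (P w + Q w) w" by (simp add: inner_simps)
  also have "P w + Q w = 0" by (simp add: w_def P.diff Q.diff comm sq)
  finally have "inner (P w) w = 0" "inner (Q w) w = 0"
    using P(2)[of w] Q(2)[of w] by auto
  then have "P w = 0" "Q w = 0" using positive_form_zero P Q by blast+
  then have "inner w w = 0"
    using P(1) Q(1) by (simp add: w_def inner_diff_left symmetric_map_def)
  then show ?thesis by (simp add: w_def)
qed

text \<open>
  Iteration of \<open>Y \<mapsto> (M + Y\<^sup>2) / 2\<close>. A fixed point satisfies \<open>(I - Y)\<^sup>2 = I - M\<close>.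
\<close>

primrec sqrt_approx :: "('a::real_vector \<Rightarrow> 'a) \<Rightarrow> nat \<Rightarrow> 'a \<Rightarrow> 'a" where
  "sqrt_approx M 0 = (\<lambda>x. 0)"
| "sqrt_approx M (Suc n) = (\<lambda>x. (1/2) *\<^sub>R (M x + sqrt_approx M n (sqrt_approx M n x)))"

text \<open>
  The same iteration for the number \<open>M = 1\<close>. Its increments dominate those of \<open>sqrt_approx\<close> for a
  contraction \<open>M\<close>, and they are summable because the iteration increases and stays below \<open>1\<close>.
\<close>

primrec sqrt_majorant :: "nat \<Rightarrow> real" where
  "sqrt_majorant 0 = 0"
| "sqrt_majorant (Suc n) = (1 + (sqrt_majorant n)\<^sup>2) / 2"

lemma sqrt_majorant_bounds: "0 \<le> sqrt_majorant n \<and> sqrt_majorant n \<le> 1"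
proof (induction n)
  case (Suc n)
  then have "(sqrt_majorant n)\<^sup>2 \<le> 1" by (simp add: power_le_one)
  then show ?case by simp
qed simp

lemma sqrt_majorant_mono: "sqrt_majorant n \<le> sqrt_majorant (Suc n)"
proof -
  have "0 \<le> (1 - sqrt_majorant n)\<^sup>2" by simp
  then show ?thesis by (simp add: power2_diff)
qed

lemma sqrt_approx_commute:
  assumes "linear L" "\<And>x. L (M x) = M (L x)"
  shows "L (sqrt_approx M n x) = sqrt_approx M n (L x)"
proof -
  interpret L: linear L by fact
  show ?thesis
    by (induction n arbitrary: x) (simp_all add: L.zero L.scaleR L.add assms(2))
qed

text \<open>
  The root commutes with everything that commutes with \<open>M\<close>, since it is a limit of polynomials in
  \<open>M\<close>. Multiplication by a complex scalar is one such operator, so a real-linear construction yields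
  complex-linear roots.
\<close>

lemma bounded_sqrt_exists:
  fixes M :: "'a::{real_inner,complete_space} \<Rightarrow> 'a"
  assumes M: "symmetric_map M" "\<And>x. norm (M x) \<le> norm x"
  obtains P where "symmetric_map P" "\<And>x. 0 \<le> inner (P x) x" "\<And>x. P (P x) = x - M x"
    "\<And>x. norm (x - P x) \<le> norm x"
    "\<And>L x. bounded_linear L \<Longrightarrow> (\<And>y. L (M y) = M (L y)) \<Longrightarrow> L (P x) = P (L x)"
proof -
  interpret M: linear M using M(1) by (simp add: symmetric_map_def)
  have Msym: "inner (M x) y = inner x (M y)" for x y using M(1) by (simp add: symmetric_map_def)
  let ?A = "sqrt_approx M" and ?s = sqrt_majorant
  have lin: "linear (?A n)" for n
  proof (induction n)
    case 0 then show ?case by (simp add: linear_zero)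
  next
    case (Suc n)
    then interpret A: linear "?A n" .
    show ?case by (rule linearI) (simp_all add: A.add A.scaleR M.add M.scaleR algebra_simps)
  qed
  have sym: "inner (?A n x) y = inner x (?A n y)" for n x y
    by (induction n arbitrary: x y) (simp_all add: inner_simps Msym)
  have cM: "M (?A n x) = ?A n (M x)" for n x
    by (rule sqrt_approx_commute) (auto intro: M.linear_axioms)
  have cA: "?A m (?A n x) = ?A n (?A m x)" for m n x
    by (rule sqrt_approx_commute[OF lin]) (simp add: cM)
  have bnd: "norm (?A n x) \<le> ?s n * norm x" for n x
  proof (induction n arbitrary: x)
    case (Suc n)
    have "norm (?A n (?A n x)) \<le> ?s n * norm (?A n x)" by (rule Suc)
    also have "\<dots> \<le> ?s n * (?s n * norm x)"
      by (intro mult_left_mono Suc) (use sqrt_majorant_bounds in auto)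
    finally show ?case
      using M(2)[of x] norm_triangle_ineq[of "M x" "?A n (?A n x)"]
      by (simp add: power2_eq_square algebra_simps del: scaleR_add_right)
  qed simp
  have step: "norm (?A (Suc n) x - ?A n x) \<le> (?s (Suc n) - ?s n) * norm x" for n x
  proof (induction n arbitrary: x)
    case 0 then show ?case using M(2)[of x] by simp
  next
    case (Suc n)
    interpret A: linear "?A n" by (rule lin)
    interpret A': linear "?A (Suc n)" by (rule lin)
    define e where "e = ?A (Suc n) x - ?A n x"
    have e: "norm e \<le> (?s (Suc n) - ?s n) * norm x" unfolding e_def by (rule Suc)
    have "?A (Suc n) (?A (Suc n) x) - ?A n (?A n x) = ?A (Suc n) e + ?A n e"
      unfolding e_def A.diff A'.diff using cA[of "Suc n" n x] by (simp del: sqrt_approx.simps)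
    then have "?A (Suc (Suc n)) x - ?A (Suc n) x = (1/2) *\<^sub>R (?A (Suc n) e + ?A n e)"
      by (metis (no_types, lifting) add_diff_cancel_left scaleR_right_diff_distrib sqrt_approx.simps(2))
    then have "norm (?A (Suc (Suc n)) x - ?A (Suc n) x) = norm (?A (Suc n) e + ?A n e) / 2" by simp
    also have "\<dots> \<le> (?s (Suc n) * norm e + ?s n * norm e) / 2"
      by (intro divide_right_mono order_trans[OF norm_triangle_ineq] add_mono bnd) simp
    also have "\<dots> = (?s (Suc n) + ?s n) / 2 * norm e" by (simp add: algebra_simps add_divide_distrib)
    also have "\<dots> \<le> (?s (Suc n) + ?s n) / 2 * ((?s (Suc n) - ?s n) * norm x)"
      using sqrt_majorant_bounds[of n] sqrt_majorant_bounds[of "Suc n"]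
      by (intro mult_left_mono e) (auto simp del: sqrt_majorant.simps)
    also have "\<dots> = (?s (Suc (Suc n)) - ?s (Suc n)) * norm x"
      by (simp add: power2_eq_square field_simps)
    finally show ?case .
  qed
  \<comment> \<open>the increments telescope against those of the scalar iteration\<close>
  have far: "norm (?A (n + k) x - ?A n x) \<le> (?s (n + k) - ?s n) * norm x" for n k x
  proof (induction k)
    case (Suc k)
    have "norm (?A (n + Suc k) x - ?A n x)
        \<le> norm (?A (Suc (n + k)) x - ?A (n + k) x) + norm (?A (n + k) x - ?A n x)"
      using norm_triangle_ineq[of "?A (Suc (n + k)) x - ?A (n + k) x" "?A (n + k) x - ?A n x"]
      by (simp del: sqrt_approx.simps)
    also have "\<dots> \<le> (?s (Suc (n + k)) - ?s (n + k)) * norm x + (?s (n + k) - ?s n) * norm x"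
      by (intro add_mono step Suc)
    finally show ?case by (simp add: algebra_simps)
  qed simp
  have "convergent ?s"
  proof (rule Bseq_mono_convergent[OF BseqI'[of _ 1]])
    show "norm (?s n) \<le> 1" for n using sqrt_majorant_bounds[of n] by simp
    show "\<forall>m n. m \<le> n \<longrightarrow> ?s m \<le> ?s n"
      using lift_Suc_mono_le[of ?s, OF sqrt_majorant_mono] by blast
  qed
  then have sC: "Cauchy ?s" by (rule convergent_Cauchy)
  have "Cauchy (\<lambda>n. ?A n x)" for x
  proof (rule metric_CauchyI)
    fix e :: real assume "0 < e"
    then have "0 < e / (norm x + 1)" by (simp add: add_nonneg_pos)
    then obtain N where N: "\<And>m n. N \<le> m \<Longrightarrow> N \<le> n \<Longrightarrow> dist (?s m) (?s n) < e / (norm x + 1)"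
      using sC unfolding Cauchy_def by blast
    have *: "dist (?A m x) (?A n x) < e" if "N \<le> n" "n \<le> m" for m n
    proof -
      have "dist (?A m x) (?A n x) \<le> (?s m - ?s n) * norm x"
        using far[of n "m - n" x] that by (simp add: dist_norm)
      also have "\<dots> \<le> \<bar>?s m - ?s n\<bar> * (norm x + 1)"
        by (intro mult_mono) auto
      also have "\<dots> < e / (norm x + 1) * (norm x + 1)"
        using N[of m n] that by (intro mult_strict_right_mono) (auto simp: dist_real_def add_nonneg_pos)
      also have "\<dots> = e" by (simp add: add_nonneg_eq_0_iff)
      finally show ?thesis .
    qed
    have "\<forall>m\<ge>N. \<forall>n\<ge>N. dist (?A m x) (?A n x) < e"
      using * by (metis dist_commute nle_le)
    then show "\<exists>N. \<forall>m\<ge>N. \<forall>n\<ge>N. dist (?A m x) (?A n x) < e" by blast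
  qed
  then have "\<exists>l. (\<lambda>n. ?A n x) \<longlonglongrightarrow> l" for x
    using Cauchy_convergent convergent_def by blast
  then obtain Y where Y: "\<And>x. (\<lambda>n. ?A n x) \<longlonglongrightarrow> Y x" by metis
  have nA: "norm (?A n x) \<le> norm x" for n x
    using bnd[of n x] sqrt_majorant_bounds[of n] mult_right_mono[of "?s n" 1 "norm x"] by auto
  have Ylin: "linear Y"
  proof (rule linearI)
    fix x y
    have "(\<lambda>n. ?A n x + ?A n y) \<longlonglongrightarrow> Y (x + y)" using Y[of "x + y"] linear_add[OF lin] by simp
    then show "Y (x + y) = Y x + Y y" using tendsto_add[OF Y Y] LIMSEQ_unique by blast
  next
    fix r x
    have "(\<lambda>n. r *\<^sub>R ?A n x) \<longlonglongrightarrow> Y (r *\<^sub>R x)" using Y[of "r *\<^sub>R x"] linear_cmul[OF lin] by simp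
    then show "Y (r *\<^sub>R x) = r *\<^sub>R Y x" using tendsto_scaleR[OF tendsto_const Y] LIMSEQ_unique by blast
  qed
  interpret Y: linear Y by (rule Ylin)
  have Ysym: "inner (Y x) y = inner x (Y y)" for x y
  proof (rule LIMSEQ_unique)
    show "(\<lambda>n. inner (?A n x) y) \<longlonglongrightarrow> inner (Y x) y" by (intro tendsto_intros Y)
    show "(\<lambda>n. inner (?A n x) y) \<longlonglongrightarrow> inner x (Y y)" unfolding sym by (intro tendsto_intros Y)
  qed
  have nY: "norm (Y x) \<le> norm x" for x
    by (rule LIMSEQ_le_const2[OF tendsto_norm[OF Y]]) (use nA in auto)
  have YY: "(\<lambda>n. ?A n (?A n x)) \<longlonglongrightarrow> Y (Y x)" for x
  proof -
    have "(\<lambda>n. ?A n (?A n x - Y x)) \<longlonglongrightarrow> 0"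
    proof (rule Lim_null_comparison)
      show "\<forall>\<^sub>F n in sequentially. norm (?A n (?A n x - Y x)) \<le> norm (?A n x - Y x)"
        by (simp add: nA)
      show "(\<lambda>n. norm (?A n x - Y x)) \<longlonglongrightarrow> 0"
        using Y[of x] tendsto_norm_zero LIM_zero by blast
    qed
    from tendsto_add[OF this Y[of "Y x"]] show ?thesis
      by (simp add: linear_diff[OF lin])
  qed
  have fixpt: "Y x = (1/2) *\<^sub>R (M x + Y (Y x))" for x
  proof (rule LIMSEQ_unique)
    show "(\<lambda>n. ?A (Suc n) x) \<longlonglongrightarrow> Y x" by (rule LIMSEQ_Suc[OF Y])
    show "(\<lambda>n. ?A (Suc n) x) \<longlonglongrightarrow> (1/2) *\<^sub>R (M x + Y (Y x))"
      unfolding sqrt_approx.simps by (intro tendsto_intros YY)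
  qed
  show thesis
  proof (rule that[of "\<lambda>x. x - Y x"])
    show "symmetric_map (\<lambda>x. x - Y x)"
      unfolding symmetric_map_def
      by (auto intro!: linearI simp: Y.add Y.scaleR inner_simps Ysym algebra_simps)
    show "0 \<le> inner (x - Y x) x" for x
    proof -
      have "inner (Y x) x \<le> norm (Y x) * norm x" by (rule norm_cauchy_schwarz)
      also have "\<dots> \<le> norm x * norm x" by (intro mult_right_mono nY) simp
      finally show ?thesis by (simp add: inner_simps norm_eq_sqrt_inner)
    qed
    show "(x - Y x) - Y (x - Y x) = x - M x" for x
    proof -
      have "2 *\<^sub>R Y x = M x + Y (Y x)" by (subst fixpt) simp
      then show ?thesis by (simp add: Y.diff scaleR_2 algebra_simps)
    qed
    show "norm (x - (x - Y x)) \<le> norm x" for x using nY by simp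
    show "L (x - Y x) = L x - Y (L x)" if L: "bounded_linear L" "\<And>y. L (M y) = M (L y)" for L x
    proof -
      interpret L: bounded_linear L by fact
      have "(\<lambda>n. L (?A n x)) \<longlonglongrightarrow> L (Y x)" by (rule L.tendsto[OF Y])
      moreover have "(\<lambda>n. L (?A n x)) \<longlonglongrightarrow> Y (L x)"
        unfolding sqrt_approx_commute[of L M, OF L.linear_axioms L(2)] by (rule Y)
      ultimately show ?thesis using LIMSEQ_unique L.diff by metis
    qed
  qed
qed

section \<open>Complex structure versus real structure\<close>

lemma scaleC_minus_one: "(- 1) *\<^sub>C x = - (x :: 'a::complex_inner)"
  using scaleC_of_real[of "-1" x] by simp

lemma scaleC_one: "1 *\<^sub>C x = (x :: 'a::complex_inner)"
  using scaleC_of_real[of 1 x] by simp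

lemma scaleC_zero [simp]: "c *\<^sub>C 0 = (0 :: 'a::complex_inner)"
  using norm_scaleC[of c "0 :: 'a"] by simp

lemma bounded_linear_scaleC: "bounded_linear (\<lambda>x :: 'a::complex_inner. c *\<^sub>C x)"
proof (rule bounded_linear_intro[where K="cmod c"])
  show "c *\<^sub>C (r *\<^sub>R x) = r *\<^sub>R (c *\<^sub>C x)" for r and x :: 'a
    by (simp add: scaleC_of_real[symmetric] scaleC_scaleC mult.commute)
qed (simp_all add: scaleC_add_right norm_scaleC mult.commute)

text \<open>
  The complex inner product is determined by the real one. Orthogonality to a complex subspace is
  therefore the same for both, which allows the Hilbert space geometry to be done over the reals.
\<close>

lemma cinner_eq_Complex: "cinner x y = Complex (inner x y) (inner ((- \<i>) *\<^sub>C x) (y :: 'a::complex_inner))"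
  by (simp add: complex_eq_iff Im_cinner inner_eq_Re_cinner)

lemma cinner_add_right: "cinner x (y + z) = cinner x y + cinner x (z :: 'a::complex_inner)"
  by (metis cinner_add_left cinner_commute complex_cnj_add)

lemma cinner_scaleC_right: "cinner x (c *\<^sub>C y) = cnj c * cinner x (y :: 'a::complex_inner)"
  by (metis cinner_commute cinner_scaleC_left complex_cnj_mult)

lemma cinner_diff_left: "cinner (x - y) z = cinner x z - cinner y (z :: 'a::complex_inner)"
  by (simp add: cinner_eq_Complex inner_diff_left linear_diff[OF bounded_linear.linear[OF bounded_linear_scaleC]] complex_eq_iff)

lemma cinner_diff_right: "cinner z (x - y) = cinner z x - cinner z (y :: 'a::complex_inner)"
  by (simp add: cinner_eq_Complex inner_diff_right complex_eq_iff)

lemma cinner_zero [simp]: "cinner 0 x = 0" "cinner x 0 = 0" for x :: "'a::complex_inner"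
  by (simp_all add: cinner_eq_Complex complex_eq_iff)

definition csubspace :: "'a::complex_inner set \<Rightarrow> bool" where
  "csubspace M \<longleftrightarrow> 0 \<in> M \<and> (\<forall>x\<in>M. \<forall>y\<in>M. x + y \<in> M) \<and> (\<forall>c. \<forall>x\<in>M. c *\<^sub>C x \<in> M)"

lemma csubspace_subspace: "csubspace M \<Longrightarrow> subspace M"
  by (auto simp: csubspace_def subspace_def scaleC_of_real[symmetric])

lemma cspan_minimal:
  assumes "S \<subseteq> M" "csubspace M"
  shows "cspan S \<subseteq> M"
proof -
  interpret module "scaleC :: complex \<Rightarrow> 'a \<Rightarrow> 'a"
    by unfold_locales (simp_all add: scaleC_add_right scaleC_add_left scaleC_scaleC scaleC_one)
  show ?thesis
    unfolding cspan_def
    by (rule span_minimal[OF assms(1)]) (use assms(2) in \<open>auto simp: subspace_def csubspace_def\<close>)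
qed

section \<open>Graphs of operators\<close>

lemma is_operatorD:
  assumes "is_operator T"
  shows is_operator_single: "(x, y) \<in> T \<Longrightarrow> (x, y') \<in> T \<Longrightarrow> y = y'"
    and is_operator_zero: "(0, 0) \<in> T"
    and is_operator_add: "(x, y) \<in> T \<Longrightarrow> (x', y') \<in> T \<Longrightarrow> (x + x', y + y') \<in> T"
    and is_operator_scaleC: "(x, y) \<in> T \<Longrightarrow> (c *\<^sub>C x, c *\<^sub>C y) \<in> T"
  using assms unfolding is_operator_def single_valued_def by blast+

lemma is_operator_subspace:
  assumes "is_operator T" shows "subspace T"
  unfolding subspace_def
  using is_operatorD[OF assms] is_operator_scaleC[OF assms, of _ _ "complex_of_real _", unfolded scaleC_of_real]
  by (auto simp: zero_prod_def)

lemma is_operator_diff: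
  assumes "is_operator T" "(x, y) \<in> T" "(x', y') \<in> T" shows "(x - x', y - y') \<in> T"
  using subspace_diff[OF is_operator_subspace[OF assms(1)] assms(2,3)] by simp

lemma Domain_csubspace: "is_operator T \<Longrightarrow> csubspace (Domain T)"
  unfolding csubspace_def by (auto simp: Domain_iff dest: is_operatorD)

lemma op_apply_eq: "is_operator T \<Longrightarrow> (x, y) \<in> T \<Longrightarrow> op_apply T x = y"
  unfolding op_apply_def by (rule the_equality) (auto dest: is_operator_single)

lemma op_adjoint_iff:
  "(y, z) \<in> op_adjoint T \<longleftrightarrow> (\<forall>x w. (x, w) \<in> T \<longrightarrow> cinner w y = cinner x z)"
  unfolding op_adjoint_def by auto

lemma op_adjoint_iff_inner:
  assumes T: "is_operator T"
  shows "(y, z) \<in> op_adjoint T \<longleftrightarrow> (\<forall>(x, w) \<in> T. inner w y = inner x z)"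
proof
  assume "(y, z) \<in> op_adjoint T"
  then show "\<forall>(x, w) \<in> T. inner w y = inner x z"
    by (auto simp: op_adjoint_def inner_eq_Re_cinner)
next
  assume *: "\<forall>(x, w) \<in> T. inner w y = inner x z"
  show "(y, z) \<in> op_adjoint T"
    using * is_operator_scaleC[OF T, of _ _ "- \<i>"]
    by (fastforce simp: op_adjoint_def cinner_eq_Complex)
qed

lemma op_adjoint_add:
  "(y, z) \<in> op_adjoint T \<Longrightarrow> (y', z') \<in> op_adjoint T \<Longrightarrow> (y + y', z + z') \<in> op_adjoint T"
  unfolding op_adjoint_iff by (auto simp: cinner_add_right)

lemma op_adjoint_scaleC: "(y, z) \<in> op_adjoint T \<Longrightarrow> (c *\<^sub>C y, c *\<^sub>C z) \<in> op_adjoint T"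
  unfolding op_adjoint_def by (auto simp: cinner_scaleC_right)

lemma op_adjoint_zero: "(0, 0) \<in> op_adjoint T"
  unfolding op_adjoint_def by auto

lemma op_adjoint_antimono: "S \<subseteq> T \<Longrightarrow> op_adjoint T \<subseteq> op_adjoint S"
  unfolding op_adjoint_def by blast

lemma closed_op_adjoint:
  assumes "is_operator T" shows "closed (op_adjoint T)"
proof -
  have "op_adjoint T = (\<Inter>p\<in>T. {q. inner (snd p) (fst q) = inner (fst p) (snd q)})"
    using op_adjoint_iff_inner[OF assms] by force
  then show ?thesis
    by (auto intro!: closed_INT closed_Collect_eq continuous_intros)
qed

text \<open>
  Closures of linear graphs are linear; only single-valuedness has to be known.
\<close>

lemma closure_is_operator:
  assumes "is_operator T" "single_valued (closure T)" shows "is_operator (closure T)"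
  unfolding is_operator_def
proof (intro conjI allI impI)
  show "single_valued (closure T)" by fact
  show "(0, 0) \<in> closure T" using is_operator_zero[OF assms(1)] closure_subset by blast
next
  fix x y x' y'
  show "(x + x', y + y') \<in> closure T" if "(x, y) \<in> closure T" "(x', y') \<in> closure T"
  proof -
    note xy = that
    obtain p where p: "\<And>n. p n \<in> T" "p \<longlonglongrightarrow> (x, y)" using xy(1) closure_sequential by blast
    obtain q where q: "\<And>n. q n \<in> T" "q \<longlonglongrightarrow> (x', y')" using xy(2) closure_sequential by blast
    have "(\<lambda>n. p n + q n) \<longlonglongrightarrow> (x, y) + (x', y')" by (intro tendsto_add p q)
    moreover have "p n + q n \<in> T" for n
      by (intro subspace_add[OF is_operator_subspace[OF assms(1)]] p q)
    ultimately show ?thesis unfolding closure_sequential by (intro exI[of _ "\<lambda>n. p n + q n"]) auto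
  qed
next
  fix c x y assume "(x, y) \<in> closure T"
  then obtain p where p: "\<And>n. p n \<in> T" "p \<longlonglongrightarrow> (x, y)" using closure_sequential by blast
  have "(\<lambda>n. (c *\<^sub>C fst (p n), c *\<^sub>C snd (p n))) \<longlonglongrightarrow> (c *\<^sub>C x, c *\<^sub>C y)"
    using tendsto_fst[OF p(2)] tendsto_snd[OF p(2)]
    by (intro tendsto_Pair bounded_linear.tendsto[OF bounded_linear_scaleC]) auto
  moreover have "(c *\<^sub>C fst (p n), c *\<^sub>C snd (p n)) \<in> T" for n
    using is_operator_scaleC[OF assms(1), of "fst (p n)" "snd (p n)"] p(1) by simp
  ultimately show "(c *\<^sub>C x, c *\<^sub>C y) \<in> closure T" unfolding closure_sequential by (intro exI[of _ "\<lambda>n. (c *\<^sub>C fst (p n), c *\<^sub>C snd (p n))"]) auto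
qed

section \<open>Positive selfadjoint operators\<close>

text \<open>
  Reality of \<open>\<langle>y, x\<rangle>\<close> on the graph is a consequence of selfadjointness.
\<close>

lemma psdI:
  assumes "is_operator R" "closure (Domain R) = UNIV" "op_adjoint R = R"
    and "\<And>x y. (x, y) \<in> R \<Longrightarrow> 0 \<le> inner y x"
  shows "positive_semidefinite R"
proof -
  have "cinner y x \<in> \<real>" if "(x, y) \<in> R" for x y
  proof -
    have "(x, y) \<in> op_adjoint R" using that assms(3) by simp
    then have "cinner y x = cinner x y" using that by (auto simp: op_adjoint_def)
    then have "cinner y x = cnj (cinner y x)" by (metis cinner_commute)
    then show ?thesis by (simp add: Reals_cnj_iff)
  qed
  then show ?thesis
    using assms by (auto simp: positive_semidefinite_def selfadjoint_def inner_eq_Re_cinner)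
qed

lemma psdD:
  assumes "positive_semidefinite R"
  shows psd_operator: "is_operator R" and psd_dense: "closure (Domain R) = UNIV"
    and psd_adjoint: "op_adjoint R = R" and psd_nonneg: "(x, y) \<in> R \<Longrightarrow> 0 \<le> inner y x"
  using assms by (auto simp: positive_semidefinite_def selfadjoint_def inner_eq_Re_cinner)

lemma psd_symmetric:
  assumes "positive_semidefinite R" "(x, w) \<in> R" "(x', w') \<in> R"
  shows "inner w x' = inner x w'"
  using assms(2,3) op_adjoint_iff_inner[OF psd_operator[OF assms(1)], of x' w'] psd_adjoint[OF assms(1)]
  by auto

lemma psd_closed: "positive_semidefinite R \<Longrightarrow> closed R"
  using closed_op_adjoint psd_adjoint psd_operator by metis

text \<open>
  The properties of \<open>(I + H)\<^sup>-\<^sup>1\<close> for a positive selfadjoint \<open>H\<close>. The condition \<open>0 \<le> J \<le> I\<close> takes the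
  form that \<open>J\<close> and \<open>I - J\<close> are contractions, which is what \<open>bounded_sqrt_exists\<close> consumes.
\<close>

definition resolvent_map :: "('a::complex_inner \<Rightarrow> 'a) \<Rightarrow> bool" where
  "resolvent_map J \<longleftrightarrow> symmetric_map J \<and> (\<forall>c x. J (c *\<^sub>C x) = c *\<^sub>C J x) \<and>
     (\<forall>x. norm (J x) \<le> norm x) \<and> (\<forall>x. norm (x - J x) \<le> norm x) \<and> (\<forall>x. J x = 0 \<longrightarrow> x = 0)"

text \<open>
  If \<open>(a, T a)\<close> is the projection of \<open>(x, 0)\<close> onto the graph of \<open>T\<close>, then the remainder
  \<open>(x - a, - T a)\<close> is orthogonal to the graph, which means \<open>T\<^sup>* T a = x - a\<close>. Thus
  \<open>J x = a\<close> defines \<open>(I + T\<^sup>* T)\<^sup>-\<^sup>1\<close> on the whole space.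
\<close>

lemma TstarT_resolvent:
  fixes T :: "('a::chilbert_space \<times> 'b::chilbert_space) set"
  assumes T: "is_operator T" "closed T" and dense: "closure (Domain T) = UNIV"
  obtains J F where "resolvent_map J"
    "\<And>x. (J x, F x) \<in> T" "\<And>x. (F x, x - J x) \<in> op_adjoint T"
    "T O op_adjoint T = {(J x, x - J x) | x. True}"
proof -
  have "\<exists>a b. (a, b) \<in> T \<and> (b, x - a) \<in> op_adjoint T" for x
  proof -
    \<comment> \<open>the projection of \<open>(x, 0)\<close> onto the closed graph\<close>
    obtain m where m: "m \<in> closure T" "\<And>h. h \<in> T \<Longrightarrow> inner h ((x, 0) - m) = 0"
      using orthogonal_decomposition[OF is_operator_subspace[OF T(1)]] by blast
    have "inner b (snd m) = inner a (x - fst m)" if "(a, b) \<in> T" for a b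
      using m(2)[OF that] by (cases m) (simp add: inner_diff_right)
    then have "(snd m, x - fst m) \<in> op_adjoint T"
      by (auto simp: op_adjoint_iff_inner[OF T(1)])
    then show ?thesis using m(1) T(2) by (metis closure_closed prod.collapse)
  qed
  then obtain J F where J: "\<And>x. (J x, F x) \<in> T" and F: "\<And>x. (F x, x - J x) \<in> op_adjoint T"
    by metis
  have adj: "inner w y = inner x z" if "(y, z) \<in> op_adjoint T" "(x, w) \<in> T" for x y z w
    using that op_adjoint_iff_inner[OF T(1), of y z] by auto
  have uniq: "a = J x" if "(a, b) \<in> T" "(b, x - a) \<in> op_adjoint T" for a b x
  proof -
    have 1: "(a - J x, b - F x) \<in> T" by (rule is_operator_diff[OF T(1) that(1) J])
    have "(- 1) *\<^sub>C F x = - F x" "(- 1) *\<^sub>C (x - J x) = - (x - J x)" by (simp_all only: scaleC_minus_one)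
    then have "(b + - F x, (x - a) + - (x - J x)) \<in> op_adjoint T"
      using op_adjoint_add[OF that(2) op_adjoint_scaleC[OF F, of "-1"]] by metis
    then have "(b - F x, - (a - J x)) \<in> op_adjoint T" by (simp add: algebra_simps)
    from adj[OF this 1] have "inner (b - F x) (b - F x) + inner (a - J x) (a - J x) = 0"
      by (simp only: inner_minus_right)
    then have "inner (a - J x) (a - J x) = 0"
      using inner_ge_zero[of "b - F x"] inner_ge_zero[of "a - J x"] by linarith
    then show ?thesis by simp
  qed
  have TT: "T O op_adjoint T = {(J x, x - J x) | x. True}"
  proof (intro set_eqI iffI)
    fix p assume "p \<in> T O op_adjoint T"
    then obtain a b h where p: "p = (a, h)" "(a, b) \<in> T" "(b, h) \<in> op_adjoint T" by blast
    then have "a = J (a + h)" by (intro uniq) auto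
    then show "p \<in> {(J x, x - J x) | x. True}" using p(1) by (auto intro!: exI[of _ "a + h"])
  qed (use J F in blast)
  have add: "J (x + y) = J x + J y" for x y
    by (rule uniq[symmetric, OF is_operator_add[OF T(1) J J]])
      (use op_adjoint_add[OF F[of x] F[of y]] in \<open>simp add: algebra_simps\<close>)
  have scC: "J (c *\<^sub>C x) = c *\<^sub>C J x" for c x
    by (rule uniq[symmetric, OF is_operator_scaleC[OF T(1) J]])
      (use op_adjoint_scaleC[OF F[of x], of c] in \<open>simp add: linear_diff[OF bounded_linear.linear[OF bounded_linear_scaleC]]\<close>)
  have lin: "linear J"
    by (rule linearI) (simp_all add: add scC[of "complex_of_real _", unfolded scaleC_of_real])
  have FF: "inner (F x) (F y) = inner (J x) (y - J y)" for x y by (rule adj[OF F J])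
  have sym: "inner (J x) y = inner x (J y)" for x y
    using FF[of x y] FF[of y x] by (simp add: inner_diff_right inner_commute)
  have n2: "(norm (F x))\<^sup>2 = inner (J x) x - (norm (J x))\<^sup>2" for x
    using FF[of x x] by (simp add: power2_norm_eq_inner inner_diff_right)
  have nJ: "norm (J x) \<le> norm x" for x
  proof -
    have "norm (J x) * norm (J x) \<le> norm (J x) * norm x"
      using n2[of x] norm_cauchy_schwarz[of "J x" x] zero_le_power2[of "norm (F x)"]
      by (simp add: power2_eq_square)
    then show ?thesis by (cases "J x = 0") auto
  qed
  have nK: "norm (x - J x) \<le> norm x" for x
  proof -
    have "(norm (x - J x))\<^sup>2 = (norm x)\<^sup>2 - 2 * inner (J x) x + (norm (J x))\<^sup>2"
      by (simp add: power2_norm_eq_inner inner_simps inner_commute)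
    also have "\<dots> \<le> (norm x)\<^sup>2"
      using n2[of x] zero_le_power2[of "norm (F x)"] zero_le_power2[of "norm (J x)"] by linarith
    finally show ?thesis by simp
  qed
  have inj: "x = 0" if "J x = 0" for x
  proof -
    have "F x = 0" using J[of x] that is_operatorD(1,2)[OF T(1)] by metis
    then have "inner a x = 0" if "(a, b) \<in> T" for a b
      using adj[OF F[of x] that] \<open>J x = 0\<close> by simp
    then show ?thesis
      using dense dense_iff_trivial_complement[OF csubspace_subspace[OF Domain_csubspace[OF T(1)]]] by blast
  qed
  show thesis
    by (rule that[OF _ J F TT])
      (auto simp: resolvent_map_def symmetric_map_def lin sym scC nJ nK inj)
qed

text \<open>
  A resolvent can be recovered from the operator that it belongs to.
\<close>

lemma resolvent_map_determined:
  assumes "resolvent_map J" "resolvent_map J'"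
    and "{(J x, x - J x) | x. True} = {(J' x, x - J' x) | x. True}"
  shows "J = J'"
proof
  fix x
  have "(J x, x - J x) \<in> {(J' x, x - J' x) | x. True}" using assms(3) by blast
  then obtain y where "J x = J' y" "x - J x = y - J' y" by blast
  then show "J x = J' x" by simp
qed

lemma commuting_product_nonneg:
  assumes P: "symmetric_map P" "\<And>x. norm (x - P x) \<le> norm x"
    and Q: "symmetric_map Q" "\<And>x. 0 \<le> inner (Q x) x" "bounded_linear Q"
    and comm: "\<And>x. Q (P x) = P (Q x)"
  shows "0 \<le> inner (P x) (Q (x :: 'a::{real_inner,complete_space}))"
proof -
  have linP: "linear P" using P(1) by (simp add: symmetric_map_def)
  have M: "symmetric_map (\<lambda>x. x - P x)"
    using P(1) by (auto simp: symmetric_map_def inner_simps intro!: linear_compose_sub linear_ident)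
  obtain q where q: "symmetric_map q" "\<And>x. q (q x) = x - (x - P x)"
    and qc: "\<And>L x. bounded_linear L \<Longrightarrow> (\<And>y. L (y - P y) = L y - P (L y)) \<Longrightarrow> L (q x) = q (L x)"
    by (rule bounded_sqrt_exists[OF M P(2)]) blast
  have cq: "Q (q y) = q (Q y)" for y
    by (rule qc[OF Q(3)]) (simp add: linear_diff[OF bounded_linear.linear[OF Q(3)]] comm)
  have "inner (P x) (Q x) = inner (q (q x)) (Q x)" by (simp add: q)
  also have "\<dots> = inner (q x) (Q (q x))" using q(1) by (simp add: symmetric_map_def cq)
  also have "\<dots> \<ge> 0" using Q(2)[of "q x"] by (simp add: inner_commute)
  finally show ?thesis .
qed

text \<open>
  From \<open>H = (I - J) J\<^sup>-\<^sup>1\<close> one expects \<open>H\<^sup>1\<^sup>/\<^sup>2 = k j\<^sup>-\<^sup>1\<close> with \<open>j = J\<^sup>1\<^sup>/\<^sup>2\<close> and \<open>k = (I - J)\<^sup>1\<^sup>/\<^sup>2\<close>, and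
  \<open>{(j z, k z)}\<close> is the graph of this operator. The identity \<open>j\<^sup>2 + k\<^sup>2 = I\<close> makes both
  selfadjointness and the computation of the square purely algebraic.
\<close>

lemma resolvent_sqrt:
  fixes J :: "'a::chilbert_space \<Rightarrow> 'a"
  assumes "resolvent_map J"
  obtains j k where "symmetric_map j" "symmetric_map k" "bounded_linear j" "bounded_linear k"
    "\<And>x. j (j x) = J x" "\<And>x. k (k x) = x - J x" "\<And>x. j (k x) = k (j x)"
    "\<And>x. 0 \<le> inner (k x) (j x)"
    "\<And>L x. bounded_linear L \<Longrightarrow> (\<And>y. L (J y) = J (L y)) \<Longrightarrow> L (j x) = j (L x)"
    "\<And>L x. bounded_linear L \<Longrightarrow> (\<And>y. L (J y) = J (L y)) \<Longrightarrow> L (k x) = k (L x)"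
    "positive_semidefinite {(j z, k z) | z. True}"
    "{(j z, k z) | z. True} O {(j z, k z) | z. True} = {(J x, x - J x) | x. True}"
proof -
  have Js: "symmetric_map J" and JC: "\<And>c x. J (c *\<^sub>C x) = c *\<^sub>C J x"
    and nJ: "\<And>x. norm (J x) \<le> norm x" and nK: "\<And>x. norm (x - J x) \<le> norm x"
    and J0: "\<And>x. J x = 0 \<Longrightarrow> x = 0"
    using assms by (auto simp: resolvent_map_def)
  have linJ: "linear J" and Jsym: "\<And>x y. inner (J x) y = inner x (J y)"
    using Js by (auto simp: symmetric_map_def)
  have blJ: "bounded_linear J"
    by (rule bounded_linear_intro[where K=1]) (auto simp: linear_add[OF linJ] linear_cmul[OF linJ] nJ)
  have Ks: "symmetric_map (\<lambda>x. x - J x)"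
    using Js by (auto simp: symmetric_map_def inner_simps intro!: linear_compose_sub linear_ident)
  obtain j where js: "symmetric_map j" and jpos: "\<And>x. 0 \<le> inner (j x) x"
    and jj: "\<And>x. j (j x) = x - (x - J x)" and jn: "\<And>x. norm (x - j x) \<le> norm x"
    and jc: "\<And>L x. bounded_linear L \<Longrightarrow> (\<And>y. L (y - J y) = L y - J (L y)) \<Longrightarrow> L (j x) = j (L x)"
    by (rule bounded_sqrt_exists[OF Ks nK]) blast
  obtain k where ks: "symmetric_map k" and kpos: "\<And>x. 0 \<le> inner (k x) x"
    and kk: "\<And>x. k (k x) = x - J x" and kn: "\<And>x. norm (x - k x) \<le> norm x"
    and kc: "\<And>L x. bounded_linear L \<Longrightarrow> (\<And>y. L (J y) = J (L y)) \<Longrightarrow> L (k x) = k (L x)"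
    by (rule bounded_sqrt_exists[OF Js nJ]) blast
  have jj': "j (j x) = J x" for x by (simp add: jj)
  have jc': "L (j x) = j (L x)" if "bounded_linear L" "\<And>y. L (J y) = J (L y)" for L x
    by (rule jc[OF that(1)]) (simp add: linear_diff[OF bounded_linear.linear[OF that(1)]] that(2))
  have jsym: "inner (j x) y = inner x (j y)" and ksym: "inner (k x) y = inner x (k y)" for x y
    using js ks by (auto simp: symmetric_map_def)
  have linj: "linear j" and link: "linear k" using js ks by (auto simp: symmetric_map_def)
  have pyth: "(norm (j x))\<^sup>2 + (norm (k x))\<^sup>2 = (norm x)\<^sup>2" for x
    by (simp add: power2_norm_eq_inner jsym ksym jj kk inner_simps)
  have nj: "norm (j x) \<le> norm x" for x
  proof -
    have "(norm (j x))\<^sup>2 \<le> (norm x)\<^sup>2" using pyth[of x] zero_le_power2[of "norm (k x)"] by linarith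
    then show ?thesis by simp
  qed
  have nk: "norm (k x) \<le> norm x" for x
  proof -
    have "(norm (k x))\<^sup>2 \<le> (norm x)\<^sup>2" using pyth[of x] zero_le_power2[of "norm (j x)"] by linarith
    then show ?thesis by simp
  qed
  have blj: "bounded_linear j"
    by (rule bounded_linear_intro[where K=1]) (auto simp: linear_add[OF linj] linear_cmul[OF linj] nj)
  have blk: "bounded_linear k"
    by (rule bounded_linear_intro[where K=1]) (auto simp: linear_add[OF link] linear_cmul[OF link] nk)
  have jJ: "j (J x) = J (j x)" for x using jj'[of "j x"] jj'[of x] by simp
  have jk: "j (k x) = k (j x)" for x by (rule kc[OF blj jJ])
  have jC: "j (c *\<^sub>C x) = c *\<^sub>C j x" and kC: "k (c *\<^sub>C x) = c *\<^sub>C k x" for c x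
    using jc'[OF bounded_linear_scaleC[of c], of x] kc[OF bounded_linear_scaleC[of c], of x] JC by auto
  have j0: "x = 0" if "j x = 0" for x
    using jj'[of x] that linear_0[OF linj] J0 by simp
  have kj: "0 \<le> inner (k x) (j x)" for x
    by (rule commuting_product_nonneg[OF ks kn js jpos blj]) (rule jk)
  define R where "R = {(j z, k z) | z. True}"
  have opR: "is_operator R"
    unfolding is_operator_def
  proof (intro conjI allI impI)
    show "single_valued R"
    proof (rule single_valuedI)
      fix x y y' assume "(x, y) \<in> R" "(x, y') \<in> R"
      then obtain z z' where z: "j z = j z'" "y = k z" "y' = k z'" by (auto simp: R_def)
      then have "j (z - z') = 0" by (simp add: linear_diff[OF linj])
      then have "z - z' = 0" by (rule j0)
      then show "y = y'" using z by simp
    qed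
    show "(0, 0) \<in> R" using linear_0[OF linj] linear_0[OF link] unfolding R_def by force
  next
    fix x y x' y' assume "(x, y) \<in> R" "(x', y') \<in> R"
    then show "(x + x', y + y') \<in> R"
      unfolding R_def by (auto simp: linear_add[OF linj, symmetric] linear_add[OF link, symmetric])
  next
    fix c x y assume "(x, y) \<in> R"
    then show "(c *\<^sub>C x, c *\<^sub>C y) \<in> R"
      unfolding R_def by (auto simp: jC[symmetric] kC[symmetric])
  qed
  have "op_adjoint R = R"
  proof (intro set_eqI iffI)
    fix p assume "p \<in> op_adjoint R"
    then obtain y v where p: "p = (y, v)" "(y, v) \<in> op_adjoint R" by (cases p) auto
    then have "inner (k z) y = inner (j z) v" for z
      unfolding op_adjoint_iff_inner[OF opR] by (auto simp: R_def)
    then have "inner z (k y - j v) = 0" for z by (simp add: ksym jsym inner_diff_right)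
    then have kjv: "k y = j v" by (metis inner_eq_zero_iff right_minus_eq)
    \<comment> \<open>the only candidate, as \<open>j (j w) + k (k w) = w\<close>\<close>
    define w where "w = j y + k v"
    have "j w = y" by (simp add: w_def linear_add[OF linj] jk flip: kjv) (simp add: jj kk)
    moreover have "k w = v"
      by (simp add: w_def linear_add[OF link] kk flip: jk) (simp add: kjv jj)
    ultimately show "p \<in> R" unfolding p R_def by blast
  next
    fix p assume "p \<in> R"
    then obtain z where p: "p = (j z, k z)" by (auto simp: R_def)
    have "inner (k a) (j z) = inner (j a) (k z)" for a by (simp add: ksym jsym jk)
    then show "p \<in> op_adjoint R" unfolding p op_adjoint_iff_inner[OF opR] by (auto simp: R_def)
  qed
  moreover have "closure (Domain R) = UNIV"
    unfolding dense_iff_trivial_complement[OF csubspace_subspace[OF Domain_csubspace[OF opR]]]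
  proof (intro allI impI)
    fix x assume "\<forall>m\<in>Domain R. inner m x = 0"
    then have "inner (j (j x)) x = 0" by (auto simp: R_def Domain_iff)
    then have "inner (j x) (j x) = 0" by (simp add: jsym)
    then show "x = 0" using j0 by simp
  qed
  ultimately have psd: "positive_semidefinite R"
    by (intro psdI opR) (auto simp: R_def kj)
  have "R O R = {(J x, x - J x) | x. True}"
  proof (intro set_eqI iffI)
    fix p assume "p \<in> R O R"
    then obtain z w where p: "p = (j z, k w)" "k z = j w" unfolding R_def by blast
    \<comment> \<open>again \<open>q\<close> is recovered from \<open>j q\<close> and \<open>k q\<close> through \<open>j\<^sup>2 + k\<^sup>2 = I\<close>\<close>
    define q where "q = j z + k w"
    have "j q = z" by (simp add: q_def linear_add[OF linj] jk flip: p(2)) (simp add: jj kk)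
    moreover have "k q = w"
      by (simp add: q_def linear_add[OF link] kk flip: jk) (simp add: p(2) jj)
    ultimately have "j z = J q" "k w = q - J q" by (metis jj', metis kk)
    then show "p \<in> {(J x, x - J x) | x. True}" unfolding p by blast
  next
    fix p assume "p \<in> {(J x, x - J x) | x. True}"
    then obtain z where p: "p = (J z, z - J z)" by blast
    have "(j (j z), k (j z)) \<in> R" "(j (k z), k (k z)) \<in> R" unfolding R_def by blast+
    then show "p \<in> R O R" unfolding p by (auto simp: jj' kk jk)
  qed
  with psd show thesis unfolding R_def
    by (intro that[of j k] js ks blj blk jj' kk jk kj jc' kc)
qed

text \<open>
  A root \<open>Q\<close> need not be bounded, but \<open>S = Q J\<close> is: it is a bounded positive root of
  \<open>(I - J) J\<close> that commutes with \<open>J\<close>, hence \<open>S = k j\<close> by uniqueness for bounded roots. This determines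
  \<open>Q\<close> on the range of \<open>J\<close>, and closedness determines the rest.
\<close>

lemma psd_sqrt_unique:
  fixes R R' :: "('a::chilbert_space \<times> 'a) set"
  assumes R: "positive_semidefinite R" and R': "positive_semidefinite R'" and eq: "R' O R' = R O R"
  shows "R' = R"
proof -
  obtain J F where J: "resolvent_map J" and "\<And>x. (J x, F x) \<in> R" "\<And>x. (F x, x - J x) \<in> R"
    and RR: "R O R = {(J x, x - J x) | x. True}"
    by (rule TstarT_resolvent[OF psd_operator[OF R] psd_closed[OF R] psd_dense[OF R], unfolded psd_adjoint[OF R]]) blast
  obtain j k where js: "symmetric_map j" and ks: "symmetric_map k"
    and blj: "bounded_linear j" and blk: "bounded_linear k"
    and jj: "\<And>x. j (j x) = J x" and kk: "\<And>x. k (k x) = x - J x" and jk: "\<And>x. j (k x) = k (j x)"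
    and kj: "\<And>x. 0 \<le> inner (k x) (j x)"
    and jc: "\<And>L x. bounded_linear L \<Longrightarrow> (\<And>y. L (J y) = J (L y)) \<Longrightarrow> L (j x) = j (L x)"
    and kc: "\<And>L x. bounded_linear L \<Longrightarrow> (\<And>y. L (J y) = J (L y)) \<Longrightarrow> L (k x) = k (L x)"
    and psd0: "positive_semidefinite {(j z, k z) | z. True}"
    and "{(j z, k z) | z. True} O {(j z, k z) | z. True} = {(J x, x - J x) | x. True}"
    by (rule resolvent_sqrt[OF J]) blast
  have linJ: "linear J" and Jsym: "\<And>x y. inner (J x) y = inner x (J y)"
    and nJ: "\<And>x. norm (J x) \<le> norm x" and nK: "\<And>x. norm (x - J x) \<le> norm x"
    using J by (auto simp: symmetric_map_def resolvent_map_def)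
  have jsym: "inner (j x) y = inner x (j y)" and ksym: "inner (k x) y = inner x (k y)" for x y
    using js ks by (auto simp: symmetric_map_def)
  define R0 where "R0 = {(j z, k z) | z. True}"
  have *: "Q = R0" if Q: "positive_semidefinite Q" and QQ: "Q O Q = R O R" for Q
  proof -
    obtain J' S where J': "resolvent_map J'" and S1: "\<And>x. (J' x, S x) \<in> Q"
      and S2: "\<And>x. (S x, x - J' x) \<in> Q" and QQ': "Q O Q = {(J' x, x - J' x) | x. True}"
      by (rule TstarT_resolvent[OF psd_operator[OF Q] psd_closed[OF Q] psd_dense[OF Q], unfolded psd_adjoint[OF Q]]) blast
    have "J' = J" by (rule resolvent_map_determined[OF J' J]) (rule trans[OF trans[OF QQ'[symmetric] QQ] RR])
    note S1 = S1[unfolded this] and S2 = S2[unfolded this] and QQ' = QQ'[unfolded this]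
    note sv = is_operator_single[OF psd_operator[OF Q]]
    have linS: "linear S"
    proof (rule linearI)
      show "S (x + y) = S x + S y" for x y
        using sv[OF S1[of "x + y"]] is_operator_add[OF psd_operator[OF Q] S1[of x] S1[of y]]
        by (simp add: linear_add[OF linJ])
      show "S (r *\<^sub>R x) = r *\<^sub>R S x" for r x
        using sv[OF S1[of "r *\<^sub>R x"]] subspace_scale[OF is_operator_subspace[OF psd_operator[OF Q]] S1[of x], of r]
        by (simp add: linear_cmul[OF linJ])
    qed
    \<comment> \<open>\<open>J a\<close> is the unique \<open>b\<close> with \<open>(b, a - b)\<close> in \<open>Q O Q\<close>; both steps in \<open>Q\<close> are known\<close>
    have SJ: "S (J x) = J (S x)" for x
    proof -
      have "(J x - J (J x), S x - S (J x)) \<in> Q" by (rule is_operator_diff[OF psd_operator[OF Q] S1 S1])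
      then have "(S (J x), S x - S (J x)) \<in> Q O Q" using S2[of "J x"] by blast
      then obtain y where "S (J x) = J y" "S x - S (J x) = y - J y" unfolding QQ' by blast
      then show ?thesis by simp
    qed
    have SS: "S (S x) = J x - J (J x)" for x
      using sv[OF S1[of "S x"]] S2[of "J x"] by (simp add: SJ)
    have Ssym: "inner (S x) y = inner x (S y)" for x y
    proof -
      have "inner (S x) (J y) = inner (J x) (S y)" by (rule psd_symmetric[OF Q S1 S1])
      moreover have "inner (x - J x) (S y) = inner (S x) (y - J y)" by (rule psd_symmetric[OF Q S2 S2])
      ultimately show ?thesis by (simp add: inner_diff_left inner_diff_right)
    qed
    have Spos: "0 \<le> inner (S x) x" for x
      using psd_nonneg[OF Q S1[of x]] psd_nonneg[OF Q S2[of x]]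
      by (simp add: inner_diff_left inner_commute inner_diff_right)
    have nS: "norm (S x) \<le> norm x" for x
    proof -
      have "(norm (S x))\<^sup>2 = inner (J (x - J x)) x"
        by (simp add: power2_norm_eq_inner Ssym SS linear_diff[OF linJ] inner_commute)
      also have "\<dots> \<le> norm (J (x - J x)) * norm x" by (rule norm_cauchy_schwarz)
      also have "\<dots> \<le> norm x * norm x"
        by (intro mult_right_mono order_trans[OF nJ nK]) simp
      finally show ?thesis by (simp add: power2_eq_square[symmetric])
    qed
    have blS: "bounded_linear S"
      by (rule bounded_linear_intro[where K=1]) (auto simp: linear_add[OF linS] linear_cmul[OF linS] nS)
    have S: "S x = k (j x)" for x
    proof (rule commuting_positive_sqrt_unique[of S "\<lambda>x. k (j x)"])
      show "symmetric_map S" using linS Ssym by (simp add: symmetric_map_def)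
      show "0 \<le> inner (S x) x" for x by (rule Spos)
      show "symmetric_map (\<lambda>x. k (j x))"
        using linear_compose[OF bounded_linear.linear[OF blj] bounded_linear.linear[OF blk]]
        by (simp add: symmetric_map_def o_def ksym jsym jk)
      show "0 \<le> inner (k (j x)) x" for x using kj[of x] by (simp add: jsym jk[symmetric])
      show "S (k (j x)) = k (j (S x))" for x
        by (simp add: kc[OF blS SJ] jc[OF blS SJ])
      show "S (S x) = k (j (k (j x)))" for x
        by (simp add: SS jk kk jj)
    qed
    have "R0 \<subseteq> Q"
    proof
      fix p assume "p \<in> R0"
      then obtain z where p: "p = (j z, k z)" by (auto simp: R0_def)
      have "z \<in> closure (range j)"
      proof -
        have "x = 0" if "\<forall>m\<in>range j. inner m x = 0" for x
        proof -
          have "inner (j (j x)) x = 0" using that by auto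
          then have "j x = 0" using jsym[of "j x" x] by simp
          then have "J x = 0" using jj[of x] linear_0[OF bounded_linear.linear[OF blj]] by simp
          then show ?thesis using J by (simp add: resolvent_map_def)
        qed
        then show ?thesis
          using dense_iff_trivial_complement[OF linear_subspace_image[OF bounded_linear.linear[OF blj] subspace_UNIV]]
          by blast
      qed
      then obtain w where w: "\<And>n. w n \<in> range j" "w \<longlonglongrightarrow> z" using closure_sequential by blast
      then have "\<forall>n. \<exists>x. w n = j x" by blast
      then obtain x where "\<And>n. w n = j (x n)" by metis
      then have "w = (\<lambda>n. j (x n))" by blast
      then have x: "(\<lambda>n. j (x n)) \<longlonglongrightarrow> z" using w(2) by simp
      have "(\<lambda>n. (j (j (x n)), k (j (x n)))) \<longlonglongrightarrow> p"
        unfolding p by (intro tendsto_Pair bounded_linear.tendsto[OF blj] bounded_linear.tendsto[OF blk] x)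
      moreover have "(j (j (x n)), k (j (x n))) \<in> Q" for n using S1[of "x n"] by (simp add: S jj)
      ultimately show "p \<in> Q" by (rule closed_sequentially[OF psd_closed[OF Q], rotated])
    qed
    \<comment> \<open>selfadjoint operators have no proper selfadjoint extensions\<close>
    then have "Q \<subseteq> R0"
      using op_adjoint_antimono[of R0 Q] unfolding psd_adjoint[OF Q] psd_adjoint[OF psd0, folded R0_def] by blast
    with \<open>R0 \<subseteq> Q\<close> show ?thesis by blast
  qed
  show ?thesis by (rule trans[OF *[OF R' eq] *[OF R refl, symmetric]])
qed

lemma op_sqrt_eq:
  fixes R :: "('a::chilbert_space \<times> 'a) set"
  assumes "positive_semidefinite R" shows "op_sqrt (R O R) = R"
  unfolding op_sqrt_def
  by (rule the_equality) (use assms psd_sqrt_unique in blast)+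

text \<open>
  On the domain of \<open>T\<^sup>* T\<close> the norm \<open>\<parallel>T x\<parallel>\<^sup>2 = \<langle>T\<^sup>* T x, x\<rangle>\<close> depends on \<open>T\<^sup>* T\<close> only. This domain is a
  core: a vector of the graph orthogonal to all \<open>(J z, T J z)\<close> vanishes.
\<close>

lemma TstarT_determines_form:
  fixes T :: "('a::chilbert_space \<times> 'b::chilbert_space) set" and T' :: "('a \<times> 'c::chilbert_space) set"
  assumes T: "is_operator T" "closed T" "closure (Domain T) = UNIV"
    and T': "is_operator T'" "closed T'" "closure (Domain T') = UNIV"
    and eq: "T O op_adjoint T = T' O op_adjoint T'" and xy: "(x, y) \<in> T"
  shows "\<exists>y'. (x, y') \<in> T' \<and> norm y' = norm y"
proof -
  obtain J F where J: "resolvent_map J" and F1: "\<And>x. (J x, F x) \<in> T"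
    and F2: "\<And>x. (F x, x - J x) \<in> op_adjoint T" and TT: "T O op_adjoint T = {(J x, x - J x) | x. True}"
    by (rule TstarT_resolvent[OF T]) blast
  obtain J' F' where J': "resolvent_map J'" and F1': "\<And>x. (J' x, F' x) \<in> T'"
    and F2': "\<And>x. (F' x, x - J' x) \<in> op_adjoint T'" and TT': "T' O op_adjoint T' = {(J' x, x - J' x) | x. True}"
    by (rule TstarT_resolvent[OF T']) blast
  have "J' = J" by (rule resolvent_map_determined[OF J' J]) (rule trans[OF trans[OF TT'[symmetric] eq[symmetric]] TT])
  note F1' = F1'[unfolded this] and F2' = F2'[unfolded this]
  have linJ: "linear J" using J by (simp add: resolvent_map_def symmetric_map_def)
  have linF: "F (x + r *\<^sub>R y) = F x + r *\<^sub>R F y" for x r y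
    using is_operator_single[OF T(1) F1[of "x + r *\<^sub>R y"]]
      subspace_add[OF is_operator_subspace[OF T(1)] F1[of x]
        subspace_scale[OF is_operator_subspace[OF T(1)] F1[of y], of r]]
    by (simp add: linear_add[OF linJ] linear_cmul[OF linJ])
  have linF': "F' (x + r *\<^sub>R y) = F' x + r *\<^sub>R F' y" for x r y
    using is_operator_single[OF T'(1) F1'[of "x + r *\<^sub>R y"]]
      subspace_add[OF is_operator_subspace[OF T'(1)] F1'[of x]
        subspace_scale[OF is_operator_subspace[OF T'(1)] F1'[of y], of r]]
    by (simp add: linear_add[OF linJ] linear_cmul[OF linJ])
  have nF: "norm (F' z) = norm (F z)" for z
  proof -
    have "inner (F z) (F z) = inner (J z) (z - J z)"
      using F2[of z] F1[of z] op_adjoint_iff_inner[OF T(1)] by blast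
    moreover have "inner (F' z) (F' z) = inner (J z) (z - J z)"
      using F2'[of z] F1'[of z] op_adjoint_iff_inner[OF T'(1)] by blast
    ultimately show ?thesis by (simp add: norm_eq_sqrt_inner)
  qed
  \<comment> \<open>\<open>G\<close> is the graph of \<open>T\<close> restricted to the domain of \<open>T\<^sup>* T\<close>\<close>
  define G where "G = range (\<lambda>z. (J z, F z))"
  have "linear (\<lambda>z. (J z, F z))"
    using linF[of _ 1] linF[of 0] linear_0[OF linJ] is_operator_single[OF T(1) F1[of 0]] is_operator_zero[OF T(1)]
    by (intro linearI) (auto simp: linear_add[OF linJ] linear_cmul[OF linJ])
  then have subG: "subspace G" unfolding G_def by (rule linear_subspace_image) (rule subspace_UNIV)
  have GT: "closure G \<subseteq> T" unfolding G_def by (rule closure_minimal) (use F1 T(2) in auto)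
  obtain m where m: "m \<in> closure G" "\<And>h. h \<in> G \<Longrightarrow> inner h ((x, y) - m) = 0"
    using orthogonal_decomposition[OF subG] by blast
  have pq: "(x - fst m, y - snd m) \<in> T"
    using is_operator_diff[OF T(1) xy] GT m(1) by (metis prod.collapse subsetD)
  have "inner (x - fst m) z = 0" for z
  proof -
    have "inner (y - snd m) (F z) = inner (x - fst m) (z - J z)"
      using F2[of z] pq op_adjoint_iff_inner[OF T(1)] by blast
    moreover have "inner (J z) (x - fst m) + inner (F z) (y - snd m) = 0"
      using m(2)[of "(J z, F z)"] by (cases m) (auto simp: G_def)
    ultimately show ?thesis by (simp add: inner_diff_right inner_commute)
  qed
  then have "x - fst m = 0" using inner_eq_zero_iff by blast
  moreover have "y - snd m = 0"
    using pq is_operatorD(1,2)[OF T(1)] \<open>x - fst m = 0\<close> by metis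
  ultimately have "(x, y) \<in> closure G" using m(1) by (cases m) simp
  then obtain p where p: "\<And>n. p n \<in> G" "p \<longlonglongrightarrow> (x, y)" using closure_sequential by blast
  then have "\<forall>n. \<exists>z. p n = (J z, F z)" by (auto simp: G_def)
  then obtain z where z: "\<And>n. p n = (J (z n), F (z n))" by metis
  have Jz: "(\<lambda>n. J (z n)) \<longlonglongrightarrow> x" and Fz: "(\<lambda>n. F (z n)) \<longlonglongrightarrow> y"
    using tendsto_fst[OF p(2)] tendsto_snd[OF p(2)] by (simp_all add: z)
  have "dist (F' (z m)) (F' (z n)) = dist (F (z m)) (F (z n))" for m n
    using nF[of "z m - z n"] linF[of "z m" "-1" "z n"] linF'[of "z m" "-1" "z n"] by (simp add: dist_norm)
  then have "Cauchy (\<lambda>n. F' (z n))"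
    using LIMSEQ_imp_Cauchy[OF Fz] by (simp add: Cauchy_def)
  then obtain y' where y': "(\<lambda>n. F' (z n)) \<longlonglongrightarrow> y'" using Cauchy_convergent convergent_def by blast
  have "(x, y') \<in> T'"
    by (rule closed_sequentially[OF T'(2) _ tendsto_Pair[OF Jz y']]) (rule F1')
  moreover have "norm y' = norm y"
    using tendsto_norm[OF y'] tendsto_norm[OF Fz] unfolding nF by (rule LIMSEQ_unique)
  ultimately show ?thesis by blast
qed

lemma TstarT_sqrt:
  fixes T :: "('a::chilbert_space \<times> 'b::chilbert_space) set"
  assumes T: "is_operator T" "closed T" "closure (Domain T) = UNIV"
  obtains R where "positive_semidefinite R" "R O R = T O op_adjoint T"
    "\<And>x y. (x, y) \<in> T \<Longrightarrow> \<exists>y'. (x, y') \<in> R \<and> norm y' = norm y"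
    "\<And>x y. (x, y) \<in> R \<Longrightarrow> \<exists>y'. (x, y') \<in> T \<and> norm y' = norm y"
proof -
  obtain J where J: "resolvent_map J" and TT: "T O op_adjoint T = {(J x, x - J x) | x. True}"
    by (rule TstarT_resolvent[OF T]) blast
  obtain R where R: "positive_semidefinite R" "R O R = {(J x, x - J x) | x. True}"
  proof (rule resolvent_sqrt[OF J])
    fix j k assume "positive_semidefinite {(j z, k z) | z. True}"
      "{(j z, k z) | z. True} O {(j z, k z) | z. True} = {(J x, x - J x) | x. True}"
    then show thesis by (rule that)
  qed
  note R' = psd_operator[OF R(1)] psd_closed[OF R(1)] psd_dense[OF R(1)]
  have "T O op_adjoint T = R O op_adjoint R" using R(2) TT psd_adjoint[OF R(1)] by simp
  from TstarT_determines_form[OF T R' this] TstarT_determines_form[OF R' T this[symmetric]]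
  show thesis by (intro that[OF R(1)]) (simp_all only: R(2) TT)
qed

section \<open>Adjoints of bounded operators\<close>

lemma bounded_clinearD:
  assumes "bounded_clinear f"
  shows bounded_clinear_bl: "bounded_linear f" and bounded_clinear_scaleC: "f (c *\<^sub>C x) = c *\<^sub>C f x"
    and bounded_clinear_add: "f (x + y) = f x + f y" and bounded_clinear_diff: "f (x - y) = f x - f y"
    and bounded_clinear_zero: "f 0 = 0" and bounded_clinear_scaleR: "f (r *\<^sub>R x) = r *\<^sub>R f x"
  using assms linear_add[of f] linear_diff[of f] linear_0[of f] linear_cmul[of f]
  by (auto simp: bounded_clinear_def dest: bounded_linear.linear)

lemma cinner_left_ext: "(\<And>x. cinner x y = cinner x z) \<Longrightarrow> y = (z :: 'a::complex_inner)"
  by (metis inner_eq_Re_cinner inner_diff_right inner_eq_zero_iff right_minus_eq)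

lemma cinner_right_ext:
  assumes "\<And>y. cinner x y = cinner z y"
  shows "x = (z :: 'a::complex_inner)"
proof (rule cinner_left_ext)
  show "cinner y x = cinner y z" for y
    using assms[of y] cinner_commute[of y x] cinner_commute[of y z] by simp
qed

lemma cadjoint_eqI:
  fixes f :: "'a::complex_inner \<Rightarrow> 'b::complex_inner"
  assumes "\<And>x y. cinner (f x) y = cinner x (g y)"
  shows "cadjoint f = g"
  unfolding cadjoint_def
proof (rule the_equality)
  show "\<forall>x y. cinner (f x) y = cinner x (g y)" using assms by blast
  fix h assume h: "\<forall>x y. cinner (f x) y = cinner x (h y)"
  have "cinner x (h y) = cinner x (g y)" for x y
    using h assms[of x y] by simp
  then show "h = g" using cinner_left_ext by blast
qed

lemma cadjoint_cinner:
  fixes f :: "'a::chilbert_space \<Rightarrow> 'b::chilbert_space"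
  assumes f: "bounded_clinear f"
  shows "cinner (f x) y = cinner x (cadjoint f y)"
proof -
  obtain g where g: "\<And>x y. inner (f x) y = inner x (g y)"
    using hilbert_adjoint_exists[OF bounded_clinear_bl[OF f]] by blast
  have "cinner (f x) y = cinner x (g y)" for x y
    by (simp add: cinner_eq_Complex g flip: bounded_clinear_scaleC[OF f])
  then have "cadjoint f = g" by (rule cadjoint_eqI)
  then show ?thesis using \<open>\<And>x y. cinner (f x) y = cinner x (g y)\<close> by simp
qed

lemma cadjoint_inner:
  fixes f :: "'a::chilbert_space \<Rightarrow> 'b::chilbert_space"
  assumes "bounded_clinear f"
  shows "inner (f x) y = inner x (cadjoint f y)"
  using cadjoint_cinner[OF assms] by (simp add: inner_eq_Re_cinner)

lemma bounded_clinear_cadjoint: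
  fixes f :: "'a::chilbert_space \<Rightarrow> 'b::chilbert_space"
  assumes f: "bounded_clinear f"
  shows "bounded_clinear (cadjoint f)"
proof -
  obtain K where K: "0 \<le> K" "\<And>x. norm (f x) \<le> norm x * K"
    using bounded_linear.nonneg_bounded[OF bounded_clinear_bl[OF f]] by blast
  have add: "cadjoint f (x + y) = cadjoint f x + cadjoint f y" for x y
    by (rule cinner_left_ext) (simp add: cinner_add_right flip: cadjoint_cinner[OF f])
  have sc: "cadjoint f (c *\<^sub>C x) = c *\<^sub>C cadjoint f x" for c x
    by (rule cinner_left_ext) (simp add: cinner_scaleC_right flip: cadjoint_cinner[OF f])
  have "norm (cadjoint f y) \<le> norm y * K" for y
  proof -
    have "(norm (cadjoint f y))\<^sup>2 = inner (f (cadjoint f y)) y"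
      by (simp add: cadjoint_inner[OF f] power2_norm_eq_inner)
    also have "\<dots> \<le> norm (f (cadjoint f y)) * norm y" by (rule norm_cauchy_schwarz)
    also have "\<dots> \<le> (norm (cadjoint f y) * K) * norm y" by (intro mult_right_mono K) simp
    finally have "norm (cadjoint f y) * norm (cadjoint f y) \<le> norm (cadjoint f y) * (norm y * K)"
      by (simp add: power2_eq_square mult_ac)
    then show ?thesis using K(1) by (cases "cadjoint f y = 0") auto
  qed
  then have "bounded_linear (cadjoint f)"
    by (intro bounded_linear_intro) (auto simp: add sc[of "complex_of_real _", unfolded scaleC_of_real])
  then show ?thesis by (simp add: bounded_clinear_def sc)
qed

lemma cadjoint_cadjoint:
  fixes f :: "'a::chilbert_space \<Rightarrow> 'b::chilbert_space"
  assumes f: "bounded_clinear f"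
  shows "cadjoint (cadjoint f) = f"
proof (rule cadjoint_eqI)
  show "cinner (cadjoint f x) y = cinner x (f y)" for x y
    by (metis cadjoint_cinner[OF f] cinner_commute)
qed

section \<open>Solutions of the KYP inequality and their inverses\<close>

text \<open>
  The KYP inequality together with positive definiteness, expressed through the square root \<open>R\<close> of
  the solution, since all estimates are made there.
\<close>

definition kyp_root ::
  "('x::chilbert_space \<Rightarrow> 'x) \<Rightarrow> ('u::chilbert_space \<Rightarrow> 'x) \<Rightarrow> ('x \<Rightarrow> 'y::chilbert_space) \<Rightarrow> ('u \<Rightarrow> 'y)
    \<Rightarrow> ('x \<times> 'x) set \<Rightarrow> bool" where
  "kyp_root A B C D R \<longleftrightarrow> positive_semidefinite R \<and> (\<forall>x. (x, 0) \<in> R \<longrightarrow> x = 0) \<and>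
     (\<forall>x y u. (x, y) \<in> R \<longrightarrow> (\<exists>z. (A x + B u, z) \<in> R \<and>
        (norm z)\<^sup>2 + (norm (C x + D u))\<^sup>2 \<le> (norm y)\<^sup>2 + (norm u)\<^sup>2))"

text \<open>
  With \<open>R O R = {(J z, z - J z)}\<close>, membership of \<open>(y, v)\<close> in the adjoint reads \<open>y = J (y + v)\<close>.
\<close>

lemma psd_square:
  fixes R :: "('x::chilbert_space \<times> 'x) set"
  assumes R: "positive_semidefinite R"
  shows "positive_semidefinite (R O R)"
proof -
  note op = psd_operator[OF R]
  obtain J F where J: "resolvent_map J" and F: "\<And>x. (J x, F x) \<in> R" "\<And>x. (F x, x - J x) \<in> R"
    and RR: "R O R = {(J x, x - J x) | x. True}"
    by (rule TstarT_resolvent[OF op psd_closed[OF R] psd_dense[OF R], unfolded psd_adjoint[OF R]]) blast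
  have linJ: "linear J" and sym: "inner (J x) y = inner x (J y)" for x y
    using J by (auto simp: resolvent_map_def symmetric_map_def)
  have opH: "is_operator (R O R)"
    unfolding is_operator_def
  proof (intro conjI allI impI)
    show "single_valued (R O R)" using op by (intro single_valued_relcomp) (auto simp: is_operator_def)
    show "(0, 0) \<in> R O R" using is_operator_zero[OF op] by blast
  qed (blast intro: is_operator_add[OF op] is_operator_scaleC[OF op])+
  show ?thesis
  proof (rule psdI[OF opH])
    have "x = 0" if "\<forall>m\<in>Domain (R O R). inner m x = 0" for x
    proof -
      have "inner (J (J x)) x = 0" using that unfolding RR by blast
      then have "J x = 0" using sym[of "J x" x] by simp
      then show ?thesis using J by (simp add: resolvent_map_def)
    qed
    then show "closure (Domain (R O R)) = UNIV"
      using dense_iff_trivial_complement[OF csubspace_subspace[OF Domain_csubspace[OF opH]]] by blast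
    show "op_adjoint (R O R) = R O R"
    proof (intro set_eqI iffI)
      fix p assume "p \<in> op_adjoint (R O R)"
      then obtain y v where p: "p = (y, v)" "(y, v) \<in> op_adjoint (R O R)" by (cases p) auto
      have "inner z (y - J (y + v)) = 0" for z
      proof -
        have "(J z, z - J z) \<in> R O R" unfolding RR by blast
        then have "inner (z - J z) y = inner (J z) v"
          using p(2) op_adjoint_iff_inner[OF opH] by blast
        then show ?thesis by (simp add: inner_diff_left inner_diff_right inner_add_right linear_add[OF linJ] sym)
      qed
      then have "y = J (y + v)" by (metis inner_eq_zero_iff right_minus_eq)
      then have "(y, v) = (J (y + v), (y + v) - J (y + v))" by simp
      then show "p \<in> R O R" unfolding p RR by blast
    next
      fix p assume "p \<in> R O R"
      then obtain z where p: "p = (J z, z - J z)" unfolding RR by blast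
      show "p \<in> op_adjoint (R O R)"
        unfolding p op_adjoint_iff_inner[OF opH] unfolding RR
        by (auto simp: inner_diff_left inner_diff_right sym)
    qed
    show "0 \<le> inner y x" if xy: "(x, y) \<in> R O R" for x y
    proof -
      obtain w where w: "(x, w) \<in> R" "(w, y) \<in> R" using xy by blast
      then show ?thesis using psd_symmetric[OF R w(1) w(2)] inner_ge_zero[of w] by (simp add: inner_commute)
    qed
  qed
qed

lemma positive_definite_square:
  fixes R :: "('x::chilbert_space \<times> 'x) set"
  assumes R: "positive_semidefinite R" and inj: "\<And>x. (x, 0) \<in> R \<Longrightarrow> x = 0"
  shows "positive_definite (R O R)"
  unfolding positive_definite_def
proof (intro conjI psd_square[OF R] ballI, clarify)
  fix x w y assume w: "(x, w) \<in> R" "(w, y) \<in> R" and "x \<noteq> 0"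
  then have "w \<noteq> 0" using inj by blast
  then show "0 < Re (cinner y x)"
    using psd_symmetric[OF R w(1) w(2)] inner_gt_zero_iff[of w]
    by (simp add: inner_commute flip: inner_eq_Re_cinner)
qed

lemma psd_inverse:
  fixes R :: "('x::chilbert_space \<times> 'x) set"
  assumes R: "positive_semidefinite R" and inj: "\<And>x. (x, 0) \<in> R \<Longrightarrow> x = 0"
  shows "positive_semidefinite (R\<inverse>)"
proof -
  note op = psd_operator[OF R]
  have opI: "is_operator (R\<inverse>)"
    unfolding is_operator_def
  proof (intro conjI allI impI)
    show "single_valued (R\<inverse>)"
    proof (rule single_valuedI)
      fix x y z assume "(x, y) \<in> R\<inverse>" "(x, z) \<in> R\<inverse>"
      then have "(y - z, x - x) \<in> R" by (intro is_operator_diff[OF op]) auto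
      then show "y = z" using inj[of "y - z"] by simp
    qed
    show "(0, 0) \<in> R\<inverse>" using is_operator_zero[OF op] by blast
  qed (blast intro: is_operator_add[OF op] is_operator_scaleC[OF op])+
  have adj: "op_adjoint (R\<inverse>) = R\<inverse>"
  proof -
    have "p \<in> op_adjoint (R\<inverse>) \<longleftrightarrow> p \<in> (op_adjoint R)\<inverse>" for p
      by (cases p) (auto simp: op_adjoint_iff)
    then show ?thesis by (auto simp: psd_adjoint[OF R])
  qed
  have "x = 0" if *: "\<forall>m\<in>Domain (R\<inverse>). inner m x = 0" for x
  proof -
    have "inner w x = inner a 0" if "(a, w) \<in> R" for a w using * that by (auto simp: Domain_iff)
    then have "(x, 0) \<in> op_adjoint R" by (auto simp: op_adjoint_iff_inner[OF op])
    then show ?thesis using inj by (simp add: psd_adjoint[OF R])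
  qed
  then have "closure (Domain (R\<inverse>)) = UNIV"
    using dense_iff_trivial_complement[OF csubspace_subspace[OF Domain_csubspace[OF opI]]] by blast
  then show ?thesis
    by (intro psdI opI adj) (auto dest: psd_nonneg[OF R] simp: inner_commute)
qed

text \<open>
  By the KYP inequality \<open>(R x, u) \<mapsto> (R (A x + B u), C x + D u)\<close> is a contraction on the range of \<open>R\<close>
  times the input space. Paired with \<open>(w, y)\<close> it is therefore represented by some \<open>(p, q)\<close> of norm
  at most \<open>\<parallel>(w, y)\<parallel>\<close>. Because \<open>R\<close> is selfadjoint, the first component identifies
  \<open>R p = A\<^sup>* R w + C\<^sup>* y\<close>, and the second is \<open>q = B\<^sup>* R w + D\<^sup>* y\<close>.
\<close>

lemma kyp_root_inverse:
  fixes A :: "'x::chilbert_space \<Rightarrow> 'x" and B :: "'u::chilbert_space \<Rightarrow> 'x"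
    and C :: "'x \<Rightarrow> 'y::chilbert_space" and D :: "'u \<Rightarrow> 'y"
  assumes bd: "bounded_clinear A" "bounded_clinear B" "bounded_clinear C" "bounded_clinear D"
    and kyp: "kyp_root A B C D R"
  shows "kyp_root (cadjoint A) (cadjoint C) (cadjoint B) (cadjoint D) (R\<inverse>)"
proof -
  have R: "positive_semidefinite R" and inj: "\<And>x. (x, 0) \<in> R \<Longrightarrow> x = 0"
    and ineq: "\<And>x y u. (x, y) \<in> R \<Longrightarrow> \<exists>z. (A x + B u, z) \<in> R \<and>
        (norm z)\<^sup>2 + (norm (C x + D u))\<^sup>2 \<le> (norm y)\<^sup>2 + (norm u)\<^sup>2"
    using kyp by (auto simp: kyp_root_def)
  note op = psd_operator[OF R]
  have "\<exists>p. (cadjoint A xs + cadjoint C y, p) \<in> R\<inverse> \<and>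
      (norm p)\<^sup>2 + (norm (cadjoint B xs + cadjoint D y))\<^sup>2 \<le> (norm w)\<^sup>2 + (norm y)\<^sup>2"
    if w: "(xs, w) \<in> R\<inverse>" for xs w y
  proof -
    have wR: "(w, xs) \<in> R" using w by simp
    \<comment> \<open>\<open>r = R x\<close> determines \<open>x\<close>, because \<open>R\<close> is injective\<close>
    define l where "l = (\<lambda>(r, u). inner (A (THE x. (x, r) \<in> R) + B u) xs + inner (C (THE x. (x, r) \<in> R) + D u) y)"
    have l: "l (r, u) = inner (A x + B u) xs + inner (C x + D u) y" if "(x, r) \<in> R" for x r u
    proof -
      have "(THE x. (x, r) \<in> R) = x"
      proof (rule the_equality)
        show "(x, r) \<in> R" by (rule that)
        fix x' assume "(x', r) \<in> R"
        then have "(x' - x, r - r) \<in> R" by (intro is_operator_diff[OF op] that)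
        then show "x' = x" using inj[of "x' - x"] by simp
      qed
      then show ?thesis by (simp add: l_def)
    qed
    let ?S = "Range R \<times> (UNIV :: 'u set)"
    have "subspace (Range R)"
      using csubspace_subspace[OF Domain_csubspace[OF psd_operator[OF psd_inverse[OF R inj]]]] by simp
    then have sub: "subspace ?S" by (intro subspace_Times) auto
    obtain z where z: "\<And>p. p \<in> ?S \<Longrightarrow> l p = inner p z" "norm z \<le> norm (w, y)"
    proof (rule riesz_subspace[OF sub, of "norm (w, y)" l])
      fix p p' assume "p \<in> ?S" "p' \<in> ?S"
      then obtain x r u x' r' u' where p: "p = (r, u)" "(x, r) \<in> R" "p' = (r', u')" "(x', r') \<in> R"
        by (metis RangeE mem_Times_iff prod.collapse)
      show "l (p + p') = l p + l p'"
        unfolding p add_Pair l[OF p(2)] l[OF p(4)] l[OF is_operator_add[OF op p(2,4)]]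
        by (simp add: bd[THEN bounded_clinear_add] inner_add_left)
    next
      fix t p assume "p \<in> ?S"
      then obtain x r u where p: "p = (r, u)" "(x, r) \<in> R"
        by (metis RangeE mem_Times_iff prod.collapse)
      have "(t *\<^sub>R x, t *\<^sub>R r) \<in> R"
        using subspace_scale[OF is_operator_subspace[OF op] p(2)] by simp
      then show "l (t *\<^sub>R p) = t * l p"
        unfolding p l[OF p(2)] by (simp add: l bd[THEN bounded_clinear_scaleR] inner_add_left algebra_simps)
    next
      fix p assume "p \<in> ?S"
      then obtain x r u where p: "p = (r, u)" "(x, r) \<in> R"
        by (metis RangeE mem_Times_iff prod.collapse)
      obtain z where z: "(A x + B u, z) \<in> R" "(norm z)\<^sup>2 + (norm (C x + D u))\<^sup>2 \<le> (norm r)\<^sup>2 + (norm u)\<^sup>2"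
        using ineq[OF p(2)] by blast
      have "l p = inner z w + inner (C x + D u) y"
        unfolding p l[OF p(2)] by (simp add: psd_symmetric[OF R z(1) wR])
      also have "\<dots> = inner (z, C x + D u) (w, y)" by simp
      also have "\<dots> \<le> norm (z, C x + D u) * norm (w, y)" by (rule norm_cauchy_schwarz)
      also have "\<dots> \<le> norm p * norm (w, y)"
        by (intro mult_right_mono) (use z(2) in \<open>auto simp: norm_Pair p\<close>)
      finally show "l p \<le> norm (w, y) * norm p" by (simp add: mult.commute)
    qed simp_all
    obtain p q where pq: "z = (p, q)" by (cases z)
    have A: "inner x (cadjoint A xs + cadjoint C y) = inner r p" if "(x, r) \<in> R" for x r
      using z(1)[of "(r, 0)"] l[OF that, of 0] that
      by (auto simp: pq bd[THEN bounded_clinear_zero] inner_add_right bd[THEN cadjoint_inner, symmetric])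
    have "(p, cadjoint A xs + cadjoint C y) \<in> op_adjoint R"
      unfolding op_adjoint_iff_inner[OF op] by (auto simp: A)
    then have 1: "(cadjoint A xs + cadjoint C y, p) \<in> R\<inverse>" by (simp add: psd_adjoint[OF R])
    have "inner u (cadjoint B xs + cadjoint D y) = inner u q" for u
      using z(1)[of "(0, u)"] l[OF is_operator_zero[OF op], of u] is_operator_zero[OF op]
      by (auto simp: pq bd[THEN bounded_clinear_zero] inner_add_right bd[THEN cadjoint_inner, symmetric])
    then have "inner u (cadjoint B xs + cadjoint D y - q) = 0" for u by (simp add: inner_diff_right)
    then have "cadjoint B xs + cadjoint D y = q" by (metis inner_eq_zero_iff right_minus_eq)
    then have "(norm p)\<^sup>2 + (norm (cadjoint B xs + cadjoint D y))\<^sup>2 \<le> (norm w)\<^sup>2 + (norm y)\<^sup>2"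
      using z(2) by (simp add: pq norm_Pair)
    with 1 show ?thesis by blast
  qed
  moreover have "\<forall>x. (x, 0) \<in> R\<inverse> \<longrightarrow> x = 0"
    using is_operatorD(1,2)[OF op] by blast
  ultimately show ?thesis using psd_inverse[OF R inj] unfolding kyp_root_def by blast
qed

definition kyp_solution ::
  "('x::chilbert_space \<Rightarrow> 'x) \<Rightarrow> ('u::chilbert_space \<Rightarrow> 'x) \<Rightarrow> ('x \<Rightarrow> 'y::chilbert_space) \<Rightarrow> ('u \<Rightarrow> 'y)
    \<Rightarrow> ('x \<times> 'x) set \<Rightarrow> bool" where
  "kyp_solution A B C D H \<longleftrightarrow> (\<exists>R. kyp_root A B C D R \<and> R O R = H)"

lemma kyp_solution_inverse:
  fixes A :: "'x::chilbert_space \<Rightarrow> 'x" and B :: "'u::chilbert_space \<Rightarrow> 'x"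
    and C :: "'x \<Rightarrow> 'y::chilbert_space" and D :: "'u \<Rightarrow> 'y"
  assumes "bounded_clinear A" "bounded_clinear B" "bounded_clinear C" "bounded_clinear D"
    and "kyp_solution A B C D H"
  shows "kyp_solution (cadjoint A) (cadjoint C) (cadjoint B) (cadjoint D) (H\<inverse>)"
  using assms(5) kyp_root_inverse[OF assms(1-4)] unfolding kyp_solution_def
  by (metis converse_relcomp)

lemma kyp_solution_root:
  assumes "kyp_solution A B C D H"
  obtains R where "kyp_root A B C D R" "op_sqrt H = R" "is_operator R" "R O R = H"
  using assms op_sqrt_eq psd_operator unfolding kyp_solution_def kyp_root_def by metis

lemma kyp_solution_positive_definite: "kyp_solution A B C D H \<Longrightarrow> positive_definite H"
  unfolding kyp_solution_def kyp_root_def using positive_definite_square by blast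

lemma kyp_solution_kyp_inequality:
  fixes A :: "'x::chilbert_space \<Rightarrow> 'x" and B :: "'u::chilbert_space \<Rightarrow> 'x"
  assumes "bounded_clinear A" "bounded_clinear B" and H: "kyp_solution A B C D H"
  shows "kyp_inequality A B C D H"
proof -
  obtain R where R: "kyp_root A B C D R" "op_sqrt H = R" "is_operator R"
    using kyp_solution_root[OF H] by metis
  have ineq: "\<exists>z. (A x + B u, z) \<in> R \<and>
        (norm z)\<^sup>2 + (norm (C x + D u))\<^sup>2 \<le> (norm y)\<^sup>2 + (norm u)\<^sup>2" if "(x, y) \<in> R" for x y u
    using R(1) that by (simp add: kyp_root_def)
  have A: "A x \<in> Domain R" if "x \<in> Domain R" for x
    using that ineq[of x _ 0] bounded_clinear_zero[OF assms(2)] by (auto simp: Domain_iff)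
  have B: "B u \<in> Domain R" for u
    using ineq[OF is_operator_zero[OF R(3)], of u] bounded_clinear_zero[OF assms(1)] by (auto simp: Domain_iff)
  have "(norm (op_apply R (A x + B u)))\<^sup>2 + (norm (C x + D u))\<^sup>2 \<le> (norm (op_apply R x))\<^sup>2 + (norm u)\<^sup>2"
    if "x \<in> Domain R" for x u
    using that ineq[of x _ u] op_apply_eq[OF R(3)] by (metis DomainE)
  with A B show ?thesis unfolding kyp_inequality_def R(2) by blast
qed

lemma kyp_solution_nondegenerate:
  assumes H: "kyp_solution A B C D H" shows "nondegenerate (quadratic_storage H)"
  unfolding nondegenerate_def
proof (intro allI impI)
  obtain R where R: "kyp_root A B C D R" "op_sqrt H = R" "is_operator R"
    using kyp_solution_root[OF H] by metis
  fix x :: 'a assume "x \<noteq> 0"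
  then have "(x, y) \<in> R \<Longrightarrow> y \<noteq> 0" for y using R(1) by (auto simp: kyp_root_def)
  then show "0 < quadratic_storage H x"
    by (auto simp: quadratic_storage_def R(2) op_apply_eq[OF R(3)])
qed

lemma quadratic_storage_zero:
  assumes H: "kyp_solution A B C D H" shows "quadratic_storage H 0 = 0"
proof -
  obtain R where R: "op_sqrt H = R" "is_operator R" using kyp_solution_root[OF H] by metis
  then show ?thesis
    using is_operator_zero[OF R(2)] op_apply_eq[OF R(2) is_operator_zero[OF R(2)]]
    by (auto simp: quadratic_storage_def)
qed

text \<open>
  Outside the domain of the square root the right-hand side is infinite.
\<close>

lemma quadratic_storage_step:
  assumes H: "kyp_solution A B C D H"
  shows "enn2ereal (quadratic_storage H (A x + B u))
    \<le> enn2ereal (quadratic_storage H x) + ereal ((norm u)\<^sup>2) - ereal ((norm (C x + D u))\<^sup>2)"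
proof -
  obtain R where R: "kyp_root A B C D R" "op_sqrt H = R" "is_operator R"
    using kyp_solution_root[OF H] by metis
  have storage: "enn2ereal (quadratic_storage H x) = ereal ((norm y)\<^sup>2)" if "(x, y) \<in> R" for x y
    using that by (auto simp: quadratic_storage_def R(2) op_apply_eq[OF R(3) that] Domain_iff)
  show ?thesis
  proof (cases "x \<in> Domain R")
    case True
    then obtain y where y: "(x, y) \<in> R" by blast
    then obtain z where z: "(A x + B u, z) \<in> R"
        "(norm z)\<^sup>2 + (norm (C x + D u))\<^sup>2 \<le> (norm y)\<^sup>2 + (norm u)\<^sup>2"
      using R(1) unfolding kyp_root_def by blast
    then show ?thesis unfolding storage[OF y] storage[OF z(1)] by simp
  next
    case False
    then show ?thesis by (simp add: quadratic_storage_def R(2))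
  qed
qed

lemma kyp_solution_storage_function:
  assumes "kyp_solution A B C D H" shows "storage_function A B C D (quadratic_storage H)"
  unfolding storage_function_def trajectory_def
  using quadratic_storage_zero[OF assms] quadratic_storage_step[OF assms] by simp

lemma kyp_solution_adjoint_storage_function:
  assumes "kyp_solution (cadjoint A) (cadjoint C) (cadjoint B) (cadjoint D) H"
  shows "adjoint_storage_function A B C D (quadratic_storage H)"
  unfolding adjoint_storage_function_def adjoint_trajectory_def
  using quadratic_storage_zero[OF assms] quadratic_storage_step[OF assms] by simp

section \<open>Defect operators of contractions\<close>

definition graph_of :: "('a \<Rightarrow> 'b) \<Rightarrow> ('a \<times> 'b) set" where
  "graph_of f = range (\<lambda>x. (x, f x))"

lemma graph_of_iff [simp]: "(x, y) \<in> graph_of f \<longleftrightarrow> y = f x"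
  by (auto simp: graph_of_def)

lemma op_adjoint_graph_of:
  fixes f :: "'a::chilbert_space \<Rightarrow> 'b::chilbert_space"
  assumes f: "bounded_clinear f"
  shows "op_adjoint (graph_of f) = graph_of (cadjoint f)"
proof -
  have "(y, z) \<in> op_adjoint (graph_of f) \<longleftrightarrow> (y, z) \<in> graph_of (cadjoint f)" for y z
    using cinner_left_ext[of "cadjoint f y" z]
    by (auto simp: op_adjoint_iff cadjoint_cinner[OF f])
  then show ?thesis by auto
qed

text \<open>
  Here the abstract square root is an everywhere defined bounded operator, so the defect can be
  handled through the equation \<open>P\<^sup>2 = I - t t\<^sup>*\<close>.
\<close>

lemma defect_of_adjoint:
  fixes t :: "'w::chilbert_space \<Rightarrow> 'k::chilbert_space"
  assumes t: "bounded_clinear t" and contr: "\<And>u. norm (t u) \<le> norm u"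
  obtains P where "defect (op_adjoint (graph_of t)) = graph_of P" "bounded_clinear P" "symmetric_map P"
    "\<And>y. P (P y) = y - t (cadjoint t y)"
proof -
  let ?M = "\<lambda>y. t (cadjoint t y)"
  note ts = bounded_clinear_cadjoint[OF t]
  have adj: "inner (t u) y = inner u (cadjoint t y)" for u y by (rule cadjoint_inner[OF t])
  have contr': "norm (cadjoint t y) \<le> norm y" for y
  proof -
    have "norm (cadjoint t y) * norm (cadjoint t y) = inner (t (cadjoint t y)) y"
      by (simp add: adj power2_norm_eq_inner flip: power2_eq_square)
    also have "\<dots> \<le> norm (t (cadjoint t y)) * norm y" by (rule norm_cauchy_schwarz)
    also have "\<dots> \<le> norm (cadjoint t y) * norm y" by (intro mult_right_mono contr) simp
    finally show ?thesis by (cases "cadjoint t y = 0") auto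
  qed
  have M: "symmetric_map ?M"
    unfolding symmetric_map_def
    by (auto intro!: linearI simp: bounded_clinear_add[OF t] bounded_clinear_add[OF ts]
        bounded_clinear_scaleR[OF t] bounded_clinear_scaleR[OF ts] adj)
      (metis adj inner_commute)
  obtain P where P: "symmetric_map P" "\<And>x. 0 \<le> inner (P x) x" "\<And>x. P (P x) = x - ?M x"
    and Pc: "\<And>L x. bounded_linear L \<Longrightarrow> (\<And>y. L (?M y) = ?M (L y)) \<Longrightarrow> L (P x) = P (L x)"
    by (rule bounded_sqrt_exists[OF M order_trans[OF contr contr']]) blast
  have linP: "linear P" and symP: "inner (P x) y = inner x (P y)" for x y
    using P(1) by (auto simp: symmetric_map_def)
  have PC: "P (c *\<^sub>C x) = c *\<^sub>C P x" for c x
    by (rule Pc[symmetric, OF bounded_linear_scaleC])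
      (simp add: bounded_clinear_scaleC[OF t] bounded_clinear_scaleC[OF ts])
  have nP: "norm (P x) \<le> norm x" for x
  proof -
    have "(norm (P x))\<^sup>2 = inner (x - ?M x) x"
      by (simp add: power2_norm_eq_inner P(3) symP inner_commute)
    also have "\<dots> = (norm x)\<^sup>2 - (norm (cadjoint t x))\<^sup>2"
      by (simp add: inner_diff_left adj power2_norm_eq_inner)
    also have "\<dots> \<le> (norm x)\<^sup>2" by simp
    finally show ?thesis by simp
  qed
  have bcP: "bounded_clinear P"
    unfolding bounded_clinear_def
    by (auto intro!: bounded_linear_intro[where K=1] simp: linear_add[OF linP] linear_cmul[OF linP] nP PC)
  have "cadjoint P = P"
    by (rule cadjoint_eqI) (simp add: cinner_eq_Complex symP flip: PC)
  then have adjP: "op_adjoint (graph_of P) = graph_of P" by (simp add: op_adjoint_graph_of[OF bcP])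
  have opP: "is_operator (graph_of P)"
    by (auto simp: is_operator_def single_valued_def linear_0[OF linP] linear_add[OF linP] PC)
  have "Domain (graph_of P) = UNIV" by (auto simp: graph_of_def)
  then have psd: "positive_semidefinite (graph_of P)"
    by (intro psdI opP adjP) (auto simp: P(2))
  have "{(x, x - z) | x z. (x, z) \<in> op_adjoint (graph_of t) O op_adjoint (op_adjoint (graph_of t))}
      = graph_of P O graph_of P"
    unfolding op_adjoint_graph_of[OF t] op_adjoint_graph_of[OF ts] cadjoint_cadjoint[OF t]
    by (auto simp: P(3) relcomp_unfold)
  then have "defect (op_adjoint (graph_of t)) = graph_of P"
    unfolding defect_def by (simp add: op_sqrt_eq[OF psd])
  then show thesis using that bcP P by blast
qed

text \<open>
  The adjoint \<open>y \<mapsto> (P y, t\<^sup>* y)\<close> of this map is isometric.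
\<close>

lemma defect_column_contraction:
  assumes P: "symmetric_map P" and sq: "\<And>y. P (P y) = y - t (ts y)"
    and adj: "\<And>u y. inner (t u) y = inner u (ts y)"
  shows "(norm (P z + t u))\<^sup>2 \<le> (norm z)\<^sup>2 + (norm u)\<^sup>2"
proof -
  define y where "y = P z + t u"
  have symP: "inner (P a) b = inner a (P b)" for a b using P by (simp add: symmetric_map_def)
  have "inner (P y) (P y) + inner (ts y) (ts y) = inner y y"
    by (simp add: symP sq inner_diff_right flip: adj) (simp add: inner_commute)
  then have n: "norm (P y, ts y) = norm y" by (simp add: norm_Pair power2_norm_eq_inner norm_eq_sqrt_inner[of y])
  have "norm y * norm y = inner y (P z + t u)"
    by (metis y_def power2_norm_eq_inner power2_eq_square)
  also have "\<dots> = inner (z, u) (P y, ts y)"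
    using symP[of z y] adj[of u y] by (simp add: inner_add_right inner_commute[of y])
  also have "\<dots> \<le> norm (z, u) * norm y" unfolding n[symmetric] by (rule norm_cauchy_schwarz)
  finally have "norm y \<le> norm (z, u)" by (cases "y = 0") auto
  then have "(norm y)\<^sup>2 \<le> (norm (z, u))\<^sup>2" by simp
  then show ?thesis by (simp add: y_def norm_Pair)
qed

text \<open>
  Inserting \<open>u = t\<^sup>* v\<close> into the bound leaves \<open>2 \<langle>v, w\<rangle> \<le> c + \<parallel>P v\<parallel>\<^sup>2\<close>, and scaling \<open>v\<close> turns this
  into \<open>\<langle>v, w\<rangle> \<le> \<surd>c \<parallel>P v\<parallel>\<close>. So \<open>P v \<mapsto> \<langle>v, w\<rangle>\<close> is a bounded functional on the range of \<open>P\<close>, and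
  the vector representing it solves \<open>P z = w\<close>.
\<close>

lemma defect_range_criterion:
  fixes P :: "'k::{real_inner,complete_space} \<Rightarrow> 'k"
  assumes P: "symmetric_map P" and sq: "\<And>y. P (P y) = y - t (ts y)"
    and adj: "\<And>u y. inner (t u) y = inner u (ts y)"
    and bound: "\<And>u. (norm (w + t u))\<^sup>2 \<le> c + (norm u)\<^sup>2"
  obtains z where "z \<in> closure (range P)" "P z = w" "(norm z)\<^sup>2 \<le> c"
proof -
  have symP: "inner (P a) b = inner a (P b)" for a b using P by (simp add: symmetric_map_def)
  interpret P: linear P using P by (simp add: symmetric_map_def)
  have "t 0 = 0" using adj[of 0 "t 0"] by simp
  then have c0: "0 \<le> c" using bound[of 0] by (simp add: order_trans[OF zero_le_power2])
  have 1: "2 * inner v w \<le> c + (norm (P v))\<^sup>2" for v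
  proof -
    have n: "(norm (P v))\<^sup>2 = (norm v)\<^sup>2 - (norm (ts v))\<^sup>2"
      by (simp add: power2_norm_eq_inner symP sq inner_diff_right flip: adj) (simp add: inner_commute)
    have "(norm ((w - P (P v)) + v))\<^sup>2 \<le> c + (norm (ts v))\<^sup>2"
      using bound[of "ts v"] by (simp add: sq)
    moreover have "(norm ((w - P (P v)) + v))\<^sup>2
        = (norm (w - P (P v)))\<^sup>2 + 2 * inner v w - 2 * (norm (P v))\<^sup>2 + (norm v)\<^sup>2"
    proof -
      have "inner (P (P v)) v = (norm (P v))\<^sup>2" by (simp add: symP power2_norm_eq_inner)
      moreover have "(norm ((w - P (P v)) + v))\<^sup>2
          = (norm (w - P (P v)))\<^sup>2 + 2 * inner (w - P (P v)) v + (norm v)\<^sup>2"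
        by (simp only: power2_norm_eq_inner inner_add_left inner_add_right)
          (simp add: inner_commute[of v "w - P (P v)"])
      ultimately show ?thesis by (simp add: inner_diff_left inner_commute[of v])
    qed
    ultimately show ?thesis using n zero_le_power2[of "norm (w - P (P v))"] by linarith
  qed
  have 2: "inner v w \<le> sqrt c * norm (P v)" for v
  proof (rule ccontr)
    assume "\<not> inner v w \<le> sqrt c * norm (P v)"
    then have less: "sqrt c * norm (P v) < inner v w" by simp
    have "0 \<le> sqrt c * norm (P v)" using c0 by simp
    then have pos: "0 < inner v w" using less by linarith
    have quad: "2 * s * inner v w \<le> c + s\<^sup>2 * (norm (P v))\<^sup>2" for s
      using 1[of "s *\<^sub>R v"] by (simp add: P.scaleR power_mult_distrib mult.assoc)
    show False
    proof (cases "P v = 0")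
      case True
      then show False using quad[of "(c + 1) / (2 * inner v w)"] pos by (simp add: field_simps)
    next
      case False
      define s where "s = inner v w / (norm (P v))\<^sup>2"
      have s: "s * (norm (P v))\<^sup>2 = inner v w" using False by (simp add: s_def)
      have "2 * s * inner v w \<le> c + s * inner v w"
        using quad[of s] s by (simp add: power2_eq_square[of s] mult.assoc)
      then have "(s * inner v w) * (norm (P v))\<^sup>2 \<le> c * (norm (P v))\<^sup>2"
        by (intro mult_right_mono) auto
      moreover have "(s * inner v w) * (norm (P v))\<^sup>2 = (inner v w)\<^sup>2"
        using s by (simp add: power2_eq_square[of "inner v w"] mult_ac)
      moreover have "(sqrt c * norm (P v))\<^sup>2 < (inner v w)\<^sup>2"
        using less \<open>0 \<le> sqrt c * norm (P v)\<close> by (intro power_strict_mono) auto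
      ultimately show False using c0 by (simp add: power_mult_distrib)
    qed
  qed
  \<comment> \<open>the estimate just proved makes this independent of the chosen preimage\<close>
  define l where "l = (\<lambda>r. inner (SOME v. P v = r) w)"
  have l: "l (P v) = inner v w" for v
  proof -
    define v' where "v' = (SOME v'. P v' = P v)"
    have "P v' = P v" unfolding v'_def by (rule someI_ex) blast
    then have "P (v - v') = 0" "P (v' - v) = 0" by (simp_all add: P.diff)
    then have "inner (v - v') w \<le> 0" "inner (v' - v) w \<le> 0" using 2[of "v - v'"] 2[of "v' - v"] by simp_all
    then show ?thesis by (simp add: l_def v'_def[symmetric] inner_diff_left)
  qed
  obtain z where z: "z \<in> closure (range P)" "\<And>r. r \<in> range P \<Longrightarrow> l r = inner r z" "norm z \<le> sqrt c"
  proof (rule riesz_subspace[of "range P" "sqrt c" l])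
    show "subspace (range P)" by (rule linear_subspace_image[OF P.linear_axioms subspace_UNIV])
    show "l (x + y) = l x + l y" if "x \<in> range P" "y \<in> range P" for x y
      using that by (auto simp: l inner_add_left simp flip: P.add)
    show "l (r *\<^sub>R x) = r * l x" if "x \<in> range P" for r x
      using that by (auto simp: l simp flip: P.scaleR)
    show "l x \<le> sqrt c * norm x" if "x \<in> range P" for x
      using that 2 by (auto simp: l)
  qed (use c0 in auto)
  have "inner v (P z - w) = 0" for v
    using z(2)[of "P v"] by (simp add: l symP inner_diff_right)
  then have "P z = w" by (metis inner_eq_zero_iff right_minus_eq)
  moreover have "(norm z)\<^sup>2 \<le> c" using z(3) c0 by (simp add: real_le_rsqrt sqrt_ge_absD)
  ultimately show thesis using that z(1) by blast
qed

section \<open>The available storage as a solution of the KYP inequality\<close>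

text \<open>
  The operator \<open>X\<close> is \<open>P\<^sup>-\<^sup>1 W\<close> on \<open>M\<close>, with \<open>P\<close> inverted on the orthogonal complement \<open>N\<close> of its
  kernel. It is contained in the closed graph \<open>Z = {(x, y). y \<in> N, P y = W x}\<close>, which is
  single-valued because \<open>P\<close> is injective on \<open>N\<close>; hence \<open>X\<close> is closable, and its closure is
  injective since \<open>W\<close> is. In the assumptions, \<open>bound\<close> makes \<open>W x\<close> a value of \<open>P\<close>, and \<open>step\<close>
  expresses that a future input \<open>v\<close> preceded by \<open>u\<close> is again an input, of energy
  \<open>\<parallel>u\<parallel>\<^sup>2 + \<parallel>v\<parallel>\<^sup>2\<close>, whose first output is \<open>C x + D u\<close>.
\<close>

lemma available_storage_solution:
  fixes A :: "'x::chilbert_space \<Rightarrow> 'x" and B :: "'u::chilbert_space \<Rightarrow> 'x"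
    and C :: "'x \<Rightarrow> 'y::chilbert_space" and D :: "'u \<Rightarrow> 'y"
    and t :: "'w::chilbert_space \<Rightarrow> 'k::chilbert_space" and W :: "('x \<times> 'k) set"
  assumes bd: "bounded_clinear A" "bounded_clinear B" "bounded_clinear C" "bounded_clinear D"
    and t: "bounded_clinear t" "\<And>u. norm (t u) \<le> norm u"
    and W: "is_operator W" "closed W" "\<And>x. (x, 0) \<in> W \<Longrightarrow> x = 0"
    and M: "csubspace M" "closure M = UNIV" "\<And>x u. x \<in> M \<Longrightarrow> A x + B u \<in> M"
    and bound: "\<And>x. x \<in> M \<Longrightarrow> \<exists>w c. (x, w) \<in> W \<and> (\<forall>u. (norm (w + t u))\<^sup>2 \<le> c + (norm u)\<^sup>2)"
    and step: "\<And>x w u w' v. (x, w) \<in> W \<Longrightarrow> (A x + B u, w') \<in> W \<Longrightarrow>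
      \<exists>u'. (norm (w' + t v))\<^sup>2 + (norm (C x + D u))\<^sup>2 = (norm (w + t u'))\<^sup>2 \<and>
        (norm u')\<^sup>2 = (norm u)\<^sup>2 + (norm v)\<^sup>2"
    and Def: "Def = defect (op_adjoint (graph_of t))"
    and X: "X = (THE X. closable X \<and> Domain X = M \<and> Range X \<subseteq> orth_compl (op_kernel Def) \<and>
      op_restrict W M = X O Def)"
  shows "kyp_solution A B C D (closure X O op_adjoint (closure X))"
proof -
  obtain P where DefP: "Def = graph_of P" and P: "bounded_clinear P" "symmetric_map P"
    and sq: "\<And>y. P (P y) = y - t (cadjoint t y)"
    unfolding Def by (rule defect_of_adjoint[OF t]) blast
  note adj = cadjoint_inner[OF t(1)]
  have symP: "inner (P a) b = inner a (P b)" for a b using P(2) by (simp add: symmetric_map_def)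
  define N where "N = orth_compl (op_kernel Def)"
  have N: "y \<in> N \<longleftrightarrow> (\<forall>k. P k = 0 \<longrightarrow> cinner k y = 0)" for y
    by (auto simp: N_def orth_compl_def op_kernel_def DefP)
  have N_inner: "y \<in> N \<longleftrightarrow> (\<forall>k. P k = 0 \<longrightarrow> inner k y = 0)" for y
  proof
    assume *: "\<forall>k. P k = 0 \<longrightarrow> inner k y = 0"
    have "inner ((- \<i>) *\<^sub>C k) y = 0" if "P k = 0" for k
      using * that by (simp add: bounded_clinear_scaleC[OF P(1)])
    then show "y \<in> N" using * by (simp add: N cinner_eq_Complex complex_eq_iff)
  qed (auto simp: N inner_eq_Re_cinner)
  have Nadd: "y \<in> N \<Longrightarrow> y' \<in> N \<Longrightarrow> y + y' \<in> N" and NsC: "y \<in> N \<Longrightarrow> c *\<^sub>C y \<in> N" and N0: "0 \<in> N"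
    and Ndiff: "y \<in> N \<Longrightarrow> y' \<in> N \<Longrightarrow> y - y' \<in> N" for y y' c
    by (auto simp: N cinner_add_right cinner_diff_right cinner_scaleC_right)
  have Ninj: "y = y'" if "y \<in> N" "y' \<in> N" "P y = P y'" for y y'
  proof -
    have "P (y - y') = 0" using that(3) by (simp add: bounded_clinear_diff[OF P(1)])
    then have "inner (y - y') (y - y') = 0" using Ndiff[OF that(1,2)] N_inner by blast
    then show ?thesis by simp
  qed
  have Nclosed: "closed N"
  proof -
    have "N = (\<Inter>k\<in>{k. P k = 0}. {y. inner k y = 0})" using N_inner by auto
    then show ?thesis by (auto intro!: closed_INT closed_Collect_eq continuous_intros)
  qed
  have ranN: "closure (range P) \<subseteq> N"
    by (rule closure_minimal[OF _ Nclosed]) (auto simp: N_inner simp flip: symP)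
  have solve: "\<exists>y\<in>N. (x, P y) \<in> W \<and> (norm y)\<^sup>2 \<le> c"
    if "(x, w) \<in> W" "\<And>u. (norm (w + t u))\<^sup>2 \<le> c + (norm u)\<^sup>2" for x w c
    by (rule defect_range_criterion[OF P(2) sq adj that(2)]) (use ranN that(1) in auto)
  define Z where "Z = {(x, y). y \<in> N \<and> (x, P y) \<in> W}"
  define Y where "Y = {(x, y). x \<in> M \<and> y \<in> N \<and> (x, P y) \<in> W}"
  have Zclosed: "closed Z"
  proof -
    have "Z = (UNIV \<times> N) \<inter> (\<lambda>p. (fst p, P (snd p))) -` W" by (auto simp: Z_def)
    moreover have "continuous_on UNIV (\<lambda>p. (fst p, P (snd p)))"
      by (intro continuous_intros bounded_linear.continuous_on[OF bounded_clinear_bl[OF P(1)]])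
    ultimately show ?thesis
      by (auto intro!: closed_Int closed_Times Nclosed closed_vimage[OF W(2)])
  qed
  have Zsv: "single_valued Z"
    by (rule single_valuedI) (auto simp: Z_def intro: Ninj is_operator_single[OF W(1)])
  have YZ: "closure Y \<subseteq> Z" by (rule closure_minimal[OF _ Zclosed]) (auto simp: Y_def Z_def)
  have svY: "single_valued (closure Y)" using Zsv YZ single_valued_subset by blast
  have opY: "is_operator Y"
    unfolding is_operator_def
  proof (intro conjI allI impI)
    show "single_valued Y" using svY closure_subset single_valued_subset by blast
    show "(0, 0) \<in> Y"
      using M(1) N0 is_operator_zero[OF W(1)] by (simp add: Y_def csubspace_def bounded_clinear_zero[OF P(1)])
  next
    fix x y x' y' assume "(x, y) \<in> Y" "(x', y') \<in> Y"
    then show "(x + x', y + y') \<in> Y"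
      using M(1) Nadd is_operator_add[OF W(1)] by (simp add: Y_def csubspace_def bounded_clinear_add[OF P(1)])
  next
    fix c x y assume "(x, y) \<in> Y"
    then show "(c *\<^sub>C x, c *\<^sub>C y) \<in> Y"
      using M(1) NsC is_operator_scaleC[OF W(1)] by (simp add: Y_def csubspace_def bounded_clinear_scaleC[OF P(1)])
  qed
  have domY: "Domain Y = M"
  proof (intro subset_antisym subsetI)
    fix x assume "x \<in> M"
    then obtain w c where "(x, w) \<in> W" "\<And>u. (norm (w + t u))\<^sup>2 \<le> c + (norm u)\<^sup>2" using bound by blast
    then obtain y where "y \<in> N" "(x, P y) \<in> W" using solve by blast
    then show "x \<in> Domain Y" using \<open>x \<in> M\<close> by (auto simp: Y_def)
  qed (auto simp: Y_def)
  have facY: "op_restrict W M = Y O Def"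
  proof (intro set_eqI iffI)
    fix p assume "p \<in> op_restrict W M"
    then obtain x w where p: "p = (x, w)" "(x, w) \<in> W" "x \<in> M" by (auto simp: op_restrict_def)
    then obtain y where y: "(x, y) \<in> Y" using domY by blast
    then have "P y = w" using p(2) is_operator_single[OF W(1)] by (auto simp: Y_def)
    then show "p \<in> Y O Def" using y by (auto simp: p(1) DefP)
  next
    fix p assume "p \<in> Y O Def"
    then show "p \<in> op_restrict W M" by (auto simp: Y_def op_restrict_def DefP)
  qed
  \<comment> \<open>the stated properties leave no choice for \<open>X\<close>, as \<open>P\<close> is injective on \<open>N\<close>\<close>
  have "X = Y"
    unfolding X N_def[symmetric]
  proof (rule the_equality)
    show "closable Y \<and> Domain Y = M \<and> Range Y \<subseteq> N \<and> op_restrict W M = Y O Def"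
      using opY svY domY facY by (auto simp: closable_def Y_def)
    fix X' assume X': "closable X' \<and> Domain X' = M \<and> Range X' \<subseteq> N \<and> op_restrict W M = X' O Def"
    have sub: "X' \<subseteq> Y"
    proof (rule subrelI)
      fix x y assume xy: "(x, y) \<in> X'"
      have "(x, P y) \<in> X' O Def" using xy by (auto simp: DefP)
      then have "(x, P y) \<in> W" using X' by (auto simp: op_restrict_def)
      then show "(x, y) \<in> Y" using xy X' by (auto simp: Y_def)
    qed
    have "Y \<subseteq> X'"
    proof (rule subrelI)
      fix x y assume xy: "(x, y) \<in> Y"
      then have "x \<in> Domain X'" using X' domY by blast
      then obtain y' where y': "(x, y') \<in> X'" by blast
      then have "y' = y" using sub xy is_operator_single[OF opY] by blast
      then show "(x, y) \<in> X'" using y' by simp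
    qed
    with sub show "X' = Y" by blast
  qed
  define T where "T = closure Y"
  have T: "is_operator T" "closed T" using closure_is_operator[OF opY svY] by (auto simp: T_def)
  have "M \<subseteq> Domain T" using domY closure_subset[of Y] unfolding T_def by blast
  then have Tdense: "closure (Domain T) = UNIV" using M(2) closure_mono by blast
  \<comment> \<open>the first output \<open>C x + D u\<close> is split off from the output energy, so the bound for \<open>A x + B u\<close> is smaller by \<open>\<parallel>C x + D u\<parallel>\<^sup>2 - \<parallel>u\<parallel>\<^sup>2\<close>\<close>
  have kypY: "\<exists>z. (A x + B u, z) \<in> Y \<and> (norm z)\<^sup>2 + (norm (C x + D u))\<^sup>2 \<le> (norm y)\<^sup>2 + (norm u)\<^sup>2"
    if xy: "(x, y) \<in> Y" for x y u
  proof -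
    have x: "x \<in> M" "y \<in> N" "(x, P y) \<in> W" using xy by (auto simp: Y_def)
    have x': "A x + B u \<in> M" by (rule M(3)[OF x(1)])
    obtain w' where w': "(A x + B u, w') \<in> W" using bound[OF x'] by blast
    have "(norm (w' + t v))\<^sup>2 \<le> ((norm y)\<^sup>2 + (norm u)\<^sup>2 - (norm (C x + D u))\<^sup>2) + (norm v)\<^sup>2" for v
    proof -
      obtain u' where "(norm (w' + t v))\<^sup>2 + (norm (C x + D u))\<^sup>2 = (norm (P y + t u'))\<^sup>2"
        "(norm u')\<^sup>2 = (norm u)\<^sup>2 + (norm v)\<^sup>2"
        using step[OF x(3) w'] by blast
      then show ?thesis using defect_column_contraction[OF P(2) sq adj, of y u'] by linarith
    qed
    from solve[OF w' this] obtain z where "z \<in> N" "(A x + B u, P z) \<in> W"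
      "(norm z)\<^sup>2 \<le> (norm y)\<^sup>2 + (norm u)\<^sup>2 - (norm (C x + D u))\<^sup>2" by blast
    then show ?thesis using x' by (intro exI[of _ z]) (auto simp: Y_def)
  qed
  have kypT: "\<exists>z. (A x + B u, z) \<in> T \<and> (norm z)\<^sup>2 + (norm (C x + D u))\<^sup>2 \<le> (norm y)\<^sup>2 + (norm u)\<^sup>2"
    if xy: "(x, y) \<in> T" for x y u
  proof -
    obtain p where p: "\<And>n. p n \<in> Y" "p \<longlonglongrightarrow> (x, y)" using xy closure_sequential unfolding T_def by blast
    define a where "a = (\<lambda>n. fst (p n))"
    define b where "b = (\<lambda>n. snd (p n))"
    have ab: "(a n, b n) \<in> Y" for n using p(1) by (simp add: a_def b_def)
    have a: "a \<longlonglongrightarrow> x" and b: "b \<longlonglongrightarrow> y"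
      using tendsto_fst[OF p(2)] tendsto_snd[OF p(2)] by (simp_all add: a_def b_def)
    obtain z where z: "\<And>n. (A (a n) + B u, z n) \<in> Y"
      and zn: "\<And>n. (norm (z n))\<^sup>2 + (norm (C (a n) + D u))\<^sup>2 \<le> (norm (b n))\<^sup>2 + (norm u)\<^sup>2"
      using kypY[OF ab, of _ u] by metis
    \<comment> \<open>the inequality with \<open>u = 0\<close>, applied to differences\<close>
    have "dist (z m) (z n) \<le> dist (b m) (b n)" for m n
    proof -
      have "(a m - a n, b m - b n) \<in> Y" by (rule is_operator_diff[OF opY ab ab])
      from kypY[OF this, of 0] obtain d where d: "(A (a m - a n), d) \<in> Y"
        "(norm d)\<^sup>2 + (norm (C (a m - a n)))\<^sup>2 \<le> (norm (b m - b n))\<^sup>2"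
        by (auto simp: bounded_clinear_zero[OF bd(2)] bounded_clinear_zero[OF bd(4)])
      have "((A (a m) + B u) - (A (a n) + B u), z m - z n) \<in> Y" by (rule is_operator_diff[OF opY z z])
      then have "(A (a m - a n), z m - z n) \<in> Y" by (simp add: bounded_clinear_diff[OF bd(1)])
      then have "d = z m - z n" using d(1) is_operator_single[OF opY] by blast
      moreover have "(norm d)\<^sup>2 \<le> (norm (b m - b n))\<^sup>2"
        using d(2) zero_le_power2[of "norm (C (a m - a n))"] by linarith
      ultimately show ?thesis by (simp add: dist_norm)
    qed
    then have "Cauchy z"
      using LIMSEQ_imp_Cauchy[OF b] unfolding Cauchy_def by (meson le_less_trans)
    then obtain l where l: "z \<longlonglongrightarrow> l" using Cauchy_convergent convergent_def by blast
    note cont = bounded_linear.tendsto[OF bounded_clinear_bl[OF bd(1)]]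
      bounded_linear.tendsto[OF bounded_clinear_bl[OF bd(3)]]
    have "(\<lambda>n. (A (a n) + B u, z n)) \<longlonglongrightarrow> (A x + B u, l)"
      by (intro tendsto_Pair tendsto_add tendsto_const cont a l)
    then have 1: "(A x + B u, l) \<in> T"
      by (rule closed_sequentially[OF T(2), rotated]) (use z closure_subset in \<open>auto simp: T_def\<close>)
    have "(norm l)\<^sup>2 + (norm (C x + D u))\<^sup>2 \<le> (norm y)\<^sup>2 + (norm u)\<^sup>2"
    proof (rule LIMSEQ_le)
      show "(\<lambda>n. (norm (z n))\<^sup>2 + (norm (C (a n) + D u))\<^sup>2) \<longlonglongrightarrow> (norm l)\<^sup>2 + (norm (C x + D u))\<^sup>2"
        by (intro tendsto_intros cont a l)
      show "(\<lambda>n. (norm (b n))\<^sup>2 + (norm u)\<^sup>2) \<longlonglongrightarrow> (norm y)\<^sup>2 + (norm u)\<^sup>2"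
        by (intro tendsto_intros b)
    qed (use zn in blast)
    with 1 show ?thesis by blast
  qed
  obtain R where R: "positive_semidefinite R" "R O R = T O op_adjoint T"
    and TR: "\<And>x y. (x, y) \<in> T \<Longrightarrow> \<exists>y'. (x, y') \<in> R \<and> norm y' = norm y"
    and RT: "\<And>x y. (x, y) \<in> R \<Longrightarrow> \<exists>y'. (x, y') \<in> T \<and> norm y' = norm y"
    by (rule TstarT_sqrt[OF T Tdense]) blast
  have "x = 0" if x0: "(x, 0) \<in> R" for x
  proof -
    have "(x, 0) \<in> T" using RT[OF x0] by auto
    then have "(x, P 0) \<in> W" using YZ by (auto simp: T_def Z_def)
    then show ?thesis using W(3) by (simp add: bounded_clinear_zero[OF P(1)])
  qed
  moreover have "\<exists>z. (A x + B u, z) \<in> R \<and> (norm z)\<^sup>2 + (norm (C x + D u))\<^sup>2 \<le> (norm y)\<^sup>2 + (norm u)\<^sup>2"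
    if xy: "(x, y) \<in> R" for x y u
  proof -
    obtain y' where y': "(x, y') \<in> T" "norm y' = norm y" using RT[OF xy] by blast
    obtain z' where z': "(A x + B u, z') \<in> T"
      "(norm z')\<^sup>2 + (norm (C x + D u))\<^sup>2 \<le> (norm y')\<^sup>2 + (norm u)\<^sup>2" using kypT[OF y'(1)] by blast
    obtain z where "(A x + B u, z) \<in> R" "norm z = norm z'" using TR[OF z'(1)] by blast
    then show ?thesis using z'(2) y'(2) by auto
  qed
  ultimately have "kyp_root A B C D R" using R(1) by (simp add: kyp_root_def)
  then show ?thesis unfolding kyp_solution_def \<open>X = Y\<close> T_def[symmetric] using R(2) by blast
qed

section \<open>Dissipative systems and their adjoints\<close>

primrec state :: "('x::complex_inner \<Rightarrow> 'x) \<Rightarrow> ('u \<Rightarrow> 'x) \<Rightarrow> 'x \<Rightarrow> (nat \<Rightarrow> 'u) \<Rightarrow> nat \<Rightarrow> 'x" where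
  "state A B x u 0 = x"
| "state A B x u (Suc n) = A (state A B x u n) + B (u n)"

text \<open>
  Finite-time contractivity of the input-output map started at rest, that is, of all finite
  sections of the block Toeplitz matrix of the system.
\<close>

definition dissipative ::
  "('x::chilbert_space \<Rightarrow> 'x) \<Rightarrow> ('u::chilbert_space \<Rightarrow> 'x) \<Rightarrow> ('x \<Rightarrow> 'y::chilbert_space) \<Rightarrow> ('u \<Rightarrow> 'y) \<Rightarrow> bool" where
  "dissipative A B C D \<longleftrightarrow>
     (\<forall>u N. (\<Sum>i<N. (norm (C (state A B 0 u i) + D (u i)))\<^sup>2) \<le> (\<Sum>i<N. (norm (u i))\<^sup>2))"

lemma funpow_add:
  fixes A :: "'x::complex_inner \<Rightarrow> 'x"
  assumes "bounded_clinear A"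
  shows "(A ^^ n) (x + y) = (A ^^ n) x + (A ^^ n) y"
  by (induction n) (simp_all add: bounded_clinear_add[OF assms])

lemma state_output:
  assumes A: "bounded_clinear A" and C: "bounded_clinear C"
  shows "C (state A B x u n) + D (u n) = C ((A ^^ n) x) + (\<Sum>j\<le>n. taylor_coeff A B C D (n - j) (u j))"
proof -
  have st: "C ((A ^^ m) (state A B x u n)) = C ((A ^^ (n + m)) x) + (\<Sum>j<n. C ((A ^^ (n - Suc j + m)) (B (u j))))" for m n
  proof (induction n arbitrary: m)
    case (Suc n)
    have "C ((A ^^ m) (state A B x u (Suc n))) = C ((A ^^ Suc m) (state A B x u n)) + C ((A ^^ m) (B (u n)))"
      by (simp add: funpow_add[OF A] bounded_clinear_add[OF C] funpow_swap1)
    also have "\<dots> = C ((A ^^ (Suc n + m)) x) + ((\<Sum>j<n. C ((A ^^ (n - Suc j + Suc m)) (B (u j)))) + C ((A ^^ m) (B (u n))))"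
      unfolding Suc by simp
    also have "(\<Sum>j<n. C ((A ^^ (n - Suc j + Suc m)) (B (u j)))) = (\<Sum>j<n. C ((A ^^ (Suc n - Suc j + m)) (B (u j))))"
      by (intro sum.cong refl arg_cong[where f="\<lambda>k. C ((A ^^ k) _)"]) auto
    finally show ?case by simp
  qed simp
  have "(\<Sum>j<n. C ((A ^^ (n - Suc j)) (B (u j)))) = (\<Sum>j<n. taylor_coeff A B C D (n - j) (u j))"
  proof (intro sum.cong refl)
    fix j assume "j \<in> {..<n}"
    then have "n - j = Suc (n - Suc j)" by auto
    then show "C ((A ^^ (n - Suc j)) (B (u j))) = taylor_coeff A B C D (n - j) (u j)"
      by (simp add: taylor_coeff_def)
  qed
  then show ?thesis
    using st[of 0 n] by (simp add: lessThan_Suc_atMost[symmetric] taylor_coeff_def)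
qed

lemma state_cong: "(\<And>k. k < n \<Longrightarrow> u k = v k) \<Longrightarrow> state A B x u n = state A B x v n"
  by (induction n) auto

lemma state_free:
  assumes "\<And>k. n \<le> k \<Longrightarrow> B (u k) = 0"
  shows "state A B x u (n + k) = (A ^^ k) (state A B x u n)"
  by (induction k) (auto simp: assms)

text \<open>
  A trajectory \<open>x\<close> of the system and a trajectory \<open>\<xi>\<close> of the adjoint system running backwards from
  \<open>\<xi> = 0\<close> at time \<open>n\<close> satisfy \<open>\<langle>output, y\<rangle> + \<langle>x', \<xi>'\<rangle> = \<langle>x, \<xi>\<rangle> + \<langle>u, adjoint output\<rangle>\<close> in each
  step, with primes denoting the next time. The sum telescopes. The adjoint trajectory is written
  as a forward trajectory driven by the reversed sequence \<open>y\<close>.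
\<close>

lemma energy_pairing:
  fixes A :: "'x::chilbert_space \<Rightarrow> 'x" and B :: "'u::chilbert_space \<Rightarrow> 'x"
    and C :: "'x \<Rightarrow> 'y::chilbert_space" and D :: "'u \<Rightarrow> 'y"
  assumes bd: "bounded_clinear A" "bounded_clinear B" "bounded_clinear C" "bounded_clinear D"
  defines "\<xi> \<equiv> state (cadjoint A) (cadjoint C) 0"
  shows "(\<Sum>i<n. inner (C (state A B x u i) + D (u i)) (y i))
    = inner x (\<xi> (\<lambda>k. y (n - Suc k)) n)
      + (\<Sum>i<n. inner (u i) (cadjoint B (\<xi> (\<lambda>k. y (n - Suc k)) (n - Suc i)) + cadjoint D (y i)))"
proof -
  let ?v = "\<lambda>k. y (n - Suc k)"
  have "(\<Sum>i<m. inner (C (state A B x u i) + D (u i)) (y i)) + inner (state A B x u m) (\<xi> ?v (n - m))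
    = inner x (\<xi> ?v n) + (\<Sum>i<m. inner (u i) (cadjoint B (\<xi> ?v (n - Suc i)) + cadjoint D (y i)))"
    if "m \<le> n" for m
    using that
  proof (induction m)
    case (Suc m)
    have rec: "\<xi> ?v (n - m) = cadjoint A (\<xi> ?v (n - Suc m)) + cadjoint C (y m)"
    proof -
      have "n - m = Suc (n - Suc m)" "n - Suc (n - Suc m) = m" using Suc.prems by auto
      then show ?thesis unfolding \<xi>_def by simp
    qed
    have "inner (C (state A B x u m) + D (u m)) (y m) + inner (state A B x u (Suc m)) (\<xi> ?v (n - Suc m))
      = inner (state A B x u m) (\<xi> ?v (n - m))
        + inner (u m) (cadjoint B (\<xi> ?v (n - Suc m)) + cadjoint D (y m))"
      unfolding rec by (simp add: inner_add_left inner_add_right bd[THEN cadjoint_inner])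
    then show ?case using Suc by simp
  qed simp
  from this[of n] show ?thesis by (simp add: \<xi>_def)
qed

lemma two_inner_le: "2 * inner a b \<le> (norm a)\<^sup>2 + (norm (b :: 'a::real_inner))\<^sup>2"
  using inner_ge_zero[of "a - b"] by (simp add: inner_diff_left inner_diff_right inner_commute power2_norm_eq_inner)

text \<open>
  Feed the output \<open>w\<close> of the adjoint system back into the system itself: the pairing gives
  \<open>\<parallel>w\<parallel>\<^sup>2 = \<langle>z, y\<rangle>\<close> where \<open>z\<close> is the response to \<open>w\<close>, and \<open>\<parallel>z\<parallel> \<le> \<parallel>w\<parallel>\<close>.
\<close>

lemma dissipative_adjoint:
  fixes A :: "'x::chilbert_space \<Rightarrow> 'x" and B :: "'u::chilbert_space \<Rightarrow> 'x"
    and C :: "'x \<Rightarrow> 'y::chilbert_space" and D :: "'u \<Rightarrow> 'y"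
  assumes bd: "bounded_clinear A" "bounded_clinear B" "bounded_clinear C" "bounded_clinear D"
    and "dissipative A B C D"
  shows "dissipative (cadjoint A) (cadjoint C) (cadjoint B) (cadjoint D)"
  unfolding dissipative_def
proof (intro allI)
  fix v :: "nat \<Rightarrow> 'y" and n
  let ?\<xi> = "state (cadjoint A) (cadjoint C) 0"
  define y where "y = (\<lambda>i. v (n - Suc i))"
  have \<xi>: "?\<xi> (\<lambda>k. y (n - Suc k)) m = ?\<xi> v m" if "m \<le> n" for m
    by (rule state_cong) (use that in \<open>auto simp: y_def intro!: arg_cong[where f=v]\<close>)
  define w where "w = (\<lambda>i. cadjoint B (?\<xi> v (n - Suc i)) + cadjoint D (y i))"
  define z where "z = (\<lambda>i. C (state A B 0 w i) + D (w i))"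
  have "2 * (\<Sum>i<n. (norm (w i))\<^sup>2) = (\<Sum>i<n. 2 * inner (z i) (y i))"
    using energy_pairing[OF bd, where x=0 and u=w and y=y and n=n]
    by (simp add: \<xi> w_def z_def power2_norm_eq_inner sum_distrib_left flip: sum_distrib_left)
  also have "\<dots> \<le> (\<Sum>i<n. (norm (z i))\<^sup>2 + (norm (y i))\<^sup>2)" by (intro sum_mono two_inner_le)
  also have "\<dots> \<le> (\<Sum>i<n. (norm (w i))\<^sup>2) + (\<Sum>i<n. (norm (y i))\<^sup>2)"
    using \<open>dissipative A B C D\<close> by (simp add: sum.distrib dissipative_def z_def)
  finally have "(\<Sum>i<n. (norm (w i))\<^sup>2) \<le> (\<Sum>i<n. (norm (y i))\<^sup>2)" by simp
  also have "(\<Sum>i<n. (norm (y i))\<^sup>2) = (\<Sum>i<n. (norm (v i))\<^sup>2)"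
    unfolding y_def by (rule sum.nat_diff_reindex)
  also have "(\<Sum>i<n. (norm (w i))\<^sup>2) = (\<Sum>i<n. (norm (cadjoint B (?\<xi> v i) + cadjoint D (v i)))\<^sup>2)"
    unfolding w_def y_def by (rule sum.nat_diff_reindex[where g="\<lambda>i. (norm (cadjoint B (?\<xi> v i) + cadjoint D (v i)))\<^sup>2"])
  finally show "(\<Sum>i<n. (norm (cadjoint B (?\<xi> v i) + cadjoint D (v i)))\<^sup>2) \<le> (\<Sum>i<n. (norm (v i))\<^sup>2)" .
qed

text \<open>
  The hypothesis \<open>ctr\<close> says that \<open>\<langle>x, \<xi>\<rangle>\<close> is controlled by the energy that the adjoint system emits
  when it is left alone in the state \<open>\<xi>\<close>; a state \<open>x = W\<^sub>c v\<close> has this property with \<open>c = \<parallel>v\<parallel>\<^sup>2\<close>.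
  Pairing the output \<open>y\<close> with itself produces such a \<open>\<xi>\<close>, and the adjoint system, driven by \<open>y\<close> up
  to time \<open>n\<close> and then left alone, emits at most \<open>\<parallel>y\<parallel>\<^sup>2\<close> altogether.
\<close>

lemma dissipative_output_bound:
  fixes A :: "'x::chilbert_space \<Rightarrow> 'x" and B :: "'u::chilbert_space \<Rightarrow> 'x"
    and C :: "'x \<Rightarrow> 'y::chilbert_space" and D :: "'u \<Rightarrow> 'y"
  assumes bd: "bounded_clinear A" "bounded_clinear B" "bounded_clinear C" "bounded_clinear D"
    and "dissipative A B C D"
    and ctr: "\<And>\<xi> e. (\<And>m. (\<Sum>k<m. (norm (cadjoint B ((cadjoint A ^^ k) \<xi>)))\<^sup>2) \<le> e) \<Longrightarrow> 2 * inner x \<xi> \<le> c + e"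
  shows "(\<Sum>i<n. (norm (C (state A B x u i) + D (u i)))\<^sup>2) \<le> c + (\<Sum>i<n. (norm (u i))\<^sup>2)"
proof -
  let ?\<xi> = "state (cadjoint A) (cadjoint C) 0"
  define y where "y = (\<lambda>i. C (state A B x u i) + D (u i))"
  \<comment> \<open>the reversed output drives the adjoint system up to time \<open>n\<close>; afterwards the input is zero\<close>
  define v where "v = (\<lambda>k. if k < n then y (n - Suc k) else 0)"
  have \<xi>: "?\<xi> (\<lambda>k. y (n - Suc k)) m = ?\<xi> v m" if "m \<le> n" for m
    by (rule state_cong) (use that in \<open>auto simp: v_def\<close>)
  define w where "w = (\<lambda>i. cadjoint B (?\<xi> v (n - Suc i)) + cadjoint D (y i))"
  define E where "E = (\<Sum>i<n. (norm (y i))\<^sup>2)"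
  have bs: "bounded_clinear (cadjoint C)" "bounded_clinear (cadjoint D)" using bd bounded_clinear_cadjoint by blast+
  have "(\<Sum>k<m. (norm (cadjoint B ((cadjoint A ^^ k) (?\<xi> v n))))\<^sup>2) \<le> E - (\<Sum>i<n. (norm (w i))\<^sup>2)" for m
  proof -
    define g where "g = (\<lambda>i. (norm (cadjoint B (?\<xi> v i) + cadjoint D (v i)))\<^sup>2)"
    have "sum g {..<n + m} \<le> (\<Sum>i<n + m. (norm (v i))\<^sup>2)"
      using dissipative_adjoint[OF bd \<open>dissipative A B C D\<close>] unfolding dissipative_def g_def by blast
    moreover have "(\<Sum>i<n + m. (norm (v i))\<^sup>2) = E"
    proof -
      have "(\<Sum>i<n + m. (norm (v i))\<^sup>2) = (\<Sum>i<n. (norm (v i))\<^sup>2)"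
        by (rule sum.mono_neutral_right) (auto simp: v_def)
      also have "\<dots> = (\<Sum>i<n. (norm (y (n - Suc i)))\<^sup>2)" by (simp add: v_def)
      also have "\<dots> = E" unfolding E_def by (rule sum.nat_diff_reindex)
      finally show ?thesis .
    qed
    moreover have "sum g {..<n + m} = sum g {..<n} + (\<Sum>k<m. g (n + k))"
      by (induction m) (auto simp: add.assoc)
    moreover have "sum g {..<n} = (\<Sum>i<n. (norm (w i))\<^sup>2)"
    proof -
      have "(\<Sum>i<n. (norm (w i))\<^sup>2) = (\<Sum>i<n. g (n - Suc i))"
        by (intro sum.cong refl) (auto simp: g_def w_def v_def)
      then show ?thesis by (simp add: sum.nat_diff_reindex)
    qed
    moreover have "g (n + k) = (norm (cadjoint B ((cadjoint A ^^ k) (?\<xi> v n))))\<^sup>2" for k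
      using state_free[of n "cadjoint C" v "cadjoint A" 0 k]
      by (simp add: g_def v_def bounded_clinear_zero[OF bs(1)] bounded_clinear_zero[OF bs(2)])
    ultimately show ?thesis by simp
  qed
  from ctr[OF this] have 1: "2 * inner x (?\<xi> v n) \<le> c + (E - (\<Sum>i<n. (norm (w i))\<^sup>2))" .
  have "E = (\<Sum>i<n. inner (C (state A B x u i) + D (u i)) (y i))"
    by (simp add: E_def power2_norm_eq_inner y_def)
  also have "\<dots> = inner x (?\<xi> v n) + (\<Sum>i<n. inner (u i) (w i))"
    unfolding energy_pairing[OF bd] w_def by (simp add: \<xi>)
  finally have "E = inner x (?\<xi> v n) + (\<Sum>i<n. inner (u i) (w i))" .
  moreover have "(\<Sum>i<n. 2 * inner (u i) (w i)) \<le> (\<Sum>i<n. (norm (u i))\<^sup>2) + (\<Sum>i<n. (norm (w i))\<^sup>2)"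
    unfolding sum.distrib[symmetric] by (intro sum_mono two_inner_le)
  ultimately have "E \<le> c + (\<Sum>i<n. (norm (u i))\<^sup>2)" using 1 by (simp add: sum_distrib_left[symmetric])
  then show ?thesis by (simp add: E_def y_def)
qed

section \<open>Schur class transfer functions are dissipative\<close>

text \<open>
  Rotating \<open>x\<close> by a unimodular scalar makes the inner product real.
\<close>

lemma cmod_cinner_le_norm: "cmod (cinner x y) \<le> norm x * norm (y :: 'a::complex_inner)"
proof (cases "cinner x y = 0")
  case False
  define a where "a = cnj (cinner x y) / cmod (cinner x y)"
  have "cmod a = 1" using False by (simp add: a_def norm_divide)
  have "cinner (a *\<^sub>C x) y = cmod (cinner x y)"
    using False by (simp add: cinner_scaleC_left a_def complex_norm_square mult.commute power2_eq_square[of "of_real _"]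
        flip: complex_norm_square)
  then have "cmod (cinner x y) = inner (a *\<^sub>C x) y" by (simp add: inner_eq_Re_cinner)
  also have "\<dots> \<le> norm (a *\<^sub>C x) * norm y" by (rule norm_cauchy_schwarz)
  finally show ?thesis by (simp add: norm_scaleC \<open>cmod a = 1\<close>)
qed simp

lemma cinner_sum_left: "cinner (\<Sum>i\<in>I. f i) y = (\<Sum>i\<in>I. cinner (f i) (y :: 'a::complex_inner))"
  by (induction I rule: infinite_finite_induct) (simp_all add: cinner_add_left)

lemma cinner_sum_right: "cinner y (\<Sum>i\<in>I. f i) = (\<Sum>i\<in>I. cinner (y :: 'a::complex_inner) (f i))"
  by (induction I rule: infinite_finite_induct) (simp_all add: cinner_add_right)

instance chilbert_space \<subseteq> banach ..

text \<open>
  The Neumann series for \<open>(I - z A)\<^sup>-\<^sup>1\<close>, tested against a vector.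
\<close>

lemma transfer_function_expansion:
  fixes A :: "'x::chilbert_space \<Rightarrow> 'x" and B :: "'u::chilbert_space \<Rightarrow> 'x"
    and C :: "'x \<Rightarrow> 'y::chilbert_space" and D :: "'u \<Rightarrow> 'y"
  assumes A: "bounded_clinear A" and C: "bounded_clinear C"
  shows "\<forall>\<^sub>F z in nhds 0. (\<lambda>n. cinner (taylor_coeff A B C D n u) y * z ^ n) sums
    cinner (transfer_function A B C D z u) y"
proof -
  obtain K where K: "K > 0" "\<And>x. norm (A x) \<le> norm x * K"
    using bounded_linear.pos_bounded[OF bounded_clinear_bl[OF A]] by blast
  obtain L where L: "\<And>x. norm (C x) \<le> norm x * L"
    using bounded_linear.bounded[OF bounded_clinear_bl[OF C]] by blast
  have "(\<lambda>n. cinner (taylor_coeff A B C D n u) y * z ^ n) sums cinner (transfer_function A B C D z u) y"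
    if "dist z 0 < 1 / K" for z
  proof -
    define q where "q = cmod z * K"
    have q: "0 \<le> q" "q < 1" using that K(1) by (auto simp: q_def field_simps)
    define s where "s = (\<lambda>n. (z ^ n) *\<^sub>C (A ^^ n) (B u))"
    have s_Suc: "s (Suc n) = z *\<^sub>C A (s n)" for n
      by (simp add: s_def bounded_clinear_scaleC[OF A] scaleC_scaleC)
    have "norm (s n) \<le> norm (B u) * q ^ n" for n
    proof (induction n)
      case (Suc n)
      have "norm (s (Suc n)) \<le> cmod z * (norm (s n) * K)"
        unfolding s_Suc norm_scaleC by (intro mult_left_mono K) simp
      also have "\<dots> = q * norm (s n)" by (simp add: q_def)
      also have "\<dots> \<le> q * (norm (B u) * q ^ n)" by (intro mult_left_mono Suc q)
      finally show ?case by (simp add: mult_ac)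
    qed (simp add: s_def scaleC_one)
    then have "summable s"
      using q summable_comparison_test'[of "\<lambda>n. norm (B u) * q ^ n" 0 s]
      by (simp add: summable_mult summable_geometric)
    then have sS: "s sums suminf s" by (rule summable_sums)
    define S where "S = suminf s"
    note blA = bounded_clinear_bl[OF A] and blC = bounded_clinear_bl[OF C]
    have "(\<lambda>n. s (Suc n)) sums (z *\<^sub>C A S)"
      unfolding s_Suc S_def
      by (intro bounded_linear.sums[OF bounded_linear_scaleC] bounded_linear.sums[OF blA] sS)
    moreover have "(\<lambda>n. s (Suc n)) sums (S - s 0)"
      using sS by (simp add: sums_Suc_iff S_def)
    ultimately have "z *\<^sub>C A S = S - s 0" by (rule sums_unique2)
    then have eq: "S - z *\<^sub>C A S = B u" by (simp add: s_def scaleC_one)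
    have "inj (\<lambda>x. x - z *\<^sub>C A x)"
    proof (rule injI)
      fix a b assume "a - z *\<^sub>C A a = b - z *\<^sub>C A b"
      then have "a - b = z *\<^sub>C A (a - b)"
        by (simp add: bounded_clinear_diff[OF A] linear_diff[OF bounded_linear.linear[OF bounded_linear_scaleC]] algebra_simps)
      then have "norm (a - b) = cmod z * norm (A (a - b))" by (metis norm_scaleC)
      also have "\<dots> \<le> cmod z * (norm (a - b) * K)" by (intro mult_left_mono K) simp
      also have "\<dots> = q * norm (a - b)" by (simp add: q_def)
      finally have "(1 - q) * norm (a - b) \<le> 0" by (simp add: algebra_simps)
      then show "a = b" using q by (simp add: mult_le_0_iff)
    qed
    then have inv: "inv (\<lambda>x. x - z *\<^sub>C A x) (B u) = S" by (intro inv_f_eq eq)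
    have bl: "bounded_linear (\<lambda>v. cinner (C v) y)"
    proof (rule bounded_linear_intro[where K="L * norm y"])
      show "norm (cinner (C v) y) \<le> norm v * (L * norm y)" for v
        using order_trans[OF cmod_cinner_le_norm mult_right_mono[OF L, of "norm y" v]] by (simp add: mult.assoc)
    qed (simp_all add: bounded_clinear_add[OF C] bounded_clinear_scaleC[OF C] cinner_add_left
        cinner_scaleC_left scaleR_conv_of_real flip: scaleC_of_real)
    have "(\<lambda>n. z * cinner (C (s n)) y) sums (z * cinner (C S) y)"
      unfolding S_def by (intro sums_mult bounded_linear.sums[OF bl] sS)
    also have "(\<lambda>n. z * cinner (C (s n)) y) = (\<lambda>n. cinner (taylor_coeff A B C D (Suc n) u) y * z ^ Suc n)"
      by (simp add: s_def taylor_coeff_def bounded_clinear_scaleC[OF C] cinner_scaleC_left mult_ac)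
    finally have "(\<lambda>n. cinner (taylor_coeff A B C D n u) y * z ^ n) sums
        (z * cinner (C S) y + cinner (taylor_coeff A B C D 0 u) y * z ^ 0)"
      by (rule sums_Suc)
    also have "z * cinner (C S) y + cinner (taylor_coeff A B C D 0 u) y * z ^ 0 = cinner (transfer_function A B C D z u) y"
      by (simp add: transfer_function_def inv cinner_add_left cinner_scaleC_left taylor_coeff_def)
    finally show ?thesis .
  qed
  then show ?thesis
    unfolding eventually_nhds_metric using K(1) by (intro exI[of _ "1 / K"]) simp
qed

lemma schur_class_holomorphic:
  assumes F: "F \<in> schur_class"
  shows "(\<lambda>z. cinner (F z u) y) holomorphic_on ball 0 1"
proof -
  have "\<exists>d. ((\<lambda>z. cinner (F z u) y) has_field_derivative d) (at z)" if z: "z \<in> ball 0 1" for z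
  proof -
    obtain F' where F': "bounded_clinear F'"
      "((\<lambda>w. onorm (\<lambda>u. (1 / (w - z)) *\<^sub>C (F w u - F z u) - F' u)) \<longlongrightarrow> 0) (at z)"
      using F z unfolding schur_class_def by blast
    let ?E = "\<lambda>w u. (1 / (w - z)) *\<^sub>C (F w u - F z u) - F' u"
    have "((\<lambda>w. (cinner (F w u) y - cinner (F z u) y) / (w - z) - cinner (F' u) y) \<longlongrightarrow> 0) (at z)"
    proof (rule Lim_null_comparison)
      show "((\<lambda>w. onorm (?E w) * norm u * norm y) \<longlongrightarrow> 0) (at z)"
        by (intro tendsto_mult_left_zero F'(2))
      have "\<forall>\<^sub>F w in at z. w \<in> ball 0 1"
        using z by (intro eventually_at_in_open') auto
      then show "\<forall>\<^sub>F w in at z. norm ((cinner (F w u) y - cinner (F z u) y) / (w - z) - cinner (F' u) y)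
          \<le> onorm (?E w) * norm u * norm y"
      proof eventually_elim
        fix w :: complex assume w: "w \<in> ball 0 1"
        have "bounded_linear (F w)" "bounded_linear (F z)"
          using F w z by (auto simp: schur_class_def bounded_clinear_def)
        then have "bounded_linear (?E w)"
          by (intro bounded_linear_sub bounded_linear_compose[OF bounded_linear_scaleC] bounded_clinear_bl[OF F'(1)])
        then have *: "norm (?E w u) \<le> onorm (?E w) * norm u" by (rule onorm)
        have "(cinner (F w u) y - cinner (F z u) y) / (w - z) - cinner (F' u) y = cinner (?E w u) y"
          by (simp add: cinner_diff_left cinner_scaleC_left)
        also have "cmod \<dots> \<le> norm (?E w u) * norm y" by (rule cmod_cinner_le_norm)
        also have "\<dots> \<le> onorm (?E w) * norm u * norm y" by (intro mult_right_mono *) simp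
        finally show "norm ((cinner (F w u) y - cinner (F z u) y) / (w - z) - cinner (F' u) y)
          \<le> onorm (?E w) * norm u * norm y" .
      qed
    qed
    from LIM_zero_cancel[OF this] show ?thesis unfolding has_field_derivative_iff by (rule exI)
  qed
  then show ?thesis
    by (auto simp: holomorphic_on_open)
qed

text \<open>
  The scalar functions \<open>\<langle>F z u, y\<rangle>\<close> are holomorphic on the disc, so the power series that represents
  them near \<open>0\<close> represents them on the whole disc.
\<close>

lemma schur_class_expansion:
  fixes A :: "'x::chilbert_space \<Rightarrow> 'x" and B :: "'u::chilbert_space \<Rightarrow> 'x"
    and C :: "'x \<Rightarrow> 'y::chilbert_space" and D :: "'u \<Rightarrow> 'y"
  assumes A: "bounded_clinear A" and C: "bounded_clinear C"
    and F: "F \<in> schur_class" "\<forall>\<^sub>F z in nhds 0. F z = transfer_function A B C D z"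
    and z: "norm z < 1"
  shows "(\<lambda>n. cinner (taylor_coeff A B C D n u) y * z ^ n) sums cinner (F z u) y"
proof -
  define a where "a = Abs_fps (\<lambda>n. cinner (taylor_coeff A B C D n u) y)"
  have ev: "\<forall>\<^sub>F z in nhds 0. (\<lambda>n. fps_nth a n * z ^ n) sums cinner (F z u) y"
    using transfer_function_expansion[OF A C, of B D u y] F(2)
    by eventually_elim (simp add: a_def)
  then obtain d where d: "d > 0" "\<And>z. dist z 0 < d \<Longrightarrow> (\<lambda>n. fps_nth a n * z ^ n) sums cinner (F z u) y"
    unfolding eventually_nhds_metric by blast
  have "summable (\<lambda>n. fps_nth a n * (of_real (d / 2) :: complex) ^ n)"
    using d(2)[of "of_real (d/2)"] d(1) by (auto simp: sums_iff)
  then have "conv_radius (fps_nth a) \<ge> ereal (norm (of_real (d / 2) :: complex))"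
    by (rule conv_radius_geI)
  then have "fps_conv_radius a > 0"
    using d(1) by (simp add: fps_conv_radius_def) (metis ereal_less(2) half_gt_zero less_le_trans)
  moreover have "\<forall>\<^sub>F z in nhds 0. eval_fps a z = cinner (F z u) y"
    using ev by eventually_elim (simp add: eval_fps_def sums_iff)
  ultimately have exp: "(\<lambda>z. cinner (F z u) y) has_fps_expansion a"
    by (simp add: has_fps_expansion_def)
  have "(\<lambda>n. fps_nth a n * z ^ n) sums cinner (F z u) y"
    by (rule has_fps_expansion_imp_sums_complex[OF exp, of 1])
      (use schur_class_holomorphic[OF F(1)] z in \<open>auto simp: one_ereal_def\<close>)
  then show ?thesis by (simp add: a_def)
qed

definition circle_point :: "real \<Rightarrow> nat \<Rightarrow> nat \<Rightarrow> complex" where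
  "circle_point r m k = of_real r * cis (2 * pi * k / m)"

lemma norm_circle_point: "0 \<le> r \<Longrightarrow> norm (circle_point r m k) = r"
  by (simp add: circle_point_def norm_mult)

text \<open>
  The mean over the \<open>m\<close>-th roots of unity, scaled to radius \<open>r\<close>, replaces integration over the circle:
  it is exact on monomials in \<open>z\<close> and \<open>cnj z\<close> of total degree below \<open>m\<close>.
\<close>

definition circle_mean :: "real \<Rightarrow> nat \<Rightarrow> (complex \<Rightarrow> complex) \<Rightarrow> complex" where
  "circle_mean r m f = (\<Sum>k<m. f (circle_point r m k)) / m"

lemma circle_mean_sum: "circle_mean r m (\<lambda>z. \<Sum>i\<in>I. f i z) = (\<Sum>i\<in>I. circle_mean r m (f i))"
  unfolding circle_mean_def sum_divide_distrib by (rule sum.swap)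

lemma circle_mean_cmult: "circle_mean r m (\<lambda>z. c * f z) = c * circle_mean r m f"
  by (simp add: circle_mean_def sum_distrib_left)

lemma circle_mean_monomial:
  assumes "p + q < m"
  shows "circle_mean r m (\<lambda>z. z ^ p * cnj z ^ q) = (if p = q then of_real (r ^ (2 * p)) else 0)"
proof -
  define \<zeta> where "\<zeta> = cis (2 * pi * (real p - real q) / m)"
  have m: "m > 0" using assms by simp
  have *: "circle_point r m k ^ p * cnj (circle_point r m k) ^ q = of_real (r ^ (p + q)) * \<zeta> ^ k" for k
  proof -
    have "cis (2 * pi * k / m) ^ p * cnj (cis (2 * pi * k / m)) ^ q = \<zeta> ^ k"
    proof -
      have "cis x ^ p * cnj (cis x) ^ q = cis (p * x - q * x)" for x :: real
        by (simp only: Complex.DeMoivre cis_cnj cis_mult) simp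
      moreover have "real p * (2 * pi * k / m) - real q * (2 * pi * k / m) = k * (2 * pi * (real p - real q) / m)"
        using m by (simp add: field_simps)
      ultimately show ?thesis by (simp only: \<zeta>_def Complex.DeMoivre)
    qed
    then show ?thesis by (simp add: circle_point_def power_mult_distrib power_add mult_ac)
  qed
  have mean: "circle_mean r m (\<lambda>z. z ^ p * cnj z ^ q) = of_real (r ^ (p + q)) * (\<Sum>k<m. \<zeta> ^ k) / m"
    unfolding circle_mean_def * by (simp add: sum_distrib_left)
  show ?thesis
  proof (cases "p = q")
    case True
    then have "\<zeta> = 1" by (simp add: \<zeta>_def)
    then show ?thesis unfolding mean using True m by (simp add: mult_2)
  next
    case False
    have "\<zeta> ^ m = cis (2 * pi * of_int (int p - int q))"
      using m by (simp add: \<zeta>_def Complex.DeMoivre)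
    also have "\<dots> = 1" by (rule cis_multiple_2pi) (rule Ints_of_int)
    finally have 1: "\<zeta> ^ m = 1" .
    have "\<zeta> \<noteq> 1"
    proof
      assume "\<zeta> = 1"
      then have "cos (2 * pi * (real p - real q) / m) = 1" by (simp add: \<zeta>_def complex_eq_iff)
      then obtain n :: int where "2 * pi * (real p - real q) / m = real_of_int n * 2 * pi"
        unfolding cos_one_2pi_int by blast
      then have "2 * pi * (real p - real q) = 2 * pi * (n * real m)" using m by (simp add: field_simps)
      then have "real p - real q = n * real m" by (subst (asm) mult_cancel_left) simp
      then have "of_int (int p - int q) = (of_int (n * int m) :: real)" by simp
      then have e: "int p - int q = n * int m" by (simp only: of_int_eq_iff)
      then have "n \<noteq> 0" using False by auto
      then have "1 * int m \<le> \<bar>n\<bar> * int m" by (intro mult_right_mono) auto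
      then have "int m \<le> \<bar>n * int m\<bar>" by (simp add: abs_mult)
      then show False using e assms by linarith
    qed
    then have "(\<Sum>k<m. \<zeta> ^ k) = 0" using geometric_sum[of \<zeta> m] 1 by simp
    then show ?thesis using False by (simp add: mean)
  qed
qed

lemma norm_circle_mean_le:
  assumes "0 \<le> r" "\<And>z. norm z = r \<Longrightarrow> norm (f z) \<le> b" "0 \<le> b"
  shows "norm (circle_mean r m f) \<le> b"
proof (cases "m = 0")
  case False
  have "norm (\<Sum>k<m. f (circle_point r m k)) \<le> (\<Sum>k<m. b)"
    by (intro sum_norm_le assms norm_circle_point)
  then show ?thesis using False by (simp add: circle_mean_def norm_divide field_simps)
qed (simp add: circle_mean_def assms)

text \<open>
  Termwise the limit is attained eventually, and the terms are dominated by \<open>|a\<^sub>n| r\<^sup>n\<close>, so Tannery's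
  theorem permits the interchange.
\<close>

lemma circle_mean_power_series:
  assumes h: "\<And>z. norm z < 1 \<Longrightarrow> (\<lambda>n. a n * z ^ n) sums h z" and r: "0 \<le> r" "r < 1"
  shows "(\<lambda>m. circle_mean r m (\<lambda>z. h z * (z ^ j * cnj z ^ i)))
    \<longlonglongrightarrow> (if j \<le> i then a (i - j) * of_real (r ^ (2 * i)) else 0)"
proof -
  define b where "b = (\<lambda>n. a n * (if n + j = i then of_real (r ^ (2 * i)) else 0))"
  \<comment> \<open>the mean of the \<open>n\<close>-th term of the series, and its limit \<open>b n\<close>\<close>
  define e where "e = (\<lambda>n m. a n * circle_mean r m (\<lambda>z. z ^ (n + j) * cnj z ^ i))"
  have e_sums: "(\<lambda>n. e n m) sums circle_mean r m (\<lambda>z. h z * (z ^ j * cnj z ^ i))" for m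
  proof -
    have "(\<lambda>n. \<Sum>k<m. (a n * circle_point r m k ^ n) * (circle_point r m k ^ j * cnj (circle_point r m k) ^ i) / m)
      sums (\<Sum>k<m. h (circle_point r m k) * (circle_point r m k ^ j * cnj (circle_point r m k) ^ i) / m)"
      by (intro sums_sum sums_divide sums_mult2 h) (simp add: norm_circle_point r)
    then show ?thesis
      by (simp add: e_def circle_mean_def sum_divide_distrib sum_distrib_left power_add mult_ac)
  qed
  have b_sums: "b sums (if j \<le> i then a (i - j) * of_real (r ^ (2 * i)) else 0)"
  proof (cases "j \<le> i")
    case True
    have "(\<lambda>n. if n = i - j then b n else 0) = b"
      using True by (auto simp: b_def fun_eq_iff)
    then have "b sums b (i - j)" using sums_single[of "i - j" b] by simp
    then show ?thesis using True by (simp add: b_def)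
  next
    case False
    then have "b = (\<lambda>n. 0)" by (auto simp: b_def)
    then show ?thesis using False by simp
  qed
  have "(\<lambda>m. \<Sum>n. e n m) \<longlonglongrightarrow> suminf b"
  proof (rule tannerys_theorem[THEN conjunct2, THEN conjunct2])
    show "(\<lambda>m. e n m) \<longlonglongrightarrow> b n" for n
    proof (rule tendsto_eventually)
      show "\<forall>\<^sub>F m in sequentially. e n m = b n"
        using eventually_gt_at_top[of "n + j + i"]
        by eventually_elim (auto simp: e_def b_def circle_mean_monomial)
    qed
    have "norm (e n m) \<le> norm (a n * of_real r ^ n)" for n m
    proof -
      have "norm (circle_mean r m (\<lambda>z. z ^ (n + j) * cnj z ^ i)) \<le> r ^ n"
      proof (rule norm_circle_mean_le[OF r(1)])
        fix z :: complex assume "norm z = r"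
        then have "norm (z ^ (n + j) * cnj z ^ i) = r ^ n * r ^ (j + i)"
          by (simp add: norm_mult norm_power power_add)
        also have "\<dots> \<le> r ^ n * 1" by (intro mult_left_mono power_le_one) (use r in auto)
        finally show "norm (z ^ (n + j) * cnj z ^ i) \<le> r ^ n" by simp
      qed (use r in simp)
      then show ?thesis using r by (simp add: e_def norm_mult norm_power mult_left_mono)
    qed
    then show "\<forall>\<^sub>F (n, m) in sequentially \<times>\<^sub>F sequentially. norm (e n m) \<le> norm (a n * of_real r ^ n)"
      by (simp add: case_prod_unfold)
    have "summable (\<lambda>n. a n * (of_real ((r + 1) / 2) :: complex) ^ n)"
      using h[of "of_real ((r + 1) / 2)"] r by (auto simp: sums_iff abs_less_iff simp del: of_real_add of_real_divide)
    then show "summable (\<lambda>n. norm (a n * of_real r ^ n))"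
      by (rule powser_insidea) (use r in \<open>simp del: of_real_add of_real_divide\<close>)
  qed simp
  then show ?thesis using e_sums b_sums by (simp add: sums_iff)
qed

lemma cinner_polynomials:
  "cinner (\<Sum>j<N. (z ^ j) *\<^sub>C u j) (\<Sum>i<N. (z ^ i) *\<^sub>C v i)
    = (\<Sum>j<N. \<Sum>i<N. cinner (u j) (v i :: 'a::complex_inner) * (z ^ j * cnj z ^ i))"
  by (simp only: cinner_sum_left)
    (simp only: cinner_sum_right cinner_scaleC_left cinner_scaleC_right complex_cnj_power mult_ac)

lemma circle_mean_norm_polynomial:
  fixes u :: "nat \<Rightarrow> 'u::complex_inner"
  assumes "2 * N < m"
  shows "circle_mean r m (\<lambda>z. of_real ((norm (\<Sum>j<N. (z ^ j) *\<^sub>C u j))\<^sup>2))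
    = of_real (\<Sum>j<N. r ^ (2 * j) * (norm (u j))\<^sup>2)"
proof -
  have "circle_mean r m (\<lambda>z. of_real ((norm (\<Sum>j<N. (z ^ j) *\<^sub>C u j))\<^sup>2))
    = circle_mean r m (\<lambda>z. \<Sum>j<N. \<Sum>i<N. cinner (u j) (u i) * (z ^ j * cnj z ^ i))"
    by (simp only: cinner_self[symmetric] cinner_polynomials)
  also have "\<dots> = (\<Sum>j<N. \<Sum>i<N. cinner (u j) (u i) * circle_mean r m (\<lambda>z. z ^ j * cnj z ^ i))"
    by (simp only: circle_mean_sum circle_mean_cmult)
  also have "\<dots> = (\<Sum>j<N. \<Sum>i<N. if j = i then cinner (u j) (u i) * of_real (r ^ (2 * j)) else 0)"
    using assms by (intro sum.cong refl) (simp add: circle_mean_monomial)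
  also have "\<dots> = of_real (\<Sum>j<N. r ^ (2 * j) * (norm (u j))\<^sup>2)"
    by (simp add: cinner_self mult.commute)
  finally show ?thesis .
qed

text \<open>
  Let \<open>U\<close> and \<open>Y\<close> be the polynomials with coefficients \<open>u\<^sub>i\<close> and \<open>y\<^sub>i\<close> (\<open>i < N\<close>), where \<open>y\<close> is the output.
  Pointwise \<open>2 Re \<langle>F U, Y\<rangle> \<le> \<parallel>U\<parallel>\<^sup>2 + \<parallel>Y\<parallel>\<^sup>2\<close> because \<open>F\<close> is contractive. The mean of the left-hand
  side over the circle of radius \<open>r\<close> tends to \<open>2 \<Sum> r\<^bsup>2i\<^esup> \<parallel>y\<^sub>i\<parallel>\<^sup>2\<close>, since \<open>y\<^sub>i\<close> is the
  \<open>i\<close>-th coefficient of \<open>F U\<close>; the means on the right are \<open>\<Sum> r\<^bsup>2i\<^esup> \<parallel>u\<^sub>i\<parallel>\<^sup>2\<close> and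
  \<open>\<Sum> r\<^bsup>2i\<^esup> \<parallel>y\<^sub>i\<parallel>\<^sup>2\<close>. Cancel, and let \<open>r \<rightarrow> 1\<close>.
\<close>

lemma schur_dissipative:
  fixes A :: "'x::chilbert_space \<Rightarrow> 'x" and B :: "'u::chilbert_space \<Rightarrow> 'x"
    and C :: "'x \<Rightarrow> 'y::chilbert_space" and D :: "'u \<Rightarrow> 'y"
  assumes bd: "bounded_clinear A" "bounded_clinear C" and schur: "has_schur_continuation A B C D"
  shows "dissipative A B C D"
  unfolding dissipative_def
proof (intro allI)
  fix u :: "nat \<Rightarrow> 'u" and N
  obtain F where F: "F \<in> schur_class" "\<forall>\<^sub>F z in nhds 0. F z = transfer_function A B C D z"
    using schur by (auto simp: has_schur_continuation_def)
  define y where "y = (\<lambda>i. \<Sum>j\<le>i. taylor_coeff A B C D (i - j) (u j))"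
  define U where "U = (\<lambda>z. \<Sum>j<N. (z ^ j) *\<^sub>C u j)"
  define Y where "Y = (\<lambda>z. \<Sum>i<N. (z ^ i) *\<^sub>C y i)"
  define G where "G = (\<lambda>z. \<Sum>j<N. \<Sum>i<N. cinner (F z (u j)) (y i) * (z ^ j * cnj z ^ i))"
  have main: "(\<Sum>i<N. r ^ (2 * i) * (norm (y i))\<^sup>2) \<le> (\<Sum>i<N. r ^ (2 * i) * (norm (u i))\<^sup>2)"
    if r: "0 \<le> r" "r < 1" for r
  proof -
    have G_le: "2 * Re (G z) \<le> (norm (U z))\<^sup>2 + (norm (Y z))\<^sup>2" if "norm z = r" for z
    proof -
      have z: "z \<in> ball 0 1" using that r by simp
      then have Fz: "bounded_clinear (F z)" "onorm (F z) \<le> 1" using F(1) by (auto simp: schur_class_def)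
      have "F z (U z) = (\<Sum>j<N. (z ^ j) *\<^sub>C F z (u j))"
        by (simp add: U_def linear_sum[OF bounded_linear.linear[OF bounded_clinear_bl[OF Fz(1)]]]
            bounded_clinear_scaleC[OF Fz(1)])
      then have "cinner (F z (U z)) (Y z) = G z"
        by (simp only: G_def Y_def cinner_polynomials)
      then have "Re (G z) = inner (F z (U z)) (Y z)" by (simp add: inner_eq_Re_cinner)
      then have "2 * Re (G z) \<le> (norm (F z (U z)))\<^sup>2 + (norm (Y z))\<^sup>2" using two_inner_le by simp
      moreover have "norm (F z (U z)) \<le> norm (U z)"
        using onorm[OF bounded_clinear_bl[OF Fz(1)], of "U z"] Fz(2)
          mult_right_mono[OF Fz(2), of "norm (U z)"] by simp
      ultimately show ?thesis by (smt (verit) power_mono norm_ge_zero)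
    qed
    \<comment> \<open>the monomials that occur have total degree below \<open>2 N\<close>, so these means are exact\<close>
    have mean_le: "2 * Re (circle_mean r m G) \<le> (\<Sum>i<N. r ^ (2 * i) * (norm (u i))\<^sup>2) + (\<Sum>i<N. r ^ (2 * i) * (norm (y i))\<^sup>2)"
      if m: "2 * N < m" for m
    proof -
      have "2 * Re (circle_mean r m G) = (\<Sum>k<m. 2 * Re (G (circle_point r m k))) / m"
        by (simp add: circle_mean_def sum_distrib_left)
      also have "\<dots> \<le> (\<Sum>k<m. (norm (U (circle_point r m k)))\<^sup>2 + (norm (Y (circle_point r m k)))\<^sup>2) / m"
        by (intro divide_right_mono sum_mono G_le norm_circle_point r) simp
      also have "\<dots> = Re (circle_mean r m (\<lambda>z. of_real ((norm (U z))\<^sup>2)) + circle_mean r m (\<lambda>z. of_real ((norm (Y z))\<^sup>2)))"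
        by (simp add: circle_mean_def sum.distrib add_divide_distrib flip: of_real_sum of_real_power)
      also have "\<dots> = (\<Sum>i<N. r ^ (2 * i) * (norm (u i))\<^sup>2) + (\<Sum>i<N. r ^ (2 * i) * (norm (y i))\<^sup>2)"
        unfolding U_def Y_def circle_mean_norm_polynomial[OF m] by simp
      finally show ?thesis .
    qed
    let ?c = "\<lambda>j i. if j \<le> i then cinner (taylor_coeff A B C D (i - j) (u j)) (y i) * of_real (r ^ (2 * i)) else 0"
    have "(\<lambda>m. circle_mean r m G) \<longlonglongrightarrow>
      (\<Sum>j<N. \<Sum>i<N. ?c j i)"
    proof -
      have "circle_mean r m G = (\<Sum>j<N. \<Sum>i<N. circle_mean r m (\<lambda>z. cinner (F z (u j)) (y i) * (z ^ j * cnj z ^ i)))" for m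
        by (simp only: G_def circle_mean_sum)
      then show ?thesis
        by (simp only:) (intro tendsto_sum circle_mean_power_series schur_class_expansion[OF bd F] r)
    qed
    also have "(\<Sum>j<N. \<Sum>i<N. ?c j i)
      = (\<Sum>i<N. \<Sum>j<N. ?c j i)"
      by (rule sum.swap)
    also have "\<dots> = (\<Sum>i<N. of_real (r ^ (2 * i) * (norm (y i))\<^sup>2))"
    proof (intro sum.cong refl)
      fix i assume "i \<in> {..<N}"
      then have "{..<N} \<inter> {j. j \<le> i} = {..i}" by auto
      then have "(\<Sum>j<N. ?c j i)
        = (\<Sum>j\<le>i. cinner (taylor_coeff A B C D (i - j) (u j)) (y i) * of_real (r ^ (2 * i)))"
        by (simp add: sum.If_cases)
      also have "\<dots> = cinner (y i) (y i) * of_real (r ^ (2 * i))"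
        by (simp add: y_def cinner_sum_left sum_distrib_right)
      finally show "(\<Sum>j<N. ?c j i)
        = of_real (r ^ (2 * i) * (norm (y i))\<^sup>2)" by (simp add: cinner_self mult.commute)
    qed
    finally have lim: "(\<lambda>m. circle_mean r m G) \<longlonglongrightarrow> of_real (\<Sum>i<N. r ^ (2 * i) * (norm (y i))\<^sup>2)" by simp
    have "2 * (\<Sum>i<N. r ^ (2 * i) * (norm (y i))\<^sup>2) \<le>
      (\<Sum>i<N. r ^ (2 * i) * (norm (u i))\<^sup>2) + (\<Sum>i<N. r ^ (2 * i) * (norm (y i))\<^sup>2)"
    proof (rule LIMSEQ_le_const2)
      show "(\<lambda>m. 2 * Re (circle_mean r m G)) \<longlonglongrightarrow> 2 * (\<Sum>i<N. r ^ (2 * i) * (norm (y i))\<^sup>2)"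
        using tendsto_mult_left[OF tendsto_Re[OF lim], of 2] by simp
      show "\<exists>M. \<forall>m\<ge>M. 2 * Re (circle_mean r m G) \<le>
        (\<Sum>i<N. r ^ (2 * i) * (norm (u i))\<^sup>2) + (\<Sum>i<N. r ^ (2 * i) * (norm (y i))\<^sup>2)"
        using mean_le by (intro exI[of _ "Suc (2 * N)"]) auto
    qed
    then show ?thesis by simp
  qed
  define r where "r = (\<lambda>n. 1 - 1 / real (Suc n))"
  have r1: "r \<longlonglongrightarrow> 1"
    unfolding r_def using tendsto_diff[OF tendsto_const LIMSEQ_Suc[OF lim_1_over_n], of "1::real"] by simp
  have r: "0 \<le> r n" "r n < 1" for n by (auto simp: r_def)
  have "(\<Sum>i<N. 1 ^ (2 * i) * (norm (y i))\<^sup>2) \<le> (\<Sum>i<N. 1 ^ (2 * i) * (norm (u i))\<^sup>2)"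
  proof (rule LIMSEQ_le)
    show "(\<lambda>n. \<Sum>i<N. r n ^ (2 * i) * (norm (y i))\<^sup>2) \<longlonglongrightarrow> (\<Sum>i<N. 1 ^ (2 * i) * (norm (y i))\<^sup>2)"
      "(\<lambda>n. \<Sum>i<N. r n ^ (2 * i) * (norm (u i))\<^sup>2) \<longlonglongrightarrow> (\<Sum>i<N. 1 ^ (2 * i) * (norm (u i))\<^sup>2)"
      by (intro tendsto_intros r1)+
  qed (use main r in auto)
  moreover have "C (state A B 0 u i) + D (u i) = y i" for i
  proof -
    have "(A ^^ i) 0 = 0" by (induction i) (simp_all add: bounded_clinear_zero[OF bd(1)])
    then show ?thesis by (simp add: state_output[OF bd] y_def bounded_clinear_zero[OF bd(2)])
  qed
  ultimately show "(\<Sum>i<N. (norm (C (state A B 0 u i) + D (u i)))\<^sup>2) \<le> (\<Sum>i<N. (norm (u i))\<^sup>2)" by simp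
qed

section \<open>Square-summable families indexed through a bijection with the natural numbers\<close>

lemma bounded_clinear_ell2_nth:
  "bounded_clinear (\<lambda>v :: ('i, 'a::complex_inner) ell2. ell2_nth v i)"
  unfolding bounded_clinear_def
  by (auto intro!: bounded_linear_intro[where K=1] simp: ell2_nth_le_norm)

lemma ell2_sums_cinner:
  fixes v w :: "('i, 'a::complex_inner) ell2" and e :: "'i \<Rightarrow> nat"
  assumes e: "bij e"
  shows "(\<lambda>k. cinner (ell2_nth v (inv e k)) (ell2_nth w (inv e k))) sums cinner v w"
proof -
  have "((\<lambda>i. cinner (ell2_nth v i) (ell2_nth w i)) has_sum cinner v w) UNIV"
    unfolding cinner_ell2_def by (rule has_sum_infsum[OF ell2_cinner_summable])
  then have "((\<lambda>k. cinner (ell2_nth v (inv e k)) (ell2_nth w (inv e k))) has_sum cinner v w) UNIV"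
    using has_sum_reindex_bij_betw[OF bij_imp_bij_inv[OF e],
        of "\<lambda>i. cinner (ell2_nth v i) (ell2_nth w i)" "cinner v w"] by simp
  then show ?thesis by (rule has_sum_imp_sums)
qed

lemma ell2_sums_norm:
  fixes v :: "('i, 'a::complex_inner) ell2" and e :: "'i \<Rightarrow> nat"
  assumes e: "bij e"
  shows "(\<lambda>k. (norm (ell2_nth v (inv e k)))\<^sup>2) sums (norm v)\<^sup>2"
  using sums_Re[OF ell2_sums_cinner[OF e, of v v]] by (simp add: cinner_self)

lemma ell2_partial_sum_le:
  fixes v :: "('i, 'a::complex_inner) ell2" and e :: "'i \<Rightarrow> nat"
  assumes e: "bij e"
  shows "(\<Sum>k<n. (norm (ell2_nth v (inv e k)))\<^sup>2) \<le> (norm v)\<^sup>2"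
  using sum_le_suminf[OF sums_summable[OF ell2_sums_norm[OF e, of v]], of "{..<n}"]
    sums_unique[OF ell2_sums_norm[OF e, of v]] by simp

lemma ell2_norm_le:
  fixes v :: "('i, 'a::complex_inner) ell2" and e :: "'i \<Rightarrow> nat"
  assumes e: "bij e" and le: "\<And>n. (\<Sum>k<n. (norm (ell2_nth v (inv e k)))\<^sup>2) \<le> c"
  shows "(norm v)\<^sup>2 \<le> c"
  using ell2_sums_norm[OF e, of v, unfolded sums_def] by (rule LIMSEQ_le_const2) (use le in auto)

text \<open>
  The bijection \<open>e\<close> will be the identity for the future and time reversal for the past. Through it,
  estimates for both are made on initial segments of a sequence.
\<close>

lemma ell2_of_sequence:
  fixes f :: "nat \<Rightarrow> 'a::complex_inner" and e :: "'i \<Rightarrow> nat"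
  assumes e: "bij e" and le: "\<And>n. (\<Sum>k<n. (norm (f k))\<^sup>2) \<le> c"
  obtains v :: "('i, 'a) ell2" where "\<And>i. ell2_nth v i = f (e i)" "(norm v)\<^sup>2 \<le> c"
proof -
  have "(\<lambda>k. (norm (f k))\<^sup>2) summable_on UNIV"
  proof (rule nonneg_bdd_above_summable_on)
    have "(\<Sum>k\<in>F. (norm (f k))\<^sup>2) \<le> c" if F: "finite F" for F
    proof -
      obtain n where "F \<subseteq> {..<n}" using F finite_nat_iff_bounded by blast
      then have "(\<Sum>k\<in>F. (norm (f k))\<^sup>2) \<le> (\<Sum>k<n. (norm (f k))\<^sup>2)" by (intro sum_mono2) auto
      then show ?thesis using le[of n] by linarith
    qed
    then show "bdd_above (sum (\<lambda>k. (norm (f k))\<^sup>2) ` {F. F \<subseteq> UNIV \<and> finite F})"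
      by (intro bdd_aboveI2[where M=c]) auto
  qed simp
  then have "(\<lambda>i. (norm (f (e i)))\<^sup>2) summable_on UNIV"
    using summable_on_reindex_bij_betw[OF e, of "\<lambda>k. (norm (f k))\<^sup>2"] by simp
  then have nth: "ell2_nth (Abs_ell2 (\<lambda>i. f (e i))) = (\<lambda>i. f (e i))" by (simp add: Abs_ell2_inverse)
  have "(norm (Abs_ell2 (\<lambda>i. f (e i))))\<^sup>2 \<le> c"
    by (rule ell2_norm_le[OF e]) (use le in \<open>simp add: nth surj_f_inv_f[OF bij_is_surj[OF e]]\<close>)
  then show thesis using that nth by metis
qed

text \<open>
  Prepending a first term: the input \<open>u\<close> now, followed by the input \<open>v\<close> later.
\<close>

lemma ell2_cons:
  fixes u :: "'a::complex_inner" and v :: "('i, 'a) ell2" and e :: "'i \<Rightarrow> nat"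
  assumes e: "bij e"
  obtains v' :: "('i, 'a) ell2" where "\<And>k. ell2_nth v' (inv e k) = (case k of 0 \<Rightarrow> u | Suc k \<Rightarrow> ell2_nth v (inv e k))"
    "(norm v')\<^sup>2 = (norm u)\<^sup>2 + (norm v)\<^sup>2"
proof -
  define f where "f = (\<lambda>k. case k of 0 \<Rightarrow> u | Suc k \<Rightarrow> ell2_nth v (inv e k))"
  have "(\<Sum>k<n. (norm (f k))\<^sup>2) \<le> (norm u)\<^sup>2 + (norm v)\<^sup>2" for n
  proof -
    have "(\<Sum>k<n. (norm (f k))\<^sup>2) \<le> (\<Sum>k<Suc n. (norm (f k))\<^sup>2)" by simp
    also have "\<dots> = (norm u)\<^sup>2 + (\<Sum>k<n. (norm (ell2_nth v (inv e k)))\<^sup>2)"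
      by (subst sum.lessThan_Suc_shift) (simp add: f_def)
    also have "\<dots> \<le> (norm u)\<^sup>2 + (norm v)\<^sup>2" using ell2_partial_sum_le[OF e] by simp
    finally show ?thesis .
  qed
  then obtain v' :: "('i, 'a) ell2" where v': "\<And>i. ell2_nth v' i = f (e i)"
    by (rule ell2_of_sequence[OF e]) blast
  have nth: "ell2_nth v' (inv e k) = f k" for k by (simp add: v' surj_f_inv_f[OF bij_is_surj[OF e]])
  have "(\<lambda>k. (norm (f (Suc k)))\<^sup>2) sums (norm v)\<^sup>2" using ell2_sums_norm[OF e, of v] by (simp add: f_def)
  then have "(\<lambda>k. (norm (f k))\<^sup>2) sums ((norm v)\<^sup>2 + (norm (f 0))\<^sup>2)"
    by (rule sums_Suc[of "\<lambda>k. (norm (f k))\<^sup>2"])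
  moreover have "(\<lambda>k. (norm (f k))\<^sup>2) sums (norm v')\<^sup>2" using ell2_sums_norm[OF e, of v'] by (simp add: nth)
  ultimately have "(norm v)\<^sup>2 + (norm (f 0))\<^sup>2 = (norm v')\<^sup>2" by (rule sums_unique2)
  then have "(norm v')\<^sup>2 = (norm u)\<^sup>2 + (norm v)\<^sup>2" by (simp add: f_def)
  then show thesis using that nth unfolding f_def by blast
qed

definition ell2_single :: "'i \<Rightarrow> 'a \<Rightarrow> ('i, 'a::complex_inner) ell2" where
  "ell2_single j a = Abs_ell2 (\<lambda>i. if i = j then a else 0)"

lemma ell2_nth_single: "ell2_nth (ell2_single j a) i = (if i = j then a else 0)"
proof -
  have "(\<lambda>i. (norm (if i = j then a else 0))\<^sup>2) summable_on UNIV"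
    by (rule finite_nonzero_values_imp_summable_on) (rule finite_subset[of _ "{j}"], auto)
  then show ?thesis by (simp add: ell2_single_def Abs_ell2_inverse)
qed

lemma cinner_ell2_single:
  "cinner (ell2_single j a) v = cinner a (ell2_nth v j)" "cinner v (ell2_single j a) = cinner (ell2_nth v j) a"
proof -
  have *: "(\<Sum>\<^sub>\<infinity>i. (if i = j then c else 0)) = c" for c :: complex
    using infsum_cong_neutral[of "{j}" UNIV "\<lambda>i. if i = j then c else 0" "\<lambda>i. if i = j then c else 0"] by simp
  show "cinner (ell2_single j a) v = cinner a (ell2_nth v j)"
    unfolding cinner_ell2_def ell2_nth_single
    by (subst *[symmetric], rule infsum_cong) auto
  then show "cinner v (ell2_single j a) = cinner (ell2_nth v j) a" by (metis cinner_commute)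
qed

text \<open>
  Convergence is along all finite subsets, because the rows of the backward Toeplitz matrix
  are summed in this sense.
\<close>

lemma ell2_has_sum_singles:
  fixes u :: "('i, 'a::complex_inner) ell2"
  shows "((\<lambda>j. ell2_single j (ell2_nth u j)) has_sum u) UNIV"
proof -
  define f where "f = (\<lambda>i. (norm (ell2_nth u i))\<^sup>2)"
  have hs: "(f has_sum (norm u)\<^sup>2) UNIV"
    unfolding ell2_norm_sq f_def by (rule has_sum_infsum[OF ell2_summable])
  \<comment> \<open>removing finitely many entries removes their share of the norm\<close>
  have rest: "(norm ((\<Sum>j\<in>F. ell2_single j (ell2_nth u j)) - u))\<^sup>2 = (norm u)\<^sup>2 - sum f F" if F: "finite F" for F
  proof -
    let ?v = "(\<Sum>j\<in>F. ell2_single j (ell2_nth u j)) - u"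
    have "ell2_nth (\<Sum>j\<in>F. ell2_single j (ell2_nth u j)) i = (if i \<in> F then ell2_nth u i else 0)" for i
      by (simp add: linear_sum[OF bounded_linear.linear[OF bounded_clinear_bl[OF bounded_clinear_ell2_nth]]]
          ell2_nth_single F)
    then have "(norm (ell2_nth ?v i))\<^sup>2 = f i - (if i \<in> F then f i else 0)" for i
      by (simp add: f_def)
    moreover have "((\<lambda>i. if i \<in> F then f i else 0) has_sum sum f F) UNIV"
      using has_sum_finite[OF F, of f] has_sum_cong_neutral[of UNIV F "\<lambda>i. if i \<in> F then f i else 0" f]
      by simp
    ultimately have "((\<lambda>i. (norm (ell2_nth ?v i))\<^sup>2) has_sum ((norm u)\<^sup>2 - sum f F)) UNIV"
      using has_sum_add[OF hs, of "\<lambda>i. - (if i \<in> F then f i else 0)" "- sum f F"]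
      by (simp only: has_sum_uminus) simp
    then show ?thesis unfolding ell2_norm_sq by (rule infsumI)
  qed
  have "((\<lambda>F. (norm ((\<Sum>j\<in>F. ell2_single j (ell2_nth u j)) - u))\<^sup>2) \<longlongrightarrow> 0) (finite_subsets_at_top UNIV)"
  proof (rule Lim_transform_eventually)
    show "((\<lambda>F. (norm u)\<^sup>2 - sum f F) \<longlongrightarrow> 0) (finite_subsets_at_top UNIV)"
      using tendsto_diff[OF tendsto_const hs[unfolded has_sum_def], of "(norm u)\<^sup>2"] by simp
    show "\<forall>\<^sub>F F in finite_subsets_at_top UNIV. (norm u)\<^sup>2 - sum f F
        = (norm ((\<Sum>j\<in>F. ell2_single j (ell2_nth u j)) - u))\<^sup>2"
      by (rule eventually_finite_subsets_at_top_weakI) (simp add: rest)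
  qed
  from tendsto_real_sqrt[OF this]
  have "((\<lambda>F. norm ((\<Sum>j\<in>F. ell2_single j (ell2_nth u j)) - u)) \<longlongrightarrow> 0) (finite_subsets_at_top UNIV)"
    by simp
  then show ?thesis
    unfolding has_sum_def by (rule LIM_zero_cancel[OF tendsto_norm_zero_cancel])
qed

section \<open>The observability, controllability and Toeplitz operators\<close>

text \<open>
  Both observability-type operators have this form: \<open>W\<^sub>o\<close> with the index map \<open>id\<close>, and \<open>W\<^sub>c\<^sup>*\<close> with the
  adjoint operators and time reversal as index map.
\<close>

definition obs_graph :: "('i \<Rightarrow> nat) \<Rightarrow> ('x::chilbert_space \<Rightarrow> 'x) \<Rightarrow> ('x \<Rightarrow> 'y::chilbert_space) \<Rightarrow> ('x \<times> ('i, 'y) ell2) set"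
  where "obs_graph e A C = {(x, v). \<forall>i. ell2_nth v i = C ((A ^^ e i) x)}"

text \<open>
  For a dissipative system the sequence is square-summable and \<open>Abs_ell2\<close> returns it; otherwise the
  value is meaningless.
\<close>

definition toeplitz_map ::
  "('i \<Rightarrow> nat) \<Rightarrow> ('x::chilbert_space \<Rightarrow> 'x) \<Rightarrow> ('u::chilbert_space \<Rightarrow> 'x) \<Rightarrow> ('x \<Rightarrow> 'y::chilbert_space) \<Rightarrow> ('u \<Rightarrow> 'y)
    \<Rightarrow> ('i, 'u) ell2 \<Rightarrow> ('i, 'y) ell2" where
  "toeplitz_map e A B C D u =
    Abs_ell2 (\<lambda>i. \<Sum>k\<le>e i. taylor_coeff A B C D (e i - k) (ell2_nth u (inv e k)))"

lemma bounded_clinear_funpow: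
  fixes A :: "'x::complex_inner \<Rightarrow> 'x"
  assumes "bounded_clinear A" shows "bounded_clinear (A ^^ n)"
proof (induction n)
  case 0 then show ?case by (simp add: bounded_clinear_def id_def bounded_linear_ident)
next
  case (Suc n)
  then show ?case
    using assms bounded_linear_compose[of A "A ^^ n"] by (simp add: bounded_clinear_def o_def)
qed

lemma bounded_clinear_taylor:
  assumes "bounded_clinear A" "bounded_clinear B" "bounded_clinear C" "bounded_clinear D"
  shows "bounded_clinear (taylor_coeff A B C D n)"
proof (cases n)
  case 0 then show ?thesis using assms(4) by (simp add: taylor_coeff_def[abs_def])
next
  case (Suc k)
  show ?thesis
    using bounded_linear_compose[OF bounded_clinear_bl[OF assms(3)]
        bounded_linear_compose[OF bounded_clinear_bl[OF bounded_clinear_funpow[OF assms(1), of k]] bounded_clinear_bl[OF assms(2)]]]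
    by (simp add: Suc taylor_coeff_def[abs_def] bounded_clinear_def
        assms(2,3)[THEN bounded_clinear_scaleC] bounded_clinear_funpow[OF assms(1), THEN bounded_clinear_scaleC])
qed

lemma cadjoint_funpow:
  fixes A :: "'x::chilbert_space \<Rightarrow> 'x"
  assumes A: "bounded_clinear A"
  shows "cinner ((A ^^ n) x) y = cinner x ((cadjoint A ^^ n) y)"
proof (induction n arbitrary: x)
  case (Suc n)
  have "(A ^^ Suc n) x = (A ^^ n) (A x)" by (simp add: funpow_swap1)
  then show ?case by (simp add: Suc cadjoint_cinner[OF A])
qed simp

lemma cadjoint_taylor:
  fixes A :: "'x::chilbert_space \<Rightarrow> 'x" and B :: "'u::chilbert_space \<Rightarrow> 'x"
    and C :: "'x \<Rightarrow> 'y::chilbert_space" and D :: "'u \<Rightarrow> 'y"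
  assumes "bounded_clinear A" "bounded_clinear B" "bounded_clinear C" "bounded_clinear D"
  shows "cinner (taylor_coeff A B C D n u) y
    = cinner u (taylor_coeff (cadjoint A) (cadjoint C) (cadjoint B) (cadjoint D) n y)"
  by (cases n) (simp_all add: taylor_coeff_def cadjoint_funpow assms[THEN cadjoint_cinner] assms(1))

lemma obs_graph_operator:
  fixes e :: "'i \<Rightarrow> nat"
  assumes "bounded_clinear A" "bounded_clinear C"
  shows "is_operator (obs_graph e A C)" "closed (obs_graph e A C)"
proof -
  note bd = bounded_clinear_funpow[OF assms(1)] assms(2)
  show "is_operator (obs_graph e A C)"
    unfolding is_operator_def obs_graph_def single_valued_def
    by (auto simp: bd[THEN bounded_clinear_add] bd[THEN bounded_clinear_scaleC] bd[THEN bounded_clinear_zero]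
        intro!: ell2_eqI)
  have "obs_graph e A C = (\<Inter>i. {p. ell2_nth (snd p) i = C ((A ^^ e i) (fst p))})"
    by (auto simp: obs_graph_def)
  moreover have "closed {p. ell2_nth (snd p) i = C ((A ^^ e i) (fst p))}" for i
    by (rule closed_Collect_eq[OF
          linear_continuous_on[OF bounded_linear_compose[OF bounded_clinear_bl[OF bounded_clinear_ell2_nth] bounded_linear_snd]]
          linear_continuous_on[OF bounded_linear_compose[OF bounded_clinear_bl[OF bd(2)]
            bounded_linear_compose[OF bounded_clinear_bl[OF bd(1)] bounded_linear_fst]]]])
  ultimately show "closed (obs_graph e A C)" by auto
qed

lemma obs_graph_injective:
  fixes e :: "'i \<Rightarrow> nat" and A :: "'x::chilbert_space \<Rightarrow> 'x" and C :: "'x \<Rightarrow> 'y::chilbert_space"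
  assumes bd: "bounded_clinear A" "bounded_clinear C" and e: "bij e"
    and dense: "closure (cspan (\<Union>k. range (\<lambda>y. (cadjoint A ^^ k) (cadjoint C y)))) = UNIV"
    and x: "(x, 0) \<in> obs_graph e A C"
  shows "x = 0"
proof -
  have C0: "C ((A ^^ k) x) = 0" for k
    using x surj_f_inv_f[OF bij_is_surj[OF e], of k] by (auto simp: obs_graph_def) metis
  define N where "N = {z. cinner x z = 0}"
  have "csubspace N" by (auto simp: N_def csubspace_def cinner_add_right cinner_scaleC_right)
  moreover have "(\<Union>k. range (\<lambda>y. (cadjoint A ^^ k) (cadjoint C y))) \<subseteq> N"
    using C0 by (auto simp: N_def cadjoint_funpow[OF bd(1), symmetric] cadjoint_cinner[OF bd(2), symmetric])
  ultimately have "cspan (\<Union>k. range (\<lambda>y. (cadjoint A ^^ k) (cadjoint C y))) \<subseteq> N" by (intro cspan_minimal)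
  then have "closure N = UNIV" using dense closure_mono by blast
  then show ?thesis
    using dense_iff_trivial_complement[OF csubspace_subspace[OF \<open>csubspace N\<close>]]
    by (auto simp: N_def inner_eq_Re_cinner) (metis cinner_commute complex_cnj_zero_iff zero_complex.simps(1))
qed

text \<open>
  \<open>M\<close> is the range of \<open>W\<^sub>c = (W\<^sub>c\<^sup>*)\<^sup>*\<close>. If \<open>W\<^sub>c v = x\<close>, then \<open>A x + B u\<close> is the image of \<open>v\<close> with \<open>u\<close>
  prepended: testing against \<open>\<xi>\<close>, the head of \<open>W\<^sub>c\<^sup>* \<xi>\<close> is \<open>B\<^sup>* \<xi>\<close> and its tail is \<open>W\<^sub>c\<^sup>* A\<^sup>* \<xi>\<close>. Starting from
  \<open>0\<close>, this puts all \<open>A\<^sup>k B u\<close> into \<open>M\<close>, and \<open>M\<close> is dense by controllability.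
\<close>

lemma reachable_space:
  fixes e :: "'j \<Rightarrow> nat" and A :: "'x::chilbert_space \<Rightarrow> 'x" and B :: "'u::chilbert_space \<Rightarrow> 'x"
  assumes bd: "bounded_clinear A" "bounded_clinear B" and e: "bij e"
    and dense: "closure (cspan (\<Union>k. range (\<lambda>u. (A ^^ k) (B u)))) = UNIV"
  defines "M \<equiv> Range (op_adjoint (obs_graph e (cadjoint A) (cadjoint B)))"
  shows "csubspace M" "x \<in> M \<Longrightarrow> A x + B u \<in> M" "closure M = UNIV"
proof -
  show sub: "csubspace M"
    unfolding csubspace_def M_def
    using op_adjoint_zero op_adjoint_add op_adjoint_scaleC by (meson Range_iff)
  show inv: "A x + B u \<in> M" if x: "x \<in> M" for x u
  proof -
    obtain v where v: "(v, x) \<in> op_adjoint (obs_graph e (cadjoint A) (cadjoint B))" using x unfolding M_def by blast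
    obtain v' :: "('j, 'u) ell2" where v': "\<And>k. ell2_nth v' (inv e k) = (case k of 0 \<Rightarrow> u | Suc k \<Rightarrow> ell2_nth v (inv e k))"
      by (rule ell2_cons[OF e]) blast
    have "cinner \<eta> v' = cinner \<xi> (A x + B u)" if \<eta>: "(\<xi>, \<eta>) \<in> obs_graph e (cadjoint A) (cadjoint B)" for \<xi> \<eta>
    proof -
      have nth: "ell2_nth \<eta> (inv e k) = cadjoint B ((cadjoint A ^^ k) \<xi>)" for k
        using \<eta> by (simp add: obs_graph_def surj_f_inv_f[OF bij_is_surj[OF e]])
      have "(\<Sum>k<n. (norm (ell2_nth \<eta> (inv e (Suc k))))\<^sup>2) \<le> (norm \<eta>)\<^sup>2" for n
        using ell2_partial_sum_le[OF e, of \<eta> "Suc n"] by (subst (asm) sum.lessThan_Suc_shift)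
          (smt (verit) zero_le_power2)
      then obtain \<eta>' :: "('j, 'u) ell2" where \<eta>': "\<And>i. ell2_nth \<eta>' i = ell2_nth \<eta> (inv e (Suc (e i)))"
        by (rule ell2_of_sequence[OF e]) blast
      have "(cadjoint A \<xi>, \<eta>') \<in> obs_graph e (cadjoint A) (cadjoint B)"
        by (simp add: obs_graph_def \<eta>' nth funpow_swap1)
      then have *: "cinner \<eta>' v = cinner (cadjoint A \<xi>) x" using v by (auto simp: op_adjoint_iff)
      define g where "g = (\<lambda>k. cinner (ell2_nth \<eta> (inv e k)) (ell2_nth v' (inv e k)))"
      have "(\<lambda>k. g (Suc k)) sums cinner \<eta>' v"
        using ell2_sums_cinner[OF e, of \<eta>' v] by (simp add: g_def v' \<eta>' surj_f_inv_f[OF bij_is_surj[OF e]])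
      then have "g sums (cinner \<eta>' v + g 0)" by (rule sums_Suc)
      moreover have "g sums cinner \<eta> v'" unfolding g_def by (rule ell2_sums_cinner[OF e])
      ultimately have "cinner \<eta> v' = cinner (cadjoint A \<xi>) x + cinner (cadjoint B \<xi>) u"
        using sums_unique2 * by (fastforce simp: g_def v' nth)
      also have "\<dots> = cinner \<xi> (A x + B u)"
        using cadjoint_cinner[OF bounded_clinear_cadjoint[OF bd(1)], of \<xi> x]
          cadjoint_cinner[OF bounded_clinear_cadjoint[OF bd(2)], of \<xi> u]
        by (simp add: cadjoint_cadjoint[OF bd(1)] cadjoint_cadjoint[OF bd(2)] cinner_add_right)
      finally show ?thesis .
    qed
    then have "(v', A x + B u) \<in> op_adjoint (obs_graph e (cadjoint A) (cadjoint B))" by (auto simp: op_adjoint_iff)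
    then show ?thesis unfolding M_def by blast
  qed
  have "0 \<in> M" using sub by (simp add: csubspace_def)
  have "(A ^^ k) (B u) \<in> M" for k u
  proof (induction k)
    case 0 then show ?case using inv[OF \<open>0 \<in> M\<close>, of u] by (simp add: bounded_clinear_zero[OF bd(1)])
  next
    case (Suc k) then show ?case using inv[of "(A ^^ k) (B u)" 0] by (simp add: bounded_clinear_zero[OF bd(2)])
  qed
  then have "cspan (\<Union>k. range (\<lambda>u. (A ^^ k) (B u))) \<subseteq> M" by (intro cspan_minimal sub) auto
  then show "closure M = UNIV" using dense closure_mono by blast
qed

lemma state_zero_output:
  assumes A: "bounded_clinear A" and C: "bounded_clinear C"
  shows "C (state A B 0 u n) + D (u n) = (\<Sum>j\<le>n. taylor_coeff A B C D (n - j) (u j))"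
  using state_output[OF A C, where x=0 and B=B and u=u and n=n and D=D] bounded_clinear_funpow[OF A, THEN bounded_clinear_zero] bounded_clinear_zero[OF C]
  by simp

lemma toeplitz_map_contraction:
  fixes e :: "'i \<Rightarrow> nat" and A :: "'x::chilbert_space \<Rightarrow> 'x" and B :: "'u::chilbert_space \<Rightarrow> 'x"
    and C :: "'x \<Rightarrow> 'y::chilbert_space" and D :: "'u \<Rightarrow> 'y"
  assumes bd: "bounded_clinear A" "bounded_clinear B" "bounded_clinear C" "bounded_clinear D"
    and e: "bij e" and dis: "dissipative A B C D"
  shows "ell2_nth (toeplitz_map e A B C D u) i
      = (\<Sum>k\<le>e i. taylor_coeff A B C D (e i - k) (ell2_nth u (inv e k)))"
    and "norm (toeplitz_map e A B C D u) \<le> norm u"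
    and "bounded_clinear (toeplitz_map e A B C D)"
proof -
  define f where "f = (\<lambda>(u :: ('i, 'u) ell2) n. \<Sum>k\<le>n. taylor_coeff A B C D (n - k) (ell2_nth u (inv e k)))"
  have le: "(\<Sum>k<n. (norm (f u k))\<^sup>2) \<le> (norm u)\<^sup>2" for u n
  proof -
    have "(\<Sum>k<n. (norm (f u k))\<^sup>2) \<le> (\<Sum>k<n. (norm (ell2_nth u (inv e k)))\<^sup>2)"
      using dis[unfolded dissipative_def state_zero_output[OF bd(1,3)], rule_format, of "\<lambda>k. ell2_nth u (inv e k)" n]
      by (simp add: f_def)
    then show ?thesis using ell2_partial_sum_le[OF e, of u n] by linarith
  qed
  have *: "(\<forall>i. ell2_nth (toeplitz_map e A B C D u) i = f u (e i)) \<and> (norm (toeplitz_map e A B C D u))\<^sup>2 \<le> (norm u)\<^sup>2" for u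
  proof -
    obtain v :: "('i, 'y) ell2" where v: "\<And>i. ell2_nth v i = f u (e i)" "(norm v)\<^sup>2 \<le> (norm u)\<^sup>2"
      by (rule ell2_of_sequence[OF e le]) blast
    have "toeplitz_map e A B C D u = Abs_ell2 (ell2_nth v)"
    proof -
      have "ell2_nth v = (\<lambda>i. f u (e i))" using v(1) by blast
      then show ?thesis by (simp only: toeplitz_map_def f_def)
    qed
    then have "toeplitz_map e A B C D u = v" by (simp add: ell2_nth_inverse)
    then show ?thesis using v by simp
  qed
  show "ell2_nth (toeplitz_map e A B C D u) i
      = (\<Sum>k\<le>e i. taylor_coeff A B C D (e i - k) (ell2_nth u (inv e k)))" for u i
    using * by (simp add: f_def)
  show n: "norm (toeplitz_map e A B C D u) \<le> norm u" for u using *[of u] by simp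
  note tc = bounded_clinear_taylor[OF bd]
  have "toeplitz_map e A B C D (u + v) = toeplitz_map e A B C D u + toeplitz_map e A B C D v" for u v
    by (rule ell2_eqI) (simp add: * f_def bounded_clinear_add[OF tc] sum.distrib)
  moreover have "toeplitz_map e A B C D (r *\<^sub>R u) = r *\<^sub>R toeplitz_map e A B C D u" for r u
    by (rule ell2_eqI) (simp add: * f_def bounded_clinear_scaleR[OF tc] scaleR_sum_right)
  moreover have "toeplitz_map e A B C D (c *\<^sub>C u) = c *\<^sub>C toeplitz_map e A B C D u" for c u
    by (rule ell2_eqI)
      (simp add: * f_def bounded_clinear_scaleC[OF tc] linear_sum[OF bounded_linear.linear[OF bounded_linear_scaleC]])
  ultimately show "bounded_clinear (toeplitz_map e A B C D)"
    unfolding bounded_clinear_def by (auto intro!: bounded_linear_intro[where K=1] simp: n)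
qed

text \<open>
  One statement covers \<open>X\<^sub>a\<close> and \<open>X\<^sub>r\<close>: the former with the future as the index set of outputs, the
  latter for the adjoint system with the two index sets exchanged.
\<close>

lemma available_storage_of_system:
  fixes e :: "'i \<Rightarrow> nat" and e' :: "'j \<Rightarrow> nat"
    and A :: "'x::chilbert_space \<Rightarrow> 'x" and B :: "'u::chilbert_space \<Rightarrow> 'x"
    and C :: "'x \<Rightarrow> 'y::chilbert_space" and D :: "'u \<Rightarrow> 'y"
  assumes bd: "bounded_clinear A" "bounded_clinear B" "bounded_clinear C" "bounded_clinear D"
    and e: "bij e" and e': "bij e'" and dis: "dissipative A B C D" and minimal: "minimal_system A B C"
    and Wc: "Wc = (obs_graph e' (cadjoint A) (cadjoint B) :: ('x \<times> ('j, 'u) ell2) set)"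
    and Def: "Def = defect (op_adjoint (graph_of (toeplitz_map e A B C D)))"
    and X: "X = (THE X. closable X \<and> Domain X = Range (op_adjoint Wc) \<and> Range X \<subseteq> orth_compl (op_kernel Def) \<and>
      op_restrict (obs_graph e A C) (Range (op_adjoint Wc)) = X O Def)"
  shows "kyp_solution A B C D (closure X O op_adjoint (closure X))"
proof -
  let ?t = "toeplitz_map e A B C D"
  note t_nth = toeplitz_map_contraction(1)[OF bd e dis]
    and t_contr = toeplitz_map_contraction(2)[OF bd e dis]
    and t_lin = toeplitz_map_contraction(3)[OF bd e dis]
  note ee = surj_f_inv_f[OF bij_is_surj[OF e]]
  have dense: "closure (cspan (\<Union>k. range (\<lambda>u. (A ^^ k) (B u)))) = UNIV"
    "closure (cspan (\<Union>k. range (\<lambda>y. (cadjoint A ^^ k) (cadjoint C y)))) = UNIV"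
    using minimal by (auto simp: minimal_system_def)
  show ?thesis
  proof (rule available_storage_solution[OF bd t_lin t_contr obs_graph_operator[OF bd(1,3)]
        obs_graph_injective[OF bd(1,3) e dense(2)]
        reachable_space(1)[OF bd(1,2) e' dense(1), folded Wc] reachable_space(3)[OF bd(1,2) e' dense(1), folded Wc]
        reachable_space(2)[OF bd(1,2) e' dense(1), folded Wc] _ _ Def X])
    fix x assume "x \<in> Range (op_adjoint Wc)"
    then obtain v where v: "(v, x) \<in> op_adjoint Wc" by blast
    have bound: "(\<Sum>i<n. (norm (C (state A B x u i) + D (u i)))\<^sup>2) \<le> (norm v)\<^sup>2 + (\<Sum>i<n. (norm (u i))\<^sup>2)" for u n
    proof (rule dissipative_output_bound[OF bd dis])
      fix \<xi> r assume "\<And>m. (\<Sum>k<m. (norm (cadjoint B ((cadjoint A ^^ k) \<xi>)))\<^sup>2) \<le> r"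
      then obtain \<eta> :: "('j, 'u) ell2" where \<eta>: "\<And>i. ell2_nth \<eta> i = cadjoint B ((cadjoint A ^^ e' i) \<xi>)" "(norm \<eta>)\<^sup>2 \<le> r"
        by (rule ell2_of_sequence[OF e']) blast
      then have "(\<xi>, \<eta>) \<in> Wc" by (simp add: Wc obs_graph_def)
      then have "cinner \<eta> v = cinner \<xi> x" using v by (auto simp: op_adjoint_iff)
      then have "inner x \<xi> = inner v \<eta>" by (metis inner_eq_Re_cinner inner_commute)
      then show "2 * inner x \<xi> \<le> (norm v)\<^sup>2 + r" using two_inner_le[of v \<eta>] \<eta>(2) by simp
    qed
    have "(\<Sum>k<n. (norm (C ((A ^^ k) x)))\<^sup>2) \<le> (norm v)\<^sup>2" for n
    proof -
      have "C (state A B x (\<lambda>_. 0) k) + D 0 = C ((A ^^ k) x)" for k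
        using state_free[of 0 B "\<lambda>_. 0" A x k] bd[THEN bounded_clinear_zero] by simp
      then show ?thesis using bound[of "\<lambda>_. 0" n] by simp
    qed
    then obtain w :: "('i, 'y) ell2" where w: "\<And>i. ell2_nth w i = C ((A ^^ e i) x)"
      by (rule ell2_of_sequence[OF e]) blast
    have "(norm (w + ?t u))\<^sup>2 \<le> (norm v)\<^sup>2 + (norm u)\<^sup>2" for u
    proof (rule ell2_norm_le[OF e])
      fix n
      have "ell2_nth (w + ?t u) (inv e k) = C (state A B x (\<lambda>k. ell2_nth u (inv e k)) k) + D (ell2_nth u (inv e k))" for k
        by (simp add: w t_nth ee state_output[OF bd(1,3), where B=B and D=D and u="\<lambda>k. ell2_nth u (inv e k)" and n=k])
      then show "(\<Sum>k<n. (norm (ell2_nth (w + ?t u) (inv e k)))\<^sup>2) \<le> (norm v)\<^sup>2 + (norm u)\<^sup>2"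
        using bound[of "\<lambda>k. ell2_nth u (inv e k)" n] ell2_partial_sum_le[OF e, of u n] by simp
    qed
    then show "\<exists>w c. (x, w) \<in> obs_graph e A C \<and> (\<forall>u. (norm (w + ?t u))\<^sup>2 \<le> c + (norm u)\<^sup>2)"
      using w by (auto simp: obs_graph_def)
  next
    fix x w u w' v assume w: "(x, w) \<in> obs_graph e A C" and w': "(A x + B u, w') \<in> obs_graph e A C"
    obtain u' :: "('i, 'u) ell2" where u': "\<And>k. ell2_nth u' (inv e k) = (case k of 0 \<Rightarrow> u | Suc k \<Rightarrow> ell2_nth v (inv e k))"
      "(norm u')\<^sup>2 = (norm u)\<^sup>2 + (norm v)\<^sup>2"
      by (rule ell2_cons[OF e]) blast
    define g where "g = (\<lambda>k. (norm (ell2_nth (w + ?t u') (inv e k)))\<^sup>2)"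
    have g0: "g 0 = (norm (C x + D u))\<^sup>2"
      using w by (simp add: g_def t_nth ee obs_graph_def u' taylor_coeff_def)
    have "ell2_nth (w + ?t u') (inv e (Suc k)) = ell2_nth (w' + ?t v) (inv e k)" for k
    proof -
      have "ell2_nth (w + ?t u') (inv e (Suc k)) = (C ((A ^^ Suc k) x) + taylor_coeff A B C D (Suc k) u)
          + (\<Sum>j\<le>k. taylor_coeff A B C D (k - j) (ell2_nth v (inv e j)))"
        using w by (simp add: t_nth ee obs_graph_def u' sum.atMost_Suc_shift add.assoc del: sum.atMost_Suc funpow.simps)
      also have "C ((A ^^ Suc k) x) + taylor_coeff A B C D (Suc k) u = C ((A ^^ k) (A x + B u))"
        by (simp add: taylor_coeff_def funpow_add[OF bd(1)] bounded_clinear_add[OF bd(3)] funpow_swap1)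
      finally show ?thesis using w' by (simp add: t_nth ee obs_graph_def)
    qed
    then have "(\<lambda>k. g (Suc k)) sums (norm (w' + ?t v))\<^sup>2"
      using ell2_sums_norm[OF e, of "w' + ?t v"] by (simp only: g_def)
    then have "g sums ((norm (w' + ?t v))\<^sup>2 + g 0)" by (rule sums_Suc)
    moreover have "g sums (norm (w + ?t u'))\<^sup>2" unfolding g_def by (rule ell2_sums_norm[OF e])
    ultimately have "(norm (w' + ?t v))\<^sup>2 + (norm (C x + D u))\<^sup>2 = (norm (w + ?t u'))\<^sup>2"
      using sums_unique2 g0 by metis
    then show "\<exists>u'. (norm (w' + ?t v))\<^sup>2 + (norm (C x + D u))\<^sup>2 = (norm (w + ?t u'))\<^sup>2 \<and>
        (norm u')\<^sup>2 = (norm u)\<^sup>2 + (norm v)\<^sup>2"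
      using u'(2) by blast
  qed
qed

section \<open>The available storage and the required supply\<close>

definition past_index :: "zneg \<Rightarrow> nat" where
  "past_index n = nat (- int_of_zneg n - 1)"

lemma int_past_index: "int (past_index n) = - int_of_zneg n - 1"
  using int_of_zneg[of n] by (simp add: past_index_def)

lemma bij_past_index: "bij past_index"
proof (rule bijI)
  show "inj past_index"
    by (rule injI) (metis int_past_index int_of_zneg_inject add.inverse_inverse diff_add_cancel)
  show "surj past_index"
  proof (rule surjI)
    show "past_index (Abs_zneg (- int n - 1)) = n" for n
      by (simp add: past_index_def Abs_zneg_inverse)
  qed
qed

text \<open>
  The backward Toeplitz matrix \<open>[F\<^bsub>i-j\<^esub>]\<close> over the negative integers is, after time reversal, the
  adjoint of the lower triangular Toeplitz matrix with symbol coefficients \<open>F\<^sub>n\<^sup>*\<close>. The adjoint is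
  bounded, so applying it to \<open>u = \<Sum> single j u\<^sub>j\<close> shows that every row sum converges to the
  right value, and the graph defined by convergence of the row sums is everywhere defined.
\<close>

lemma toeplitz_past_eq:
  fixes A :: "'x::chilbert_space \<Rightarrow> 'x" and B :: "'u::chilbert_space \<Rightarrow> 'x"
    and C :: "'x \<Rightarrow> 'y::chilbert_space" and D :: "'u \<Rightarrow> 'y"
  assumes bd: "bounded_clinear A" "bounded_clinear B" "bounded_clinear C" "bounded_clinear D"
    and dis: "dissipative (cadjoint A) (cadjoint C) (cadjoint B) (cadjoint D)"
  shows "toeplitz_past A B C D
    = op_adjoint (graph_of (toeplitz_map past_index (cadjoint A) (cadjoint C) (cadjoint B) (cadjoint D)))"
proof -
  let ?t = "toeplitz_map past_index (cadjoint A) (cadjoint C) (cadjoint B) (cadjoint D)"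
  let ?T = "taylor_coeff A B C D"
  note bs = bd(1,3,2,4)[THEN bounded_clinear_cadjoint]
  note t_nth = toeplitz_map_contraction(1)[OF bs bij_past_index dis]
    and t_lin = toeplitz_map_contraction(3)[OF bs bij_past_index dis]
  define g where "g = cadjoint ?t"
  have g_lin: "bounded_clinear g" unfolding g_def by (rule bounded_clinear_cadjoint[OF t_lin])
  have g: "cinner (g u) v = cinner u (?t v)" for u v
    using cadjoint_cinner[OF g_lin] by (simp add: g_def cadjoint_cadjoint[OF t_lin])
  have g_single: "ell2_nth (g (ell2_single j a)) i
      = (if past_index i \<le> past_index j then ?T (past_index j - past_index i) a else 0)" for i j a
  proof -
    have "cinner (ell2_nth (g (ell2_single j a)) i) y
      = cinner (if past_index i \<le> past_index j then ?T (past_index j - past_index i) a else 0) y" for y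
    proof -
      have "cinner (ell2_nth (g (ell2_single j a)) i) y = cinner a (ell2_nth (?t (ell2_single i y)) j)"
        by (simp add: g flip: cinner_ell2_single)
      also have "ell2_nth (?t (ell2_single i y)) j
        = (\<Sum>k\<le>past_index j. if k = past_index i
            then taylor_coeff (cadjoint A) (cadjoint C) (cadjoint B) (cadjoint D) (past_index j - past_index i) y else 0)"
        unfolding t_nth
      proof (intro sum.cong refl)
        fix k
        have "inv past_index k = i \<longleftrightarrow> k = past_index i"
          using bij_inv_eq_iff[OF bij_past_index] by metis
        then show "taylor_coeff (cadjoint A) (cadjoint C) (cadjoint B) (cadjoint D) (past_index j - k)
            (ell2_nth (ell2_single i y) (inv past_index k)) = (if k = past_index i
            then taylor_coeff (cadjoint A) (cadjoint C) (cadjoint B) (cadjoint D) (past_index j - past_index i) y else 0)"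
          by (simp add: ell2_nth_single bounded_clinear_zero[OF bounded_clinear_taylor[OF bs]])
      qed
      finally show ?thesis by (simp add: cadjoint_taylor[OF bd])
    qed
    then show ?thesis by (rule cinner_right_ext)
  qed
  have has_sum: "((\<lambda>j. ?T (nat (int_of_zneg i - int_of_zneg j)) (ell2_nth u j))
      has_sum ell2_nth (g u) i) {j. int_of_zneg j \<le> int_of_zneg i}" for u i
  proof -
    have bl: "bounded_linear (\<lambda>u. ell2_nth (g u) i)"
      by (rule bounded_linear_compose[OF bounded_clinear_bl[OF bounded_clinear_ell2_nth] bounded_clinear_bl[OF g_lin]])
    have "((\<lambda>j. ell2_nth (g (ell2_single j (ell2_nth u j))) i) has_sum ell2_nth (g u) i) UNIV"
      using has_sum_bounded_linear[OF bl ell2_has_sum_singles[of u]] by (simp add: o_def)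
    moreover have "ell2_nth (g (ell2_single j (ell2_nth u j))) i = ?T (nat (int_of_zneg i - int_of_zneg j)) (ell2_nth u j)"
      if "j \<in> {j. int_of_zneg j \<le> int_of_zneg i}" for j
    proof -
      have "past_index i \<le> past_index j" "past_index j - past_index i = nat (int_of_zneg i - int_of_zneg j)"
        using that int_past_index[of i] int_past_index[of j] by auto
      then show ?thesis by (simp add: g_single)
    qed
    moreover have "ell2_nth (g (ell2_single j (ell2_nth u j))) i = 0" if "j \<in> UNIV - {j. int_of_zneg j \<le> int_of_zneg i}" for j
    proof -
      have "\<not> past_index i \<le> past_index j"
        using that int_past_index[of i] int_past_index[of j] by auto
      then show ?thesis by (simp add: g_single)
    qed
    ultimately show ?thesis
      using has_sum_cong_neutral[of "{j. int_of_zneg j \<le> int_of_zneg i}" UNIV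
          "\<lambda>j. ?T (nat (int_of_zneg i - int_of_zneg j)) (ell2_nth u j)" "\<lambda>j. ell2_nth (g (ell2_single j (ell2_nth u j))) i"]
      by blast
  qed
  have "(u, v) \<in> toeplitz_past A B C D \<longleftrightarrow> v = g u" for u v
  proof
    assume "(u, v) \<in> toeplitz_past A B C D"
    then show "v = g u"
      unfolding toeplitz_past_def by (intro ell2_eqI) (auto intro: has_sum_unique[OF _ has_sum])
  qed (simp add: toeplitz_past_def has_sum)
  then have "toeplitz_past A B C D = graph_of g" by auto
  then show ?thesis by (simp add: op_adjoint_graph_of[OF t_lin] g_def)
qed

lemma minimal_system_adjoint:
  assumes "bounded_clinear A" "bounded_clinear B" "minimal_system A B C"
  shows "minimal_system (cadjoint A) (cadjoint C) (cadjoint B)"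
  using assms by (simp add: minimal_system_def cadjoint_cadjoint)

lemma H_avail_solution:
  fixes A :: "'x::chilbert_space \<Rightarrow> 'x" and B :: "'u::chilbert_space \<Rightarrow> 'x"
    and C :: "'x \<Rightarrow> 'y::chilbert_space" and D :: "'u \<Rightarrow> 'y"
  assumes bd: "bounded_clinear A" "bounded_clinear B" "bounded_clinear C" "bounded_clinear D"
    and minimal: "minimal_system A B C" and dis: "dissipative A B C D"
  shows "kyp_solution A B C D (H_avail A B C D)"
proof -
  have Wc: "ctr_op_adj A B = obs_graph past_index (cadjoint A) (cadjoint B)"
    by (simp add: ctr_op_adj_def obs_graph_def past_index_def)
  have Wo: "obs_op A C = obs_graph id A C" by (simp add: obs_op_def obs_graph_def)
  have "toeplitz_future A B C D = graph_of (toeplitz_map id A B C D)"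
  proof -
    have "(u, v) \<in> toeplitz_future A B C D \<longleftrightarrow> v = toeplitz_map id A B C D u" for u v
      by (auto simp: toeplitz_future_def toeplitz_map_contraction(1)[OF bd bij_id dis] intro!: ell2_eqI)
    then show ?thesis by auto
  qed
  then have Def: "defect (op_adjoint (toeplitz_future A B C D)) = defect (op_adjoint (graph_of (toeplitz_map id A B C D)))"
    by simp
  show ?thesis
    unfolding H_avail_def
    by (rule available_storage_of_system[OF bd bij_id bij_past_index dis minimal Wc Def])
      (simp add: X_avail_def Let_def ctr_op_def Wo)
qed

text \<open>
  \<open>X\<^sub>r\<close> is the available-storage operator of the adjoint system: its observability operator is
  \<open>W\<^sub>c\<^sup>*\<close>, its controllability operator is \<open>W\<^sub>o\<^sup>*\<close>, and its Toeplitz operator is the adjoint of the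
  backward Toeplitz operator.
\<close>

lemma H_req_inverse_solution:
  fixes A :: "'x::chilbert_space \<Rightarrow> 'x" and B :: "'u::chilbert_space \<Rightarrow> 'x"
    and C :: "'x \<Rightarrow> 'y::chilbert_space" and D :: "'u \<Rightarrow> 'y"
  assumes bd: "bounded_clinear A" "bounded_clinear B" "bounded_clinear C" "bounded_clinear D"
    and minimal: "minimal_system A B C" and dis: "dissipative A B C D"
  shows "kyp_solution (cadjoint A) (cadjoint C) (cadjoint B) (cadjoint D) ((H_req A B C D)\<inverse>)"
proof -
  note bs = bd(1,3,2,4)[THEN bounded_clinear_cadjoint]
  have dis': "dissipative (cadjoint A) (cadjoint C) (cadjoint B) (cadjoint D)"
    by (rule dissipative_adjoint[OF bd dis])
  have Wc: "obs_op A C = obs_graph id (cadjoint (cadjoint A)) (cadjoint (cadjoint C))"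
    by (simp add: obs_op_def obs_graph_def cadjoint_cadjoint[OF bd(1)] cadjoint_cadjoint[OF bd(3)])
  have Wo: "ctr_op_adj A B = obs_graph past_index (cadjoint A) (cadjoint B)"
    by (simp add: ctr_op_adj_def obs_graph_def past_index_def)
  show ?thesis
    unfolding H_req_def converse_converse
    by (rule available_storage_of_system[OF bs bij_past_index bij_id dis'
          minimal_system_adjoint[OF bd(1,2) minimal] Wc arg_cong[where f=defect, OF toeplitz_past_eq[OF bd dis']]])
      (simp add: X_req_def Let_def obs_op_adj_def Wo)
qed

theorem proposition5p5:
  fixes A :: "'x::chilbert_space \<Rightarrow> 'x"
    and B :: "'u::chilbert_space \<Rightarrow> 'x"
    and C :: "'x \<Rightarrow> 'y::chilbert_space"
    and D :: "'u \<Rightarrow> 'y"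
  assumes "bounded_clinear A" "bounded_clinear B" "bounded_clinear C" "bounded_clinear D"
    and "minimal_system A B C"
    and "has_schur_continuation A B C D"
  shows
    "(\<forall>H \<in> {H_avail A B C D, H_req A B C D}.
        storage_function A B C D (quadratic_storage H) \<and> nondegenerate (quadratic_storage H) \<and>
        positive_definite H \<and> kyp_inequality A B C D H) \<and>
     (\<forall>H \<in> {(H_req A B C D)\<inverse>, (H_avail A B C D)\<inverse>}.
        adjoint_storage_function A B C D (quadratic_storage H) \<and>
        positive_definite H \<and> adjoint_kyp_inequality A B C D H)"
proof -
  note bd = assms(1-4)
  note bs = bd(1,3,2,4)[THEN bounded_clinear_cadjoint]
  have dis: "dissipative A B C D" by (rule schur_dissipative[OF bd(1,3) assms(6)])
  have a: "kyp_solution A B C D (H_avail A B C D)"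
    and r': "kyp_solution (cadjoint A) (cadjoint C) (cadjoint B) (cadjoint D) ((H_req A B C D)\<inverse>)"
    by (rule H_avail_solution[OF bd assms(5) dis] H_req_inverse_solution[OF bd assms(5) dis])+
  have a': "kyp_solution (cadjoint A) (cadjoint C) (cadjoint B) (cadjoint D) ((H_avail A B C D)\<inverse>)"
    by (rule kyp_solution_inverse[OF bd a])
  have r: "kyp_solution A B C D (H_req A B C D)"
    using kyp_solution_inverse[OF bs r'] by (simp add: bd[THEN cadjoint_cadjoint])
  have "storage_function A B C D (quadratic_storage H) \<and> nondegenerate (quadratic_storage H) \<and>
      positive_definite H \<and> kyp_inequality A B C D H" if "kyp_solution A B C D H" for H
    using kyp_solution_storage_function kyp_solution_nondegenerate kyp_solution_positive_definite
      kyp_solution_kyp_inequality[OF bd(1,2)] that by blast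
  moreover have "adjoint_storage_function A B C D (quadratic_storage H) \<and>
      positive_definite H \<and> adjoint_kyp_inequality A B C D H"
    if "kyp_solution (cadjoint A) (cadjoint C) (cadjoint B) (cadjoint D) H" for H
    using kyp_solution_adjoint_storage_function kyp_solution_positive_definite
      kyp_solution_kyp_inequality[OF bs(1,2)] that unfolding adjoint_kyp_inequality_def by blast
  ultimately show ?thesis using a a' r r' by blast
qed

end
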